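(* Let $\nu\in\mathcal{R}$, let $U$ be a nonempty open subset of $\mathbb{R}^d$, and let $\Pi$ be a Poisson point measure on $(0,1]\times U$ with intensity $\nu\otimes\mathcal{L}^d(\cdot\cap U)$. Let $F_\nu=\{y\in\mathbb{R}^d:\int_{(0,1]\times U}\mathbf{1}_{\{|y-x|<r\}}\,\Pi(dr,dx)=\infty\}$. If $\nu\notin\mathcal{R}_d$, then almost surely $F_\nu$ has full Lebesgue measure in $U$. If $\nu\in\mathcal{R}_d$, then almost surely $F_\nu$ is $\nu$-describable in $U$.
   Context: A Poisson point measure on a locally compact second-countable space $S$ with Radon intensity $\pi$ is a random point measure $\Pi$ such that $\Pi(E)$ is Poisson with parameter $\pi(E)$ for every Borel $E$, and $\Pi(E_1),\dots,\Pi(E_n)$ are independent for pairwise disjoint Borel $E_1,\dots,E_n$. Fix $d\ge1$ and a norm $|\cdot|$ on $\mathbb{R}^d$ (diameters are taken with respect to it); $\mathcal{L}^d$ is Lebesgue measure. A gauge function is a function $g:[0,\infty]\to[0,\infty]$ that is nondecreasing on a neighbourhood of $0$ and satisfies $\lim_{r\to0}g(r)=g(0)=0$, $g(\infty)=\infty$; $\mathfrak{G}$ denotes the set of gauge functions. $\mathcal{H}^g$ is the Hausdorff $g$-measure: $\mathcal{H}^g(E)=\lim_{\delta\downarrow0}\inf\{\sum_ng(\mathrm{diam}\,C_n):E\subseteq\bigcup_nC_n,\ \mathrm{diam}\,C_n\le\delta\}$. The $d$-normalization of $g$ is $g_d(r)=r^d\inf_{0<\rho\le r}g(\rho)/\rho^d$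 for $r\in(0,\infty)$, $g_d(0)=0$, $g_d(\infty)=\infty$; $g$ is $d$-normalized if $g=g_d$ on a neighbourhood of $0$. Let $\ell_g=\liminf_{r\to0}g(r)/r^d$, $\mathfrak{G}^\infty=\{g\in\mathfrak{G}:\ell_g=\infty\}$, $\mathfrak{G}^*=\{g\in\mathfrak{G}:\ell_g\in(0,\infty]\}$. For $d$-normalized gauge functions $g,h$ write $h\prec g$ if $h(r)/g(r)$ increases monotonically to $\infty$ as $r\downarrow0$ (with the convention that $h\prec g$ for every $h$ if $g$ vanishes on a neighbourhood of $0$). Dyadic cubes are the sets $2^{-j}(k+[0,1)^d)$, $j\in\mathbb{Z}$, $k\in\mathbb{Z}^d$. For a $d$-normalized gauge function $h$, let $\varepsilon_h$ be the supremum of those $\varepsilon>0$ such that $h$ is nondecreasing on $[0,\varepsilon]$ and $r\mapsto h(r)/r^d$ is nonincreasing on $(0,\varepsilon]$, and let $\mathcal{M}^h_\infty(E)=\inf\sum_nh(\mathrm{diam}\,\lambda_n)$, the infimum over all countable coverings of $E$ by dyadic cubes $\lambda_n$ of diameter less than $\varepsilon_h$. For a gauge function $g$ and a nonempty open set $U\subseteq\mathbb{R}^d$, the large intersection class $G^g(U)$ is the collection of $G_\delta$ subsets $F\subseteq\mathbb{R}^d$ such that $\mathcal{M}^h_\infty(F\cap V)=\mathcal{M}^h_\infty(V)$ for every $d$-normalized gauge function $h$ with $h\prec g_d$ and every open $V\subseteq U$. Let $\mathcal{Z}(U)$ be the set of Borel sets $E$ with $\mathcal{L}^d(E\cap U)=0$;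 for such $E$, the majorizing collection is $\mathfrak{M}(E,U)=\{g\in\mathfrak{G}^\infty:\mathcal{H}^g(E\cap U)=0\}$ and the minorizing collection is $\mathfrak{m}(E,U)=\{g\in\mathfrak{G}^*:\exists F\in G^g(U),\ F\subseteq E\}$. Let $\mathcal{R}$ be the set of positive Borel measures $\mathfrak{n}$ on $(0,1]$ with infinite total mass and $\mathfrak{n}([\rho,1])<\infty$ for all $\rho\in(0,1]$, and $\mathcal{R}_d=\{\mathfrak{n}\in\mathcal{R}:\int_{(0,1]}r^d\,\mathfrak{n}(dr)<\infty\}$. For $\mathfrak{n}\in\mathcal{R}_d$, $\mathfrak{G}(\mathfrak{n})=\{g\in\mathfrak{G}^\infty:\int_{(0,1]}g_d\,d\mathfrak{n}=\infty\}$ and $\mathfrak{G}(\mathfrak{n})^\complement=\mathfrak{G}^\infty\setminus\mathfrak{G}(\mathfrak{n})$. A set $E$ is $\mathfrak{n}$-describable in $U$ if $E\in\mathcal{Z}(U)$, $\mathfrak{M}(E,U)=\mathfrak{G}(\mathfrak{n})^\complement$ and $\mathfrak{m}(E,U)\cap\mathfrak{G}^\infty=\mathfrak{G}(\mathfrak{n})$. For $\mathfrak{s}\in[0,d)$, $\mathfrak{G}(\mathfrak{s})$ is the set of $g\in\mathfrak{G}^\infty$ such that for every $s>\mathfrak{s}$, $g_d(r)$ is not $o(r^s)$ as $r\to0$; $E$ is $\mathfrak{s}$-describable in $U$ if $E\in\mathcal{Z}(U)$, $\mathfrak{M}(E,U)=\mathfrak{G}^\infty\setminus\mathfrak{G}(\mathfrak{s})$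 and $\mathfrak{m}(E,U)\cap\mathfrak{G}^\infty=\mathfrak{G}(\mathfrak{s})$. *)

theory Defs
  imports "HOL-Analysis.Analysis" "HOL-Probability.Probability"
begin

definition point_measure :: "'b measure \<Rightarrow> bool" where
  "point_measure \<mu> \<longleftrightarrow> (\<exists>(I::nat set) (P::nat \<Rightarrow> 'b). (\<forall>i\<in>I. P i \<in> space \<mu>) \<and>
     (\<forall>E\<in>sets \<mu>. emeasure \<mu> E = (\<Sum>i. if i \<in> I then indicator E (P i) else (0::ennreal))))"

definition poisson_point_measure ::
  "'w measure \<Rightarrow> ('w \<Rightarrow> 'b measure) \<Rightarrow> 'b measure \<Rightarrow> bool" where
  "poisson_point_measure M Pm \<pi> \<longleftrightarrow>
     prob_space M \<and>
     (\<forall>\<omega>\<in>space M. sets (Pm \<omega>) = sets \<pi> \<and> point_measure (Pm \<omega>)) \<and>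
     (\<forall>E\<in>sets \<pi>. (\<lambda>\<omega>. emeasure (Pm \<omega>) E) \<in> borel_measurable M \<and>
        (if emeasure \<pi> E = \<infinity> then (AE \<omega> in M. emeasure (Pm \<omega>) E = \<infinity>)
         else (\<forall>k::nat. measure M {\<omega>\<in>space M. emeasure (Pm \<omega>) E = of_nat k}
                 = exp (- enn2real (emeasure \<pi> E)) * enn2real (emeasure \<pi> E) ^ k / fact k))) \<and>
     (\<forall>(n::nat) (E::nat \<Rightarrow> 'b set). (\<forall>i<n. E i \<in> sets \<pi>) \<longrightarrow>
        (\<forall>i<n. \<forall>j<n. i \<noteq> j \<longrightarrow> E i \<inter> E j = {}) \<longrightarrow>
        prob_space.indep_vars M (\<lambda>_. borel) (\<lambda>i \<omega>. emeasure (Pm \<omega>) (E i)) {..<n})"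

definition is_norm :: "('a::real_vector \<Rightarrow> real) \<Rightarrow> bool" where
  "is_norm N \<longleftrightarrow> (\<forall>x. 0 \<le> N x) \<and> (\<forall>x. N x = 0 \<longleftrightarrow> x = 0) \<and>
     (\<forall>c x. N (c *\<^sub>R x) = \<bar>c\<bar> * N x) \<and> (\<forall>x y. N (x + y) \<le> N x + N y)"

text \<open>Diameter with respect to the norm \<open>N\<close> (diameter of the empty set is 0).\<close>
definition ndiam :: "('a::real_vector \<Rightarrow> real) \<Rightarrow> 'a set \<Rightarrow> ennreal" where
  "ndiam N C = (SUP x\<in>C. SUP y\<in>C. ennreal (N (x - y)))"

definition gauge_fun :: "(ennreal \<Rightarrow> ennreal) \<Rightarrow> bool" where
  "gauge_fun g \<longleftrightarrow> (\<exists>\<epsilon>>0. mono_on {0..\<epsilon>} g) \<and> g 0 = 0 \<and> (g \<longlongrightarrow> 0) (at_right 0)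
      \<and> g \<infinity> = \<infinity>"

definition hausdorff_pre :: "('a::real_vector \<Rightarrow> real) \<Rightarrow> (ennreal \<Rightarrow> ennreal) \<Rightarrow> real \<Rightarrow> 'a set \<Rightarrow> ennreal" where
  "hausdorff_pre N g \<delta> E = (INF C\<in>{C::nat \<Rightarrow> 'a set. E \<subseteq> (\<Union>n. C n) \<and> (\<forall>n. ndiam N (C n) \<le> ennreal \<delta>)}.
       (\<Sum>n. g (ndiam N (C n))))"

definition hausdorff_g :: "('a::real_vector \<Rightarrow> real) \<Rightarrow> (ennreal \<Rightarrow> ennreal) \<Rightarrow> 'a set \<Rightarrow> ennreal" where
  "hausdorff_g N g E = (SUP \<delta>\<in>{0<..}. hausdorff_pre N g \<delta> E)"
  \<comment> \<open>the limit as \<open>\<delta> \<down> 0\<close> of a nonincreasing function of \<open>\<delta>\<close>\<close>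

definition dnorm :: "nat \<Rightarrow> (ennreal \<Rightarrow> ennreal) \<Rightarrow> ennreal \<Rightarrow> ennreal" where
  "dnorm d g r = (if r = 0 then 0 else if r = \<infinity> then \<infinity>
                  else r ^ d * (INF \<rho>\<in>{0<..r}. g \<rho> / \<rho> ^ d))"

definition d_normalized :: "nat \<Rightarrow> (ennreal \<Rightarrow> ennreal) \<Rightarrow> bool" where
  "d_normalized d g \<longleftrightarrow> (\<exists>\<epsilon>>0. \<forall>r<\<epsilon>. g r = dnorm d g r)"

definition ell :: "nat \<Rightarrow> (ennreal \<Rightarrow> ennreal) \<Rightarrow> ennreal" where
  "ell d g = Liminf (at_right 0) (\<lambda>r. g r / r ^ d)"

definition gauges_inf :: "nat \<Rightarrow> (ennreal \<Rightarrow> ennreal) set" where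
  "gauges_inf d = {g. gauge_fun g \<and> ell d g = \<infinity>}"

definition gauges_star :: "nat \<Rightarrow> (ennreal \<Rightarrow> ennreal) set" where
  "gauges_star d = {g. gauge_fun g \<and> ell d g > 0}"

definition gauge_prec :: "(ennreal \<Rightarrow> ennreal) \<Rightarrow> (ennreal \<Rightarrow> ennreal) \<Rightarrow> bool" where
  "gauge_prec h g \<longleftrightarrow> (\<exists>\<epsilon>>0. \<forall>r. 0 < r \<and> r < \<epsilon> \<longrightarrow> g r = 0) \<or>
     ((\<exists>\<epsilon>>0. \<forall>r s. 0 < r \<and> r \<le> s \<and> s < \<epsilon> \<longrightarrow> h s / g s \<le> h r / g r) \<and>
      ((\<lambda>r. h r / g r) \<longlongrightarrow> \<infinity>) (at_right 0))"

definition dyadic_cube :: "int \<Rightarrow> ('n \<Rightarrow> int) \<Rightarrow> (real^'n) set" where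
  "dyadic_cube j k = {x. \<forall>i. real_of_int (k i) \<le> 2 powr real_of_int j * x $ i
                              \<and> 2 powr real_of_int j * x $ i < real_of_int (k i) + 1}"

definition dyadic_cubes :: "(real^'n) set set" where
  "dyadic_cubes = {dyadic_cube j k | j k. True}"

definition eps_h :: "nat \<Rightarrow> (ennreal \<Rightarrow> ennreal) \<Rightarrow> ennreal" where
  "eps_h d h = Sup {\<epsilon>. \<epsilon> > 0 \<and> mono_on {0..\<epsilon>} h \<and>
       (\<forall>r s. 0 < r \<and> r \<le> s \<and> s \<le> \<epsilon> \<longrightarrow> h s / s ^ d \<le> h r / r ^ d)}"

text \<open>Countable coverings by dyadic cubes; empty members are allowed only to encode
  finite coverings (they contribute \<open>h 0 = 0\<close>).\<close>
definition M_inf :: "(real^'n \<Rightarrow> real) \<Rightarrow> (ennreal \<Rightarrow> ennreal) \<Rightarrow> (real^'n) set \<Rightarrow> ennreal" where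
  "M_inf N h E = (INF C\<in>{C::nat \<Rightarrow> (real^'n) set. E \<subseteq> (\<Union>n. C n) \<and>
        (\<forall>n. (C n \<in> dyadic_cubes \<or> C n = {}) \<and> ndiam N (C n) < eps_h CARD('n) h)}.
       (\<Sum>n. h (ndiam N (C n))))"

definition large_int_class :: "(real^'n \<Rightarrow> real) \<Rightarrow> (ennreal \<Rightarrow> ennreal) \<Rightarrow> (real^'n) set \<Rightarrow> (real^'n) set set" where
  "large_int_class N g U = {F. gdelta_in euclidean F \<and>
     (\<forall>h V. gauge_fun h \<and> d_normalized CARD('n) h \<and> gauge_prec h (dnorm CARD('n) g)
        \<and> open V \<and> V \<subseteq> U \<longrightarrow> M_inf N h (F \<inter> V) = M_inf N h V)}"

definition Zcls :: "(real^'n) set \<Rightarrow> (real^'n) set set" where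
  "Zcls U = {E. E \<in> sets borel \<and> emeasure lborel (E \<inter> U) = 0}"

definition majorizing :: "(real^'n \<Rightarrow> real) \<Rightarrow> (real^'n) set \<Rightarrow> (real^'n) set \<Rightarrow> (ennreal \<Rightarrow> ennreal) set" where
  "majorizing N E U = {g \<in> gauges_inf CARD('n). hausdorff_g N g (E \<inter> U) = 0}"

definition minorizing :: "(real^'n \<Rightarrow> real) \<Rightarrow> (real^'n) set \<Rightarrow> (real^'n) set \<Rightarrow> (ennreal \<Rightarrow> ennreal) set" where
  "minorizing N E U = {g \<in> gauges_star CARD('n). \<exists>F\<in>large_int_class N g U. F \<subseteq> E}"

definition Rcls :: "real measure set" where
  "Rcls = {\<nu>. sets \<nu> = sets (restrict_space borel {0<..1}) \<and> emeasure \<nu> (space \<nu>) = \<infinity> \<and>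
               (\<forall>\<rho>\<in>{0<..1}. emeasure \<nu> {\<rho>..1} < \<infinity>)}"

definition Rcls_d :: "nat \<Rightarrow> real measure set" where
  "Rcls_d d = {\<nu>\<in>Rcls. (\<integral>\<^sup>+ r. ennreal (r ^ d) \<partial>\<nu>) < \<infinity>}"

definition gauges_nu :: "nat \<Rightarrow> real measure \<Rightarrow> (ennreal \<Rightarrow> ennreal) set" where
  "gauges_nu d \<nu> = {g \<in> gauges_inf d. (\<integral>\<^sup>+ r. dnorm d g (ennreal r) \<partial>\<nu>) = \<infinity>}"

definition nu_describable :: "(real^'n \<Rightarrow> real) \<Rightarrow> real measure \<Rightarrow> (real^'n) set \<Rightarrow> (real^'n) set \<Rightarrow> bool" where
  "nu_describable N \<nu> E U \<longleftrightarrow> E \<in> Zcls U \<and>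
     majorizing N E U = gauges_inf CARD('n) - gauges_nu CARD('n) \<nu> \<and>
     minorizing N E U \<inter> gauges_inf CARD('n) = gauges_nu CARD('n) \<nu>"

definition F_set :: "(real^'n \<Rightarrow> real) \<Rightarrow> (real \<times> (real^'n)) measure \<Rightarrow> (real^'n) set" where
  "F_set N \<mu> = {y. (\<integral>\<^sup>+ z. indicator {(r, x). N (y - x) < r} z \<partial>\<mu>) = \<infinity>}"

end

theory Submission
  imports Defs
begin

text \<open>
  Write \<open>F\<close> for the limsup of the balls \<open>B(x\<^sub>i, r\<^sub>i)\<close> given by the atoms of the Poisson measure, \<open>D = 16 ^ d\<close>,
  and let \<open>b j\<close> be the level at which the tail \<open>\<nu>([b j, 1])\<close> passes \<open>4 D ^ j\<close>. Then \<open>\<integral> w d\<nu>\<close> and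
  \<open>\<Sum> w (b j) D ^ j\<close> converge or diverge together for monotone \<open>w\<close>. Randomness enters only through two
  almost sure facts, which do not involve the gauge and hence serve all gauges at once: bounded regions
  contain \<open>O(D ^ j)\<close> atoms with \<open>r\<^sub>i > b j\<close>, and in every dyadic cube inside \<open>U\<close> at least half of the
  subcubes of side \<open>16 ^ (- j)\<close> eventually contain an atom with \<open>r\<^sub>i \<ge> b j\<close> (a union bound over void probabilities).

  The first fact bounds the cost of covering \<open>F\<close> by its own balls, so that \<open>F\<close> is null for every gauge with
  convergent sum. The second yields, for weights \<open>w j\<close> with \<open>\<Sum> w j D ^ j = \<infinity>\<close>, finitely many
  atoms in any cube \<open>Q\<close> that are surrounded by disjoint dyadic cubes of volume about \<open>w j\<close> and of total volume
  at least a fixed part of \<open>Q\<close>. If \<open>h(b j) / w j \<rightarrow> \<infinity>\<close>, then a cover of \<open>F \<inter> Q\<close> of cost well below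
  \<open>h(Q)\<close> leaves one of the balls at these atoms mostly uncovered; iterating inside that ball produces a point of
  \<open>F\<close> outside the cover. Hence \<open>F\<close> has full net content, and adding the cubes this estimate
  controls to a given cover of \<open>F \<inter> V\<close> covers \<open>V\<close> at arbitrarily small extra cost.
\<close>

section \<open>Norms and dyadic cubes\<close>

text \<open>A divergent sum alone does not yield full net content: the covering estimate needs room
  between the gauge that prices the cubes and the weights whose sum diverges. For a gauge
  \<open>h\<close> with \<open>gauge_prec h (dnorm d g)\<close> the values of the normalized
  \<open>g\<close> are such weights. Hausdorff measure, however, is tested at \<open>g\<close>
  itself, where the room must be made by passing to smaller weights whose sum still diverges. In the
  opposite regime, membership in the minorizing collection is refuted by a gauge above
  \<open>g\<close> whose sum still converges, since the large intersection class only tests gauges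
  above the normalized \<open>g\<close>. The constants balance as follows. With a factor
  \<open>16 ^ d\<close> between levels, the cubes of all earlier levels number at most a fifteenth
  of those of the current one. The factor 4 in \<open>4 * q j\<close> gives a fixed half of
  \<open>m\<close> cubes void probability at most \<open>exp (- 2 * m)\<close>, which beats the at
  most \<open>2 ^ m\<close> families. A selection fills an eighth of a cube, and a cover cheaper
  than \<open>f Q / 32\<close> can spoil at most a sixteenth.\<close>

lemma is_norm_minus: "is_norm N \<Longrightarrow> N (- x) = N x"
  unfolding is_norm_def by (metis abs_minus_cancel abs_one mult_1 scaleR_minus1_left)

lemma is_norm_minus_commute: "is_norm N \<Longrightarrow> N (x - y) = N (y - x)"
  by (metis is_norm_minus minus_diff_eq)

lemma is_norm_upper:
  fixes N :: "real^'n \<Rightarrow> real"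
  assumes "is_norm N"
  obtains B where "B > 0" "\<And>x. N x \<le> B * norm x"
proof -
  have sub: "N (sum f A) \<le> (\<Sum>i\<in>A. N (f i))" if "finite A" for f :: "'n \<Rightarrow> real^'n" and A
    using that
  proof (induction A rule: finite_induct)
    case empty
    have "N 0 = 0" using assms by (simp add: is_norm_def)
    then show ?case by simp
  next
    case (insert a A)
    have "N (f a + sum f A) \<le> N (f a) + N (sum f A)" using assms by (simp add: is_norm_def)
    then show ?case using insert by simp
  qed
  define B where "B = (\<Sum>i\<in>UNIV. N (axis i 1 :: real^'n)) + 1"
  have nn: "N x \<ge> 0" for x using assms by (simp add: is_norm_def)
  have "N x \<le> B * norm x" for x
  proof -
    have "x = (\<Sum>i\<in>UNIV. (x $ i) *\<^sub>R axis i 1)"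
      by (simp add: vec_eq_iff axis_def if_distrib[of "\<lambda>t. _ * t"] cong: if_cong)
    then have "N x \<le> (\<Sum>i\<in>UNIV. N ((x $ i) *\<^sub>R axis i 1))"
      using sub[of UNIV "\<lambda>i. (x $ i) *\<^sub>R axis i 1"] by simp
    also have "\<dots> = (\<Sum>i\<in>UNIV. \<bar>x $ i\<bar> * N (axis i 1))" using assms by (simp add: is_norm_def)
    also have "\<dots> \<le> (\<Sum>i\<in>UNIV. norm x * N (axis i 1))"
      by (intro sum_mono mult_right_mono component_le_norm_cart nn)
    also have "\<dots> \<le> B * norm x" by (simp add: B_def sum_distrib_left distrib_right distrib_left mult.commute)
    finally show ?thesis .
  qed
  moreover have "B > 0" unfolding B_def by (intro add_nonneg_pos sum_nonneg nn) simp
  ultimately show ?thesis using that by blast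
qed

lemma is_norm_continuous:
  fixes N :: "real^'n \<Rightarrow> real"
  assumes "is_norm N"
  shows "continuous_on S N"
proof -
  obtain B where B: "B > 0" "\<And>x. N x \<le> B * norm x" using is_norm_upper[OF assms] by blast
  have tri: "N x \<le> N y + N (x - y)" for x y
    using assms unfolding is_norm_def by (metis diff_add_cancel add.commute)
  have "\<bar>N x - N y\<bar> \<le> B * dist x y" for x y
    using tri[of x y] tri[of y x] B(2)[of "x - y"] is_norm_minus_commute[OF assms, of x y]
    by (simp add: dist_norm)
  then have "B-lipschitz_on S N" using B by (intro lipschitz_onI) (auto simp: dist_real_def)
  then show ?thesis by (rule lipschitz_on_continuous_on)
qed

lemma is_norm_lower:
  fixes N :: "real^'n \<Rightarrow> real"
  assumes "is_norm N"
  obtains a where "a > 0" "\<And>x. a * norm x \<le> N x"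
proof -
  have ne: "sphere (0::real^'n) 1 \<noteq> {}"
    using norm_axis_1[of undefined] by (metis empty_iff mem_sphere_0)
  obtain z where z: "z \<in> sphere 0 1" "\<And>y. y \<in> sphere 0 1 \<Longrightarrow> N z \<le> N y"
    using continuous_attains_inf[OF compact_sphere ne is_norm_continuous[OF assms]] by blast
  have "N z > 0" using z assms unfolding is_norm_def
    by (metis less_eq_real_def mem_sphere_0 norm_zero zero_neq_one)
  moreover have "N z * norm x \<le> N x" for x
  proof (cases "x = 0")
    case True then show ?thesis using assms by (simp add: is_norm_def)
  next
    case False
    have "N z \<le> N (x /\<^sub>R norm x)" using False by (intro z) simp
    also have "\<dots> = N x / norm x" using assms by (simp add: is_norm_def divide_inverse mult.commute)
    finally show ?thesis using False by (simp add: field_simps)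
  qed
  ultimately show ?thesis using that by blast
qed

section \<open>Diameters and the dyadic grid\<close>

lemma ndiam_upper: "x \<in> C \<Longrightarrow> y \<in> C \<Longrightarrow> ennreal (N (x - y)) \<le> ndiam N C"
  unfolding ndiam_def by (meson SUP_upper SUP_upper2)

lemma ndiam_empty [simp]: "ndiam N {} = 0"
  by (simp add: ndiam_def bot_ennreal)

text \<open>A cube is addressed by any of its points instead of an integer vector. Cubes of one
  scale that share a point are then identified by \<open>dyadic_at_eq\<close>, and nesting becomes a
  statement about the cubes around one point.\<close>

definition dyadic_at :: "int \<Rightarrow> real^'n \<Rightarrow> (real^'n) set" where
  "dyadic_at j x = dyadic_cube j (\<lambda>i. \<lfloor>2 powr real_of_int j * x $ i\<rfloor>)"

lemma mem_dyadic_cube: "x \<in> dyadic_cube j k \<longleftrightarrow> k = (\<lambda>i. \<lfloor>2 powr real_of_int j * x $ i\<rfloor>)"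
  unfolding dyadic_cube_def fun_eq_iff by (auto simp: floor_eq_iff eq_commute[of "k _"])

lemma mem_dyadic_at: "y \<in> dyadic_at j x \<longleftrightarrow>
    (\<forall>i. \<lfloor>2 powr real_of_int j * y $ i\<rfloor> = \<lfloor>2 powr real_of_int j * x $ i\<rfloor>)"
  unfolding dyadic_at_def mem_dyadic_cube fun_eq_iff by auto

lemma dyadic_at_refl [simp, intro]: "x \<in> dyadic_at j x"
  by (simp add: mem_dyadic_at)

lemma dyadic_at_eq: "y \<in> dyadic_at j x \<Longrightarrow> dyadic_at j y = dyadic_at j x"
  by (auto simp: mem_dyadic_at)

lemma dyadic_cube_eq_at: "x \<in> dyadic_cube j k \<Longrightarrow> dyadic_cube j k = dyadic_at j x"
  by (simp add: dyadic_at_def mem_dyadic_cube)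

lemma dyadic_at_in [simp, intro]: "dyadic_at j x \<in> dyadic_cubes"
  by (auto simp: dyadic_at_def dyadic_cubes_def)

lemma dyadic_cube_nonempty: "dyadic_cube j k \<noteq> {}"
proof -
  have "(\<chi> i. real_of_int (k i) / 2 powr real_of_int j) \<in> dyadic_cube j k"
    by (simp add: dyadic_cube_def)
  then show ?thesis by blast
qed

lemma dyadic_cubesE:
  assumes "K \<in> dyadic_cubes"
  obtains j x where "K = dyadic_at j x"
  using assms dyadic_cube_nonempty dyadic_cube_eq_at unfolding dyadic_cubes_def by blast

text \<open>The index at the coarser scale is the integer quotient of the finer index by
  \<open>2 ^ nat (j - i)\<close>, so points with equal fine indices have equal coarse ones.\<close>

lemma dyadic_at_mono:
  assumes "i \<le> j" shows "dyadic_at j x \<subseteq> dyadic_at i x"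
proof
  fix y assume "y \<in> dyadic_at j x"
  then have *: "\<lfloor>2 powr real_of_int j * y $ l\<rfloor> = \<lfloor>2 powr real_of_int j * x $ l\<rfloor>" for l
    by (simp add: mem_dyadic_at)
  define b :: int where "b = 2 ^ nat (j - i)"
  have b: "2 powr real_of_int i * t = (2 powr real_of_int j * t) / real_of_int b" for t :: real
  proof -
    have "real_of_int b = 2 powr (real_of_int j - real_of_int i)"
      using assms by (simp add: b_def powr_realpow[symmetric])
    then show ?thesis by (simp add: powr_diff)
  qed
  have "\<lfloor>2 powr real_of_int i * t\<rfloor> = \<lfloor>2 powr real_of_int j * t\<rfloor> div b" for t :: real
    unfolding b by (rule floor_divide_real_eq_div) (simp add: b_def)
  then show "y \<in> dyadic_at i x" by (simp add: mem_dyadic_at *)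
qed

lemma dyadic_at_nested:
  assumes "i \<le> j" "dyadic_at i x \<inter> dyadic_at j y \<noteq> {}"
  shows "dyadic_at j y \<subseteq> dyadic_at i x"
proof -
  obtain z where "z \<in> dyadic_at i x" "z \<in> dyadic_at j y" using assms by blast
  then have "dyadic_at i x = dyadic_at i z" "dyadic_at j y = dyadic_at j z"
    using dyadic_at_eq by blast+
  then show ?thesis using dyadic_at_mono[OF assms(1)] by simp
qed

lemma dyadic_at_cases: "dyadic_at i x \<inter> dyadic_at j y = {} \<or> dyadic_at j y \<subseteq> dyadic_at i x \<or>
    dyadic_at i x \<subseteq> dyadic_at j y"
  using dyadic_at_nested[of i j x y] dyadic_at_nested[of j i y x] by (cases "i \<le> j") auto

lemma countable_dyadic_cubes: "countable (dyadic_cubes :: (real^'n) set set)"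
proof -
  have "countable (UNIV :: ('n \<Rightarrow> int) set)"
    using countable_PiE[of "UNIV :: 'n set" "\<lambda>_. UNIV :: int set"] by (simp add: PiE_def)
  then have "countable ((\<lambda>(j,k). dyadic_cube j k :: (real^'n) set) ` (UNIV \<times> UNIV))"
    by (intro countable_image countable_SIGMA) auto
  moreover have "(dyadic_cubes :: (real^'n) set set) \<subseteq> (\<lambda>(j,k). dyadic_cube j k) ` (UNIV \<times> UNIV)"
    by (auto simp: dyadic_cubes_def)
  ultimately show ?thesis by (rule countable_subset[rotated])
qed

lemma dyadic_cube_borel [measurable]: "dyadic_cube j k \<in> sets borel"
proof -
  have "dyadic_cube j k = (\<Inter>i. {x. real_of_int (k i) \<le> 2 powr real_of_int j * x $ i} \<inter>
      {x. 2 powr real_of_int j * x $ i < real_of_int (k i) + 1})"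
    by (auto simp: dyadic_cube_def)
  also have "\<dots> \<in> sets borel"
    by (intro sets.countable_INT' sets.Int borel_closed borel_open closed_Collect_le open_Collect_less continuous_intros) auto
  finally show ?thesis .
qed

lemma dyadic_at_borel [measurable]: "dyadic_at j x \<in> sets borel"
  by (simp add: dyadic_at_def)

text \<open>The half-open cube lies between the open and the closed box with the same corners, which
  have equal volume.\<close>

lemma emeasure_dyadic_at:
  fixes x :: "real^'n"
  shows "emeasure lborel (dyadic_at j x) = ennreal (2 powr (- real CARD('n) * real_of_int j))"
proof -
  define k where "k = (\<lambda>i. \<lfloor>2 powr real_of_int j * x $ i\<rfloor>)"
  define p where "p = 2 powr real_of_int j"
  have p: "p > 0" by (simp add: p_def)
  define a :: "real^'n" where "a = (\<chi> i. k i / p)"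
  define b :: "real^'n" where "b = (\<chi> i. (k i + 1) / p)"
  have mem: "z \<in> dyadic_at j x \<longleftrightarrow> (\<forall>i. a $ i \<le> z $ i \<and> z $ i < b $ i)" for z
    using p by (simp add: dyadic_at_def dyadic_cube_def a_def b_def k_def p_def[symmetric] field_simps)
  have sub: "box a b \<subseteq> dyadic_at j x" "dyadic_at j x \<subseteq> cbox a b"
    by (auto simp: mem mem_box_cart less_imp_le)
  have le: "a $ i \<le> b $ i" for i using p by (simp add: a_def b_def divide_right_mono)
  have ab: "\<forall>i\<in>Basis. a \<bullet> i \<le> b \<bullet> i" using le by (auto simp: Basis_vec_def inner_axis)
  have ne: "cbox a b \<noteq> {}" using ab by (simp add: box_ne_empty)
  have eq: "emeasure lborel (box a b) = emeasure lborel (cbox a b)"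
    using ab by (simp add: emeasure_lborel_box_eq emeasure_lborel_cbox_eq)
  have "emeasure lborel (dyadic_at j x) = emeasure lborel (cbox a b)"
    using emeasure_mono[OF sub(1), of lborel] emeasure_mono[OF sub(2), of lborel] eq
    by simp
  also have "\<dots> = ennreal (measure lborel (cbox a b))"
    by (intro emeasure_eq_ennreal_measure) (simp add: emeasure_lborel_cbox_eq)
  also have "measure lborel (cbox a b) = (\<Prod>i\<in>UNIV. b $ i - a $ i)"
    using ne by (rule content_cbox_cart)
  also have "\<dots> = (1 / p) ^ CARD('n)"
    by (simp add: a_def b_def diff_divide_distrib[symmetric])
  also have "\<dots> = 2 powr (- real CARD('n) * real_of_int j)"
    by (simp add: p_def power_one_over powr_minus divide_inverse powr_powr[symmetric] powr_realpow[symmetric] power_inverse mult.commute)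
  finally show ?thesis .
qed

text \<open>Families of cubes consist of bare sets; the scale of a cube is recovered from its
  volume.\<close>

lemma dyadic_at_subset_gen:
  assumes "dyadic_at j x \<subseteq> dyadic_at i (y::real^'n)" shows "i \<le> j"
proof -
  have "emeasure lborel (dyadic_at j x) \<le> emeasure lborel (dyadic_at i y)"
    using assms by (intro emeasure_mono) auto
  then have "2 powr (- real CARD('n) * real_of_int j) \<le> 2 powr (- real CARD('n) * real_of_int i)"
    unfolding emeasure_dyadic_at by (subst (asm) ennreal_le_iff) auto
  then show ?thesis by simp
qed

lemma dyadic_at_eq_gen: "dyadic_at j x = dyadic_at i (y::real^'n) \<Longrightarrow> i = j"
  using dyadic_at_subset_gen by (metis order_antisym order_refl)

text \<open>The constant relating side and diameter: by homogeneity a cube of scale \<open>j\<close>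
  has this multiple of its side as diameter. The conversion to a real loses nothing, the diameter of
  the unit cube being finite.\<close>

definition unit_diam :: "(real^'n \<Rightarrow> real) \<Rightarrow> real" where
  "unit_diam N = enn2real (ndiam N (dyadic_at 0 0))"

lemma dyadic_at_component_diff:
  assumes "y \<in> dyadic_at j x" "z \<in> dyadic_at j x"
  shows "\<bar>y $ i - z $ i\<bar> < 2 powr (- real_of_int j)"
proof -
  have "\<lfloor>2 powr real_of_int j * y $ i\<rfloor> = \<lfloor>2 powr real_of_int j * z $ i\<rfloor>"
    using assms by (auto simp: mem_dyadic_at)
  then have "\<bar>2 powr real_of_int j * y $ i - 2 powr real_of_int j * z $ i\<bar> < 1" by linarith
  then have "2 powr real_of_int j * \<bar>y $ i - z $ i\<bar> < 1"
    by (simp add: right_diff_distrib[symmetric] abs_mult)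
  then show ?thesis by (simp add: powr_minus field_simps)
qed

lemma ndiam_unit:
  fixes N :: "real^'n \<Rightarrow> real"
  assumes "is_norm N"
  shows "ndiam N (dyadic_at 0 0) = ennreal (unit_diam N)" "unit_diam N > 0"
proof -
  obtain B where B: "B > 0" "\<And>x. N x \<le> B * norm x" using is_norm_upper[OF assms] by blast
  have "ndiam N (dyadic_at 0 0) \<le> ennreal (B * real CARD('n))"
    unfolding ndiam_def
  proof (intro SUP_least ennreal_leI)
    fix x y :: "real^'n" assume "x \<in> dyadic_at 0 0" "y \<in> dyadic_at 0 0"
    then have "\<bar>(x - y) $ i\<bar> \<le> 1" for i using dyadic_at_component_diff[of x 0 0 y i] by simp
    then have "norm (x - y) \<le> (\<Sum>i\<in>(UNIV::'n set). 1)"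
      by (intro order_trans[OF norm_le_l1_cart sum_mono]) auto
    then show "N (x - y) \<le> B * real CARD('n)"
      using B(2)[of "x - y"] B(1) by (simp add: order_trans[OF _ mult_left_mono])
  qed
  then have fin: "ndiam N (dyadic_at 0 0) < \<infinity>" by (simp add: order_le_less_trans)
  then show eq: "ndiam N (dyadic_at 0 0) = ennreal (unit_diam N)" by (simp add: unit_diam_def)
  define z :: "real^'n" where "z = (\<chi> i. 1/2)"
  have "z \<in> dyadic_at 0 0" by (simp add: mem_dyadic_at z_def)
  then have "ennreal (N (z - 0)) \<le> ennreal (unit_diam N)"
    unfolding eq[symmetric] by (intro ndiam_upper) auto
  moreover have "N z > 0" using assms unfolding is_norm_def
    by (metis less_eq_real_def z_def vec_lambda_beta zero_index zero_neq_one divide_eq_0_iff zero_neq_numeral)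
  ultimately show "unit_diam N > 0"
    by (metis diff_zero ennreal_eq_0_iff ennreal_le_iff2 leD le_zero_eq not_le order_le_less_trans)
qed

lemma dyadic_at_image:
  fixes x :: "real^'n"
  shows "dyadic_at j x = (\<lambda>y. 2 powr (- real_of_int j) *\<^sub>R (y + (\<chi> i. real_of_int \<lfloor>2 powr real_of_int j * x $ i\<rfloor>))) ` dyadic_at 0 0"
    (is "_ = ?f ` _")
proof (intro equalityI subsetI)
  define p where "p = 2 powr real_of_int j"
  have p: "p > 0" "2 powr (- real_of_int j) = 1 / p" by (auto simp: p_def powr_minus divide_inverse)
  {
    fix z assume z: "z \<in> dyadic_at j x"
    define y where "y = p *\<^sub>R z - (\<chi> i. real_of_int \<lfloor>p * x $ i\<rfloor>)"
    have "?f y = z" using p by (simp add: y_def p_def[symmetric])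
    moreover have "y \<in> dyadic_at 0 0" using z by (auto simp: mem_dyadic_at y_def p_def[symmetric])
    ultimately show "z \<in> ?f ` dyadic_at 0 0" by (metis imageI)
  }
  {
    fix z assume "z \<in> ?f ` dyadic_at 0 0"
    then obtain y where y: "y \<in> dyadic_at 0 0" "z = ?f y" by blast
    have "p * z $ i = y $ i + real_of_int \<lfloor>p * x $ i\<rfloor>" for i
      using p by (simp add: y(2) p_def[symmetric])
    then show "z \<in> dyadic_at j x" using y(1) by (auto simp: mem_dyadic_at p_def[symmetric])
  }
qed

lemma ndiam_dyadic_at:
  fixes x :: "real^'n"
  assumes "is_norm N"
  shows "ndiam N (dyadic_at j x) = ennreal (unit_diam N * 2 powr (- real_of_int j))"
proof -
  let ?q = "2 powr (- real_of_int j)"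
  define c :: "real^'n" where "c = (\<chi> i. real_of_int \<lfloor>2 powr real_of_int j * x $ i\<rfloor>)"
  have sc: "N (c *\<^sub>R x) = \<bar>c\<bar> * N x" and nn: "0 \<le> N x" for c x using assms by (auto simp: is_norm_def)
  have eq: "?q *\<^sub>R (y + c) - ?q *\<^sub>R (z + c) = ?q *\<^sub>R (y - z)" for y z
    by (simp add: algebra_simps)
  have "ndiam N (dyadic_at j x) = (SUP y\<in>dyadic_at 0 0. SUP z\<in>dyadic_at 0 0. ennreal (N (?q *\<^sub>R (y + c) - ?q *\<^sub>R (z + c))))"
    unfolding ndiam_def dyadic_at_image[of j x] image_image c_def ..
  also have "\<dots> = (SUP y\<in>dyadic_at 0 (0::real^'n). SUP z\<in>dyadic_at 0 0. ennreal ?q * ennreal (N (y - z)))"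
    unfolding eq sc by (intro SUP_cong refl) (simp add: ennreal_mult nn)
  also have "\<dots> = ennreal ?q * ndiam N (dyadic_at 0 0)"
    by (simp add: ndiam_def SUP_mult_left_ennreal)
  also have "\<dots> = ennreal (unit_diam N * ?q)"
    using ndiam_unit[OF assms] by (simp add: ennreal_mult mult.commute)
  finally show ?thesis .
qed

lemma dyadic_at_norm_diff:
  assumes "is_norm N" "y \<in> dyadic_at j x" "z \<in> dyadic_at j x"
  shows "N (y - z) \<le> unit_diam N * 2 powr (- real_of_int j)"
proof -
  have "ennreal (N (y - z)) \<le> ennreal (unit_diam N * 2 powr (- real_of_int j))"
    using ndiam_upper[OF assms(2,3), of N] ndiam_dyadic_at[OF assms(1), of j x] by simp
  then show ?thesis using ndiam_unit(2)[OF assms(1)] by (simp add: ennreal_le_iff)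
qed

lemma two_powr_small:
  assumes "0 < (e::real)"
  obtains j0 :: int where "\<And>j. j \<ge> j0 \<Longrightarrow> c * 2 powr (- real_of_int j) < e"
proof
  define j0 where "j0 = \<lfloor>log 2 ((\<bar>c\<bar> + 1) / e)\<rfloor> + 1"
  fix j assume "j \<ge> j0"
  then have "log 2 ((\<bar>c\<bar> + 1) / e) < real_of_int j" unfolding j0_def by linarith
  then have "(\<bar>c\<bar> + 1) / e < 2 powr real_of_int j" using assms by (simp add: log_less_iff)
  then have "(\<bar>c\<bar> + 1) * 2 powr (- real_of_int j) < e"
    using assms by (simp add: powr_minus field_simps)
  moreover have "c * 2 powr (- real_of_int j) \<le> (\<bar>c\<bar> + 1) * 2 powr (- real_of_int j)"
    by (intro mult_right_mono) auto
  ultimately show "c * 2 powr (- real_of_int j) < e" by linarith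
qed

lemma dyadic_at_norm_le:
  fixes x :: "real^'n"
  assumes "y \<in> dyadic_at j x"
  shows "norm (y - x) \<le> real CARD('n) * 2 powr (- real_of_int j)"
proof -
  have "norm (y - x) \<le> (\<Sum>i\<in>UNIV. \<bar>(y - x) $ i\<bar>)" by (rule norm_le_l1_cart)
  also have "\<dots> \<le> (\<Sum>i\<in>(UNIV::'n set). 2 powr (- real_of_int j))"
    using dyadic_at_component_diff[OF assms dyadic_at_refl] by (intro sum_mono) (auto intro: less_imp_le)
  finally show ?thesis by simp
qed

lemma dyadic_at_in_open:
  fixes x :: "real^'n"
  assumes "open V" "x \<in> V"
  obtains j0 :: int where "\<And>j. j \<ge> j0 \<Longrightarrow> dyadic_at j x \<subseteq> V"
proof -
  obtain e where e: "e > 0" "ball x e \<subseteq> V" using assms openE by blast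
  obtain j0 :: int where j0: "\<And>j. j \<ge> j0 \<Longrightarrow> real CARD('n) * 2 powr (- real_of_int j) < e"
    using two_powr_small[OF e(1)] by blast
  have "dyadic_at j x \<subseteq> V" if "j \<ge> j0" for j
    using dyadic_at_norm_le[of _ j x] j0[OF that] e(2) by (force simp: dist_norm norm_minus_commute)
  then show ?thesis using that by blast
qed

section \<open>Counting and decomposing families of disjoint cubes\<close>

lemma emeasure_UN_dyadic_at:
  fixes x :: "'i \<Rightarrow> real^'n"
  assumes "finite S" "\<And>s t. s \<in> S \<Longrightarrow> t \<in> S \<Longrightarrow> s \<noteq> t \<Longrightarrow> dyadic_at (m s) (x s) \<inter> dyadic_at (m t) (x t) = {}"
  shows "emeasure lborel (\<Union>s\<in>S. dyadic_at (m s) (x s)) = ennreal (\<Sum>s\<in>S. 2 powr (- real CARD('n) * real_of_int (m s)))"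
proof -
  have "emeasure lborel (\<Union>s\<in>S. dyadic_at (m s) (x s)) = (\<Sum>s\<in>S. emeasure lborel (dyadic_at (m s) (x s)))"
    using assms by (intro sum_emeasure[symmetric]) (auto simp: disjoint_family_on_def)
  then show ?thesis by (simp add: emeasure_dyadic_at)
qed

lemma dyadic_at_same_gen: "dyadic_at j x = dyadic_at j y \<or> dyadic_at j x \<inter> dyadic_at j y = {}"
  by (metis disjoint_iff dyadic_at_eq)

text \<open>Distinct cubes of one scale are disjoint and of equal volume, so volume bounds their
  number. Finiteness is part of the claim and comes from a uniform bound on the finite
  subfamilies.\<close>

lemma card_dyadic_le:
  fixes B :: "(real^'n) set set"
  assumes B: "\<And>q. q \<in> B \<Longrightarrow> \<exists>x. q = dyadic_at j x" and sub: "\<Union>B \<subseteq> A"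
    and A: "A \<in> sets borel" "emeasure lborel A \<le> ennreal v" "v \<ge> 0"
  shows "finite B" "real (card B) * 2 powr (- real CARD('n) * real_of_int j) \<le> v"
proof -
  let ?p = "2 powr (- real CARD('n) * real_of_int j)"
  obtain x where x: "\<And>q. q \<in> B \<Longrightarrow> q = dyadic_at j (x q)" using B by metis
  have fin: "real (card C) * ?p \<le> v" if "finite C" "C \<subseteq> B" for C
  proof -
    have eq: "(\<Union>q\<in>C. dyadic_at j (x q)) = \<Union>C" using x that by fast
    have "emeasure lborel (\<Union>q\<in>C. dyadic_at j (x q)) = ennreal (\<Sum>q\<in>C. ?p)"
    proof (rule emeasure_UN_dyadic_at[OF that(1)])
      fix s t assume "s \<in> C" "t \<in> C" "s \<noteq> t"
      then show "dyadic_at j (x s) \<inter> dyadic_at j (x t) = {}"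
        using x[of s] x[of t] that(2) dyadic_at_same_gen[of j "x s" "x t"] by auto
    qed
    moreover have "emeasure lborel (\<Union>C) \<le> emeasure lborel A"
      using sub that A by (intro emeasure_mono) auto
    ultimately have "ennreal (real (card C) * ?p) \<le> ennreal v" using A(2) by (simp add: eq)
    then show ?thesis using A(3) by (simp add: ennreal_le_iff)
  qed
  have "card C \<le> nat \<lceil>v / ?p\<rceil>" if "C \<subseteq> B" "finite C" for C
  proof -
    have "real (card C) \<le> v / ?p" using fin[OF that(2,1)] by (simp add: field_simps)
    then show ?thesis by linarith
  qed
  then show "finite B" using finite_if_finite_subsets_card_bdd by blast
  then show "real (card B) * ?p \<le> v" using fin by blast
qed

definition subcubes :: "int \<Rightarrow> (real^'n) set \<Rightarrow> (real^'n) set set" where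
  "subcubes j Q = dyadic_at j ` Q"

lemma subcubes_subset:
  assumes "c \<le> j" "q \<in> subcubes j (dyadic_at c z)" shows "q \<subseteq> dyadic_at c z"
  using assms dyadic_at_nested[OF assms(1), of z] unfolding subcubes_def by blast

lemma subcubes_disjoint: "q \<in> subcubes j A \<Longrightarrow> q' \<in> subcubes j B \<Longrightarrow> q \<noteq> q' \<Longrightarrow> q \<inter> q' = {}"
  unfolding subcubes_def using dyadic_at_same_gen by blast

lemma Union_subcubes:
  assumes "c \<le> j" shows "\<Union> (subcubes j (dyadic_at c z)) = dyadic_at c z"
  using subcubes_subset[OF assms] unfolding subcubes_def by blast

lemma card_subcubes:
  fixes z :: "real^'n"
  assumes "c \<le> j"
  shows "finite (subcubes j (dyadic_at c z))"
    and "real (card (subcubes j (dyadic_at c z))) = 2 powr (real CARD('n) * (real_of_int j - real_of_int c))"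
proof -
  let ?B = "subcubes j (dyadic_at c z)"
  have B: "\<And>q. q \<in> ?B \<Longrightarrow> \<exists>x. q = dyadic_at j x" by (auto simp: subcubes_def)
  show fin: "finite ?B"
    by (rule card_dyadic_le(1)[OF B, where A = "dyadic_at c z" and v = "2 powr (- real CARD('n) * real_of_int c)"])
       (use Union_subcubes[OF assms] in \<open>auto simp: emeasure_dyadic_at\<close>)
  obtain x where x: "\<And>q. q \<in> ?B \<Longrightarrow> q = dyadic_at j (x q)" using B by metis
  have eq: "(\<Union>q\<in>?B. dyadic_at j (x q)) = \<Union>?B" using x by fast
  have "emeasure lborel (\<Union>q\<in>?B. dyadic_at j (x q)) = ennreal (\<Sum>q\<in>?B. 2 powr (- real CARD('n) * real_of_int j))"
  proof (rule emeasure_UN_dyadic_at[OF fin])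
    fix s t assume "s \<in> ?B" "t \<in> ?B" "s \<noteq> t"
    then show "dyadic_at j (x s) \<inter> dyadic_at j (x t) = {}"
      using x[of s] x[of t] dyadic_at_same_gen[of j "x s" "x t"] by auto
  qed
  then have "ennreal (2 powr (- real CARD('n) * real_of_int c)) = ennreal (real (card ?B) * 2 powr (- real CARD('n) * real_of_int j))"
    by (simp add: eq Union_subcubes[OF assms] emeasure_dyadic_at)
  then have "2 powr (- real CARD('n) * real_of_int c) = real (card ?B) * 2 powr (- real CARD('n) * real_of_int j)"
    by (subst (asm) ennreal_inj) auto
  then show "real (card ?B) = 2 powr (real CARD('n) * (real_of_int j - real_of_int c))"
    by (simp add: right_diff_distrib powr_diff powr_minus field_simps)
qed

text \<open>The family consists of the maximal cubes inside \<open>V\<close> among those of scale at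
  least \<open>e0\<close>. The lower bound on the scale makes maximal cubes exist even if
  \<open>V\<close> is the whole space.\<close>

lemma open_dyadic_decomposition:
  fixes V :: "(real^'n) set"
  assumes "open V"
  obtains W where "disjoint W" "\<Union>W = V" "\<And>w. w \<in> W \<Longrightarrow> \<exists>j x. e0 \<le> j \<and> w = dyadic_at j x"
proof -
  define W where "W = {dyadic_at j x | j x. e0 \<le> j \<and> dyadic_at j x \<subseteq> V \<and> (\<forall>i. e0 \<le> i \<and> i < j \<longrightarrow> \<not> dyadic_at i x \<subseteq> V)}"
  have *: "dyadic_at j x = dyadic_at j' x'"
    if "dyadic_at j x \<inter> dyadic_at j' x' \<noteq> {}" "e0 \<le> j" "j \<le> j'" "dyadic_at j x \<subseteq> V"
      "\<forall>i. e0 \<le> i \<and> i < j' \<longrightarrow> \<not> dyadic_at i x' \<subseteq> V" for j x j' x'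
  proof -
    have "dyadic_at j' x' \<subseteq> dyadic_at j x" using dyadic_at_nested that by blast
    then have "dyadic_at j x' = dyadic_at j x" using dyadic_at_eq by blast
    moreover have "\<not> dyadic_at j x' \<subseteq> V" if "j < j'" using \<open>e0 \<le> j\<close> that \<open>\<forall>i. e0 \<le> i \<and> i < j' \<longrightarrow> \<not> dyadic_at i x' \<subseteq> V\<close> by simp
    ultimately have "\<not> j < j'" using that(4) by argo
    then have "j = j'" using that(3) by linarith
    then show ?thesis using \<open>dyadic_at j x' = dyadic_at j x\<close> by metis
  qed
  have "disjoint W"
  proof (rule disjointI)
    fix a b assume ab: "a \<in> W" "b \<in> W" "a \<noteq> b"
    obtain j x j' x' where "a = dyadic_at j x" "b = dyadic_at j' x'" "e0 \<le> j" "e0 \<le> j'"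
      "dyadic_at j x \<subseteq> V" "dyadic_at j' x' \<subseteq> V"
      "\<forall>i. e0 \<le> i \<and> i < j \<longrightarrow> \<not> dyadic_at i x \<subseteq> V" "\<forall>i. e0 \<le> i \<and> i < j' \<longrightarrow> \<not> dyadic_at i x' \<subseteq> V"
      using ab(1,2) unfolding W_def by blast
    note h = this
    show "a \<inter> b = {}"
    proof (cases "j \<le> j'")
      case True
      then show ?thesis using *[OF _ h(3) True h(5) h(8)] h(1,2) ab(3) by argo
    next
      case False
      then have le: "j' \<le> j" by simp
      then show ?thesis using *[OF _ h(4) le h(6) h(7)] h(1,2) ab(3) by (metis Int_commute)
    qed
  qed
  moreover have "\<Union>W = V"
  proof
    show "\<Union>W \<subseteq> V" by (auto simp: W_def)
    show "V \<subseteq> \<Union>W"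
    proof
      fix x assume "x \<in> V"
      then obtain j0 where j0: "\<And>j. j \<ge> j0 \<Longrightarrow> dyadic_at j x \<subseteq> V" using dyadic_at_in_open[OF assms] by blast
      define P where "P n \<longleftrightarrow> dyadic_at (e0 + int n) x \<subseteq> V" for n
      have "P (nat (j0 - e0))" unfolding P_def by (intro j0) auto
      then have "P (LEAST n. P n)" by (rule LeastI)
      moreover have "\<not> P n" if "n < (LEAST n. P n)" for n using not_less_Least[OF that] .
      ultimately obtain n where n: "P n" "\<And>m. m < n \<Longrightarrow> \<not> P m" by blast
      have "\<not> dyadic_at i x \<subseteq> V" if "e0 \<le> i" "i < e0 + int n" for i
        using n(2)[of "nat (i - e0)"] that unfolding P_def by auto
      moreover have "e0 \<le> e0 + int n" "dyadic_at (e0 + int n) x \<subseteq> V" using n(1) unfolding P_def by auto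
      ultimately have "dyadic_at (e0 + int n) x \<in> W" unfolding W_def by blast
      then show "x \<in> \<Union>W" by blast
    qed
  qed
  moreover have "\<And>w. w \<in> W \<Longrightarrow> \<exists>j x. e0 \<le> j \<and> w = dyadic_at j x" by (auto simp: W_def)
  ultimately show ?thesis using that by blast
qed

text \<open>A substitute for the density theorem. Enclose the set in an open subset \<open>V\<close>
  of \<open>U\<close> with excess at most \<open>e\<close> and add the local bound over the dyadic
  decomposition of \<open>V\<close>: this gives \<open>m \<le> \<theta> * (m + e)\<close> for its
  measure \<open>m\<close> and every \<open>e > 0\<close>, hence \<open>m = 0\<close>. Intersecting
  with balls first makes \<open>m\<close> finite.\<close>

lemma null_if_dyadic_density:
  fixes E U :: "(real^'n) set"
  assumes "open U" "E \<subseteq> U" "E \<in> sets borel" "0 \<le> \<theta>" "\<theta> < 1"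
    and dens: "\<And>j x. dyadic_at j x \<subseteq> U \<Longrightarrow> emeasure lborel (E \<inter> dyadic_at j x) \<le> ennreal \<theta> * emeasure lborel (dyadic_at j x)"
  shows "emeasure lborel E = 0"
proof -
  have bdd: "emeasure lborel (E \<inter> ball 0 R) = 0" for R
  proof -
    define E' where "E' = E \<inter> ball 0 R"
    have E': "E' \<in> sets borel" "E' \<subseteq> U" using assms by (auto simp: E'_def)
    have fin: "emeasure lborel E' < \<infinity>"
      using emeasure_mono[of E' "ball 0 R" lborel] emeasure_lborel_ball_finite[of 0 R]
      by (auto simp: E'_def intro: order_le_less_trans)
    define m where "m = measure lborel E'"
    have m: "emeasure lborel E' = ennreal m" using fin by (simp add: m_def emeasure_eq_ennreal_measure)
    have "m \<le> \<theta> * (m + e)" if e: "e > 0" for e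
    proof -
      obtain T where T: "open T" "E' \<subseteq> T" "emeasure lborel (T - E') < ennreal e"
        using outer_regular_lborel[OF E'(1) e] by blast
      define V where "V = T \<inter> U"
      have V: "open V" "E' \<subseteq> V" using T E' assms(1) by (auto simp: V_def)
      obtain W where W: "disjoint W" "\<Union>W = V" "\<And>w. w \<in> W \<Longrightarrow> \<exists>j x. 0 \<le> j \<and> w = dyadic_at j x"
        using open_dyadic_decomposition[OF V(1), of 0] by metis
      have Wd: "W \<subseteq> dyadic_cubes" using W(3) by blast
      have cW: "countable W" using countable_subset[OF Wd countable_dyadic_cubes] .
      have Wb: "w \<in> sets borel" if "w \<in> W" for w using W(3)[OF that] by auto
      have dis: "disjoint_family_on (\<lambda>w. w) W" "disjoint_family_on (\<lambda>w. E' \<inter> w) W"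
        using W(1) unfolding disjoint_family_on_def disjoint_def by blast+
      have "emeasure lborel E' = emeasure lborel (\<Union>w\<in>W. E' \<inter> w)"
        using V(2) W(2) by (intro arg_cong[of _ _ "emeasure lborel"]) auto
      also have "\<dots> = (\<integral>\<^sup>+w. emeasure lborel (E' \<inter> w) \<partial>count_space W)"
        using cW dis E' Wb by (intro emeasure_UN_countable) auto
      also have "\<dots> \<le> (\<integral>\<^sup>+w. ennreal \<theta> * emeasure lborel w \<partial>count_space W)"
      proof (rule nn_integral_mono)
        fix w assume "w \<in> space (count_space W)"
        then have w: "w \<in> W" by simp
        obtain j x where jx: "w = dyadic_at j x" using W(3)[OF w] by blast
        have "w \<subseteq> U" using w W(2) by (auto simp: V_def)
        then have "emeasure lborel (E \<inter> w) \<le> ennreal \<theta> * emeasure lborel w" using dens[of j x] jx by simp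
        moreover have "emeasure lborel (E' \<inter> w) \<le> emeasure lborel (E \<inter> w)"
          using assms Wb[OF w] by (intro emeasure_mono) (auto simp: E'_def)
        ultimately show "emeasure lborel (E' \<inter> w) \<le> ennreal \<theta> * emeasure lborel w" by order
      qed
      also have "\<dots> = ennreal \<theta> * (\<integral>\<^sup>+w. emeasure lborel w \<partial>count_space W)"
        by (simp add: nn_integral_cmult)
      also have "(\<integral>\<^sup>+w. emeasure lborel w \<partial>count_space W) = emeasure lborel (\<Union>w\<in>W. w)"
        using cW dis Wb by (intro emeasure_UN_countable[symmetric]) auto
      also have "(\<Union>w\<in>W. w) = V" using W(2) by simp
      also have "emeasure lborel V \<le> emeasure lborel (E' \<union> (T - E'))"
        using T E' by (intro emeasure_mono) (auto simp: V_def)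
      also have "\<dots> \<le> emeasure lborel E' + emeasure lborel (T - E')"
        using E' T by (intro emeasure_subadditive) auto
      also have "\<dots> \<le> ennreal m + ennreal e" using T(3) m by (intro add_mono) auto
      finally have "ennreal m \<le> ennreal \<theta> * (ennreal m + ennreal e)"
        using m by (simp add: mult_left_mono)
      also have "\<dots> = ennreal (\<theta> * (m + e))"
        using that assms(4) by (simp add: m_def ennreal_mult flip: ennreal_plus)
      finally show ?thesis using that assms(4) by (subst (asm) ennreal_le_iff) (auto simp: m_def)
    qed
    then have "(1 - \<theta>) * m \<le> \<theta> * e" if "e > 0" for e using \<open>\<And>e. e > 0 \<Longrightarrow> m \<le> \<theta> * (m + e)\<close>[OF that] by (simp add: algebra_simps)
    then have "(1 - \<theta>) * m \<le> e" if "e > 0" for e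
      using that assms(4,5) by (meson mult_left_le_one_le less_imp_le order_trans)
    then have "(1 - \<theta>) * m \<le> 0" using dense_ge[of 0 "(1 - \<theta>) * m"] by blast
    then have "m \<le> 0" using assms(5) by (simp add: mult_le_0_iff)
    then show ?thesis using m unfolding E'_def by (simp add: ennreal_neg)
  qed
  have "E = (\<Union>n::nat. E \<inter> ball 0 (real n))"
  proof -
    have "\<exists>n. x \<in> ball 0 (real n)" for x :: "real^'n"
      using reals_Archimedean2[of "norm x"] by simp
    then show ?thesis by blast
  qed
  moreover have "(\<Union>n::nat. E \<inter> ball 0 (real n)) \<in> null_sets lborel"
    using assms(3) bdd by (intro null_sets_UN') (auto simp: null_sets_def)
  ultimately show ?thesis by (metis null_setsD1)
qed

text \<open>All cubes of side about \<open>r\<close> that meet \<open>A\<close> lie in one box of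
  comparable side around a point of \<open>A\<close>, so comparing volumes bounds their number by a
  constant that depends on the norm alone.\<close>

lemma cover_by_dyadic:
  fixes N :: "real^'n \<Rightarrow> real"
  assumes N: "is_norm N"
  obtains L :: real where "L > 0" "\<And>A r. 0 < r \<Longrightarrow> ndiam N A \<le> ennreal r \<Longrightarrow>
    \<exists>j. r \<le> 2 powr (- real_of_int j) \<and> 2 powr (- real_of_int j) \<le> 2 * r \<and>
       finite (dyadic_at j ` A) \<and> real (card (dyadic_at j ` A)) \<le> L"
proof -
  obtain a where a: "a > 0" "\<And>x. a * norm x \<le> N x" using is_norm_lower[OF N] by blast
  \<comment> \<open>\<open>p / a\<close> bounds the Euclidean distance of two points of
    \<open>A\<close>, and one more \<open>p\<close> accounts for the cube around the second
    point.\<close>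
  define s where "s = 1/a + 1"
  have s: "s > 0" using a by (simp add: s_def add_pos_pos)
  define L where "L = (2 * s) ^ CARD('n)"
  have "\<exists>j. r \<le> 2 powr (- real_of_int j) \<and> 2 powr (- real_of_int j) \<le> 2 * r \<and>
       finite (dyadic_at j ` A) \<and> real (card (dyadic_at j ` A)) \<le> L" if r: "0 < r" "ndiam N A \<le> ennreal r" for A r
  proof -
    define j where "j = \<lfloor>- log 2 r\<rfloor>"
    define p where "p = 2 powr (- real_of_int j)"
    have "log 2 r \<le> - real_of_int j" "- real_of_int j < log 2 r + 1" unfolding j_def by linarith+
    then have "2 powr (log 2 r) \<le> p" "p \<le> 2 powr (log 2 r + 1)" unfolding p_def by (intro powr_mono; simp)+
    then have 1: "r \<le> p" "p \<le> 2 * r" using r(1) by (simp_all add: powr_add)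
    have p: "p > 0" by (simp add: p_def)
    have "finite (dyadic_at j ` A) \<and> real (card (dyadic_at j ` A)) \<le> L"
    proof (cases "A = {}")
      case True then show ?thesis using s by (simp add: L_def)
    next
      case False
      then obtain y0 where y0: "y0 \<in> A" by blast
      define lo :: "real^'n" where "lo = (\<chi> i. y0 $ i - s * p)"
      define hi :: "real^'n" where "hi = (\<chi> i. y0 $ i + s * p)"
      have sub: "\<Union>(dyadic_at j ` A) \<subseteq> cbox lo hi"
      proof clarify
        fix y z assume y: "y \<in> A" and z: "z \<in> dyadic_at j y"
        have "ennreal (N (y - y0)) \<le> ennreal r" using ndiam_upper[OF y y0, of N] r(2) by order
        then have "N (y - y0) \<le> r" using r(1) by (simp add: ennreal_le_iff)
        then have "a * norm (y - y0) \<le> p" using a(2)[of "y - y0"] 1 by linarith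
        then have n: "norm (y - y0) \<le> p / a" using a(1) by (simp add: field_simps)
        have "\<bar>z $ i - y0 $ i\<bar> \<le> s * p" for i
        proof -
          have "\<bar>z $ i - y $ i\<bar> \<le> p" using dyadic_at_component_diff[OF z dyadic_at_refl, of i] by (simp add: p_def)
          moreover have "\<bar>y $ i - y0 $ i\<bar> \<le> p / a" using component_le_norm_cart[of "y - y0" i] n by simp
          ultimately show ?thesis by (simp add: s_def distrib_right)
        qed
        then have "y0 $ i - s * p \<le> z $ i \<and> z $ i \<le> y0 $ i + s * p" for i
          by (meson abs_diff_le_iff)
        then show "z \<in> cbox lo hi" by (simp add: mem_box_cart lo_def hi_def)
      qed
      have lh: "lo $ i \<le> hi $ i" for i using s p by (simp add: lo_def hi_def)
      then have ne: "cbox lo hi \<noteq> {}" by (simp add: interval_ne_empty_cart)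
      have "emeasure lborel (cbox lo hi) = ennreal (measure lborel (cbox lo hi))"
        by (intro emeasure_eq_ennreal_measure) (simp add: emeasure_lborel_cbox_eq)
      also have "measure lborel (cbox lo hi) = (\<Prod>i\<in>UNIV. hi $ i - lo $ i)"
        using ne by (rule content_cbox_cart)
      also have "\<dots> = L * p ^ CARD('n)"
        by (simp add: lo_def hi_def L_def power_mult_distrib)
      finally have em: "emeasure lborel (cbox lo hi) \<le> ennreal (L * p ^ CARD('n))" by simp
      have pd: "p ^ CARD('n) = 2 powr (- real CARD('n) * real_of_int j)"
        by (simp add: p_def powr_powr powr_realpow[symmetric] mult.commute)
      have L0: "L * p ^ CARD('n) \<ge> 0" using s p by (simp add: L_def)
      have B: "\<And>q. q \<in> dyadic_at j ` A \<Longrightarrow> \<exists>x. q = dyadic_at j x" by blast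
      have "finite (dyadic_at j ` A)" "real (card (dyadic_at j ` A)) * p ^ CARD('n) \<le> L * p ^ CARD('n)"
        using card_dyadic_le[OF B sub _ em L0] pd by auto
      then show ?thesis using p by simp
    qed
    then show ?thesis using 1 unfolding p_def by blast
  qed
  moreover have "L > 0" using s by (simp add: L_def)
  ultimately show ?thesis using that by blast
qed

section \<open>Greedy selection and covering costs\<close>

lemma dyadic_cubes_borel: "K \<in> dyadic_cubes \<Longrightarrow> K \<in> sets borel"
  by (auto elim!: dyadic_cubesE)

text \<open>The cost of a family of cubes is the value of a measure on families of cubes, so that
  subadditivity and continuity of the cost are instances of measure theory.\<close>

definition cost :: "('a \<Rightarrow> ennreal) \<Rightarrow> 'a set \<Rightarrow> ennreal" where
  "cost f C = emeasure (density (count_space UNIV) f) C"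

lemma cost_eq: "cost f C = (\<integral>\<^sup>+K. f K \<partial>count_space C)"
  by (simp add: cost_def emeasure_density nn_integral_count_space_indicator mult.commute)

lemma cost_mono: "C \<subseteq> C' \<Longrightarrow> cost f C \<le> cost f C'"
  by (simp add: cost_def emeasure_mono)

lemma cost_singleton [simp]: "cost f {K} = f K"
  unfolding cost_eq by (subst nn_integral_count_space_finite) auto

lemma cost_ge: "K \<in> C \<Longrightarrow> f K \<le> cost f C"
  using cost_mono[of "{K}" C f] by simp

lemma cost_finite_sum: "finite C \<Longrightarrow> cost f C = (\<Sum>K\<in>C. f K)"
  by (simp add: cost_eq nn_integral_count_space_finite)

lemma cost_Un_le: "cost f (A \<union> B) \<le> cost f A + cost f B"
  unfolding cost_def by (intro emeasure_subadditive) auto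

lemma cost_UN_le: "cost f (\<Union>n::nat. A n) \<le> (\<Sum>n. cost f (A n))"
  unfolding cost_def by (intro emeasure_subadditive_countably) auto

lemma cost_sum_disjoint:
  assumes "finite S" "\<And>s t. s \<in> S \<Longrightarrow> t \<in> S \<Longrightarrow> s \<noteq> t \<Longrightarrow> A s \<inter> A t = {}"
  shows "(\<Sum>s\<in>S. cost f (A s)) = cost f (\<Union>s\<in>S. A s)"
  unfolding cost_def using assms by (intro sum_emeasure) (auto simp: disjoint_family_on_def)

text \<open>Countable subadditivity over a set of sets, in the integral form of
  \<open>cost_eq\<close>; it follows by exchanging the two integrals of the indicator.\<close>

lemma emeasure_Union_le_nn_integral:
  assumes "countable C" "\<And>K. K \<in> C \<Longrightarrow> K \<in> sets M"
  shows "emeasure M (\<Union>C) \<le> (\<integral>\<^sup>+K. emeasure M K \<partial>count_space C)"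
proof -
  have "emeasure M (\<Union>C) = (\<integral>\<^sup>+x. indicator (\<Union>C) x \<partial>M)"
    using assms by (intro nn_integral_indicator[symmetric]) (simp add: sets.countable_Union subsetI)
  also have "\<dots> \<le> (\<integral>\<^sup>+x. \<integral>\<^sup>+K. indicator K x \<partial>count_space C \<partial>M)"
  proof (rule nn_integral_mono)
    fix x
    show "indicator (\<Union>C) x \<le> (\<integral>\<^sup>+K. indicator K x \<partial>count_space C :: ennreal)"
    proof (cases "x \<in> \<Union>C")
      case True
      then obtain K where "K \<in> C" "x \<in> K" by blast
      then show ?thesis using cost_ge[of K C "\<lambda>K. indicator K x"] True by (simp add: cost_eq)
    qed auto
  qed
  also have "\<dots> = (\<integral>\<^sup>+K. \<integral>\<^sup>+x. indicator K x \<partial>M \<partial>count_space C)"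
    using assms by (intro nn_integral_count_space_nn_integral) auto
  also have "\<dots> = (\<integral>\<^sup>+K. emeasure M K \<partial>count_space C)"
    using assms by (intro nn_integral_cong) auto
  finally show ?thesis .
qed

text \<open>A decreasing sequence of half-open cubes may have empty intersection. Keeping the
  closure inside the larger cube removes this obstacle, at the price of two scales.\<close>

lemma inner_subcube:
  fixes x :: "real^'n"
  obtains p where "closure (dyadic_at (g + 2) p) \<subseteq> dyadic_at g x"
proof -
  define P where "P = 2 powr real_of_int g"
  have P: "P > 0" "2 powr real_of_int (g + 2) = 4 * P" by (auto simp: P_def powr_add)
  define k where "k i = \<lfloor>P * x $ i\<rfloor>" for i
  \<comment> \<open>Index \<open>4 * k i + 1\<close> is the second quarter of every side, so even
    its closed version avoids the missing right face.\<close>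
  define p :: "real^'n" where "p = (\<chi> i. (4 * k i + 1) / (4 * P))"
  define T :: "(real^'n) set" where "T = {y. \<forall>i. 4 * real_of_int (k i) + 1 \<le> 4 * P * y $ i \<and> 4 * P * y $ i \<le> 4 * real_of_int (k i) + 2}"
  have "closed T" unfolding T_def
    by (intro closed_Collect_all closed_Collect_conj closed_Collect_le continuous_intros)
  moreover have "dyadic_at (g + 2) p \<subseteq> T"
  proof
    fix y assume "y \<in> dyadic_at (g + 2) p"
    then have y: "\<lfloor>4 * P * y $ i\<rfloor> = \<lfloor>4 * P * p $ i\<rfloor>" for i unfolding mem_dyadic_at P by blast
    have "4 * P * p $ i = real_of_int (4 * k i + 1)" for i using P by (simp add: p_def)
    then have "\<lfloor>4 * P * y $ i\<rfloor> = 4 * k i + 1" for i using y by (simp del: of_int_add of_int_mult)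
    then have "4 * real_of_int (k i) + 1 \<le> 4 * P * y $ i \<and> 4 * P * y $ i \<le> 4 * real_of_int (k i) + 2" for i
      by (simp add: floor_eq_iff) (smt (verit))
    then show "y \<in> T" by (simp add: T_def)
  qed
  moreover have "T \<subseteq> dyadic_at g x"
  proof
    fix y assume "y \<in> T"
    then have "real_of_int (k i) \<le> P * y $ i \<and> P * y $ i < real_of_int (k i) + 1" for i
      using \<open>y \<in> T\<close>[unfolded T_def, simplified, THEN spec[of _ i]] by (simp add: mult.assoc)
    then show "y \<in> dyadic_at g x"
      by (simp add: dyadic_at_def dyadic_cube_def P_def[symmetric] k_def)
  qed
  ultimately show ?thesis using that closure_minimal by (meson order_trans)
qed

lemma bounded_dyadic_at: "bounded (dyadic_at j (x :: real^'n))"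
proof -
  have "dyadic_at j x \<subseteq> cball x (real CARD('n) * 2 powr (- real_of_int j))"
    using dyadic_at_norm_le by (force simp: dist_norm norm_minus_commute)
  then show ?thesis using bounded_cball bounded_subset by blast
qed

section \<open>Limsup sets of balls and the greedy selection of cubes\<close>

abbreviation cvol :: "nat \<Rightarrow> int \<Rightarrow> real" where
  "cvol d j \<equiv> 2 powr (- real d * real_of_int j)"

text \<open>Indices are counted, not positions, so that repeated atoms carry their multiplicity, as
  they do in the integral defining \<open>F_set\<close>.\<close>

definition limsup_balls :: "(real^'n \<Rightarrow> real) \<Rightarrow> nat set \<Rightarrow> (nat \<Rightarrow> real) \<Rightarrow> (nat \<Rightarrow> real^'n) \<Rightarrow> (real^'n) set" where
  "limsup_balls N I rr xx = {y. infinite {i \<in> I. N (y - xx i) < rr i}}"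

lemma limsup_balls_iff:
  "y \<in> limsup_balls N I rr xx \<longleftrightarrow> (\<forall>k. \<exists>i\<in>I - {..<k}. N (y - xx i) < rr i)"
proof -
  have "(\<exists>n\<ge>k. n \<in> {i \<in> I. N (y - xx i) < rr i}) \<longleftrightarrow> (\<exists>i\<in>I - {..<k}. N (y - xx i) < rr i)" for k
    by (auto simp: not_less)
  then show ?thesis unfolding limsup_balls_def infinite_nat_iff_unbounded_le by simp
qed

lemma open_norm_ball:
  fixes N :: "real^'n \<Rightarrow> real"
  assumes "is_norm N" shows "open {y. N (y - x) < r}"
  by (intro open_Collect_less continuous_intros continuous_on_compose2[OF is_norm_continuous[OF assms, of UNIV]]) auto

text \<open>Level \<open>j\<close> uses cubes of side \<open>2 ^ (- 4 j)\<close>, not \<open>2 ^ (- j)\<close>, so that the number of cubes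
  of all earlier levels is a small fraction of the number of cubes of level \<open>j\<close>.\<close>

locale ubiquity =
  fixes N :: "real^'n \<Rightarrow> real" and I :: "nat set" and rr :: "nat \<Rightarrow> real" and xx :: "nat \<Rightarrow> real^'n"
    and b :: "nat \<Rightarrow> real" and U :: "(real^'n) set"
  assumes norm: "is_norm N"
    and dense: "dyadic_at c z \<subseteq> U \<Longrightarrow> \<forall>\<^sub>F j in sequentially.
      2 powr (real CARD('n) * (real_of_int (4 * int j) - real_of_int c))
        \<le> 2 * real (card {q \<in> subcubes (4 * int j) (dyadic_at c z). \<exists>i\<in>I. b j \<le> rr i \<and> xx i \<in> q})"
begin

text \<open>A selection consists of pairs (level, atom). An atom chosen at level \<open>j\<close>
  has radius at least \<open>b j\<close> and reserves the dyadic cube of scale \<open>m j\<close> in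
  which it lies. \<open>J0\<close> keeps the levels large, and \<open>X\<close> excludes atoms
  already used, so that repeated selection yields infinitely many different atoms.\<close>

definition admissible :: "(nat \<Rightarrow> int) \<Rightarrow> nat \<Rightarrow> nat set \<Rightarrow> (real^'n) set \<Rightarrow> (nat \<times> nat) set \<Rightarrow> bool" where
  "admissible m J0 X Q S \<longleftrightarrow> finite S \<and>
    (\<forall>(j,i)\<in>S. J0 \<le> j \<and> i \<in> I \<and> i \<notin> X \<and> b j \<le> rr i \<and> dyadic_at (m j) (xx i) \<subseteq> Q) \<and>
    (\<forall>s\<in>S. \<forall>t\<in>S. s \<noteq> t \<longrightarrow> dyadic_at (m (fst s)) (xx (snd s)) \<inter> dyadic_at (m (fst t)) (xx (snd t)) = {})"

text \<open>Cubes of level \<open>j\<close> are discarded if they lie in a selected cube, contain one, or contain a point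
  of \<open>X\<close>; at least an eighth of them remains and carries an admissible point.\<close>

lemma selection_step:
  assumes Q: "Q = dyadic_at c z" and X: "finite X" "real (card X) \<le> cvol CARD('n) c / cvol CARD('n) (4 * int j) / 16"
    and m: "4 * int j \<le> m j" and c: "c \<le> 4 * int j" and j: "J0 \<le> j"
    and many: "cvol CARD('n) c / cvol CARD('n) (4 * int j) \<le> 2 * real (card {q \<in> subcubes (4 * int j) Q. \<exists>i\<in>I. b j \<le> rr i \<and> xx i \<in> q})"
    and S: "admissible m J0 X Q S" "\<And>s. s \<in> S \<Longrightarrow> fst s < j"
    and cardS: "15 * real (card S) \<le> cvol CARD('n) c / cvol CARD('n) (4 * int j)"
    and small: "(\<Sum>s\<in>S. cvol CARD('n) (m (fst s))) \<le> cvol CARD('n) c / 8"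
  obtains S' where "admissible m J0 X Q S'" "\<And>s. s \<in> S' \<Longrightarrow> fst s < Suc j"
    "real (card S') \<le> real (card S) + cvol CARD('n) c / cvol CARD('n) (4 * int j)"
    "(\<Sum>s\<in>S'. cvol CARD('n) (m (fst s))) \<ge> (\<Sum>s\<in>S. cvol CARD('n) (m (fst s))) + cvol CARD('n) c / 8 * (cvol CARD('n) (m j) / cvol CARD('n) (4 * int j))"
proof -
  define D where "D s = dyadic_at (m (fst s)) (xx (snd s))" for s
  define SQ where "SQ = subcubes (4 * int j) Q"
  define M where "M = cvol CARD('n) c / cvol CARD('n) (4 * int j)"
  have finSQ: "finite SQ" and cardSQ: "real (card SQ) = M"
    using card_subcubes[OF c, of z] unfolding SQ_def Q M_def
    by (auto simp: powr_diff[symmetric] algebra_simps)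
  have finS: "finite S" using S(1) by (simp add: admissible_def)
  have SQc: "\<exists>x. q = dyadic_at (4 * int j) x" if "q \<in> SQ" for q using that by (auto simp: SQ_def subcubes_def)
  have SQd: "q \<inter> q' = {}" if "q \<in> SQ" "q' \<in> SQ" "q \<noteq> q'" for q q'
    using subcubes_disjoint that unfolding SQ_def by blast
  define A where "A = {q \<in> SQ. \<exists>i\<in>I. b j \<le> rr i \<and> xx i \<in> q}"
  \<comment> \<open>Three obstructions, counted by different means: \<open>B1\<close> by volume,
    \<open>B2\<close> by an injection into \<open>S\<close>, \<open>B3\<close> by an injection into
    \<open>X\<close>.\<close>
  define B1 where "B1 = {q \<in> SQ. \<exists>s\<in>S. q \<subseteq> D s}"
  define B2 where "B2 = {q \<in> SQ. \<exists>s\<in>S. D s \<subseteq> q}"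
  define B3 where "B3 = {q \<in> SQ. \<exists>i\<in>X. xx i \<in> q}"
  define G where "G = A - B1 - B2 - B3"
  have fins: "finite A" "finite B1" "finite B2" "finite B3" "finite G"
    using finSQ by (auto simp: A_def B1_def B2_def B3_def G_def)
  have cA: "real (card A) \<ge> M / 2" using many by (simp add: A_def SQ_def M_def)
  have cB1: "real (card B1) \<le> M / 8"
  proof -
    have "emeasure lborel (\<Union>s\<in>S. D s) = ennreal (\<Sum>s\<in>S. cvol CARD('n) (m (fst s)))"
      unfolding D_def using S(1) by (intro emeasure_UN_dyadic_at) (auto simp: admissible_def)
    also have "\<dots> \<le> ennreal (cvol CARD('n) c / 8)" using small by (intro ennreal_leI)
    finally have em: "emeasure lborel (\<Union>s\<in>S. D s) \<le> ennreal (cvol CARD('n) c / 8)" .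
    have "real (card B1) * cvol CARD('n) (4 * int j) \<le> cvol CARD('n) c / 8"
    proof (rule card_dyadic_le(2)[OF _ _ _ em])
      show "\<Union> B1 \<subseteq> (\<Union>s\<in>S. D s)" by (auto simp: B1_def)
      show "\<And>q. q \<in> B1 \<Longrightarrow> \<exists>x. q = dyadic_at (4 * int j) x" using SQc by (auto simp: B1_def)
      show "(\<Union>s\<in>S. D s) \<in> sets borel" using finS by (auto simp: D_def)
    qed auto
    then show ?thesis by (simp add: M_def field_simps)
  qed
  have cB2: "card B2 \<le> card S"
  proof -
    have "\<forall>q\<in>B2. \<exists>s. s \<in> S \<and> D s \<subseteq> q" by (auto simp: B2_def)
    from bchoice[OF this] obtain \<sigma> where \<sigma>: "\<And>q. q \<in> B2 \<Longrightarrow> \<sigma> q \<in> S \<and> D (\<sigma> q) \<subseteq> q" by blast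
    have ne: "D s \<noteq> {}" for s unfolding D_def by (metis dyadic_at_refl empty_iff)
    have "inj_on \<sigma> B2"
    proof (rule inj_onI, rule ccontr)
      fix q q' assume h: "q \<in> B2" "q' \<in> B2" "\<sigma> q = \<sigma> q'" "q \<noteq> q'"
      then have "q \<inter> q' = {}" using SQd by (auto simp: B2_def)
      moreover have "D (\<sigma> q) \<subseteq> q" "D (\<sigma> q) \<subseteq> q'" using \<sigma>[OF h(1)] \<sigma>[OF h(2)] h(3) by auto
      ultimately show False using ne[of "\<sigma> q"] by blast
    qed
    then show ?thesis using \<sigma> finS by (intro card_inj_on_le[of \<sigma>]) auto
  qed
  have cB3: "card B3 \<le> card X"
  proof -
    have "\<forall>q\<in>B3. \<exists>s. s \<in> X \<and> xx s \<in> q" by (auto simp: B3_def)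
    from bchoice[OF this] obtain \<sigma> where \<sigma>: "\<And>q. q \<in> B3 \<Longrightarrow> \<sigma> q \<in> X \<and> xx (\<sigma> q) \<in> q" by blast
    have "inj_on \<sigma> B3"
    proof (rule inj_onI, rule ccontr)
      fix q q' assume h: "q \<in> B3" "q' \<in> B3" "\<sigma> q = \<sigma> q'" "q \<noteq> q'"
      then have "q \<inter> q' = {}" using SQd by (auto simp: B3_def)
      then show False using \<sigma>[OF h(1)] \<sigma>[OF h(2)] h(3) by auto
    qed
    then show ?thesis using \<sigma> X(1) by (intro card_inj_on_le[of \<sigma>]) auto
  qed
  have "card A \<le> card (G \<union> (B1 \<union> B2 \<union> B3))" using fins by (intro card_mono) (auto simp: G_def)
  also have "\<dots> \<le> card G + (card B1 + card B2 + card B3)"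
    by (meson add_mono card_Un_le order_trans order_refl)
  finally have "real (card A) \<le> real (card G) + (real (card B1) + real (card B2) + real (card B3))" by linarith
  moreover have "M > 0" by (simp add: M_def)
  moreover have "15 * real (card S) \<le> M" "real (card X) \<le> M / 16" using cardS X(2) by (auto simp: M_def)
  \<comment> \<open>1/2 - 1/8 - 1/15 - 1/16 is still larger than 1/8.\<close>
  ultimately have cG: "real (card G) \<ge> M / 8" using cA cB1 cB2 cB3 by linarith
  have "\<forall>q\<in>G. \<exists>i. i \<in> I \<and> b j \<le> rr i \<and> xx i \<in> q" by (auto simp: G_def A_def)
  from bchoice[OF this] obtain \<iota> where \<iota>: "\<And>q. q \<in> G \<Longrightarrow> \<iota> q \<in> I \<and> b j \<le> rr (\<iota> q) \<and> xx (\<iota> q) \<in> q"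
    by blast
  have Gq: "q = dyadic_at (4 * int j) (xx (\<iota> q))" if "q \<in> G" for q
    using SQc[of q] \<iota>[OF that] that dyadic_at_eq unfolding G_def A_def by blast
  define S' where "S' = S \<union> (\<lambda>q. (j, \<iota> q)) ` G"
  have inj: "inj_on (\<lambda>q. (j, \<iota> q)) G" using Gq by (intro inj_onI) (metis prod.inject)
  have disj: "S \<inter> (\<lambda>q. (j, \<iota> q)) ` G = {}" using S(2) by force
  have Dsub: "D (j, \<iota> q) \<subseteq> q" if "q \<in> G" for q
    using dyadic_at_mono[OF m, of "xx (\<iota> q)"] Gq[OF that] by (simp add: D_def)
  have subQ: "q \<subseteq> Q" if "q \<in> SQ" for q using subcubes_subset[OF c] that unfolding SQ_def Q by blast
  \<comment> \<open>Dyadic cubes are nested or disjoint, and removing \<open>B1\<close> and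
    \<open>B2\<close> has excluded both ways of being nested.\<close>
  have d1: "D s \<inter> D (j, \<iota> q) = {}" if "s \<in> S" "q \<in> G" for s q
  proof -
    have "\<not> q \<subseteq> D s" "\<not> D s \<subseteq> q" using that by (auto simp: G_def A_def B1_def B2_def)
    then have "D s \<inter> q = {}" using Gq[OF that(2)] dyadic_at_cases[of "m (fst s)" "xx (snd s)" "4 * int j" "xx (\<iota> q)"]
      unfolding D_def by argo
    then show ?thesis using Dsub[OF that(2)] by blast
  qed
  have d2: "D (j, \<iota> q) \<inter> D (j, \<iota> q') = {}" if "q \<in> G" "q' \<in> G" "q \<noteq> q'" for q q'
    using Dsub[OF that(1)] Dsub[OF that(2)] SQd[of q q'] that by (auto simp: G_def A_def)
  have adm: "admissible m J0 X Q S'"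
    unfolding admissible_def D_def[symmetric]
  proof (intro conjI ballI impI)
    show "finite S'" using finS fins by (simp add: S'_def)
    fix s assume s: "s \<in> S'"
    show "case s of (j, i) \<Rightarrow> J0 \<le> j \<and> i \<in> I \<and> i \<notin> X \<and> b j \<le> rr i \<and> dyadic_at (m j) (xx i) \<subseteq> Q"
    proof (cases "s \<in> S")
      case True then show ?thesis using S(1) by (auto simp: admissible_def)
    next
      case False
      then obtain q where q: "q \<in> G" "s = (j, \<iota> q)" using s by (auto simp: S'_def)
      have "q \<in> SQ" "q \<notin> B3" using q by (auto simp: G_def A_def)
      then have "\<iota> q \<notin> X" using \<iota>[OF q(1)] by (auto simp: B3_def)
      moreover have "dyadic_at (m j) (xx (\<iota> q)) \<subseteq> Q"
        using Dsub[OF q(1)] subQ[OF \<open>q \<in> SQ\<close>] by (auto simp: D_def)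
      ultimately show ?thesis using \<iota>[OF q(1)] j q(2) by simp
    qed
    fix t assume t: "t \<in> S'" "s \<noteq> t"
    show "D s \<inter> D t = {}"
    proof -
      have SS: "D s \<inter> D t = {}" if "s \<in> S" "t \<in> S"
        using S(1) t(2) that unfolding admissible_def D_def by blast
      consider "s \<in> S" "t \<in> S" | q where "s \<in> S" "q \<in> G" "t = (j, \<iota> q)" | q where "t \<in> S" "q \<in> G" "s = (j, \<iota> q)"
        | q q' where "q \<in> G" "q' \<in> G" "s = (j, \<iota> q)" "t = (j, \<iota> q')"
        using s t(1) unfolding S'_def by blast
      then show ?thesis
      proof cases
        case 1 then show ?thesis by (rule SS)
      next
        case 2 then show ?thesis using d1 by blast
      next
        case 3 then show ?thesis using d1 by blast
      next
        case 4 then show ?thesis using d2[of q q'] t(2) by blast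
      qed
    qed
  qed
  have "real (card S') = real (card S) + real (card G)"
    using finS fins disj inj by (simp add: S'_def card_Un_disjoint card_image)
  moreover have "card G \<le> card SQ" using finSQ by (intro card_mono) (auto simp: G_def A_def)
  ultimately have c': "real (card S') \<le> real (card S) + M" using cardSQ by linarith
  have "(\<Sum>s\<in>S'. cvol CARD('n) (m (fst s))) = (\<Sum>s\<in>S. cvol CARD('n) (m (fst s))) + (\<Sum>s\<in>(\<lambda>q. (j, \<iota> q)) ` G. cvol CARD('n) (m (fst s)))"
    unfolding S'_def using finS fins disj by (intro sum.union_disjoint) auto
  also have "(\<Sum>s\<in>(\<lambda>q. (j, \<iota> q)) ` G. cvol CARD('n) (m (fst s))) = real (card G) * cvol CARD('n) (m j)"
    using inj by (simp add: sum.reindex)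
  finally have s': "(\<Sum>s\<in>S'. cvol CARD('n) (m (fst s))) \<ge> (\<Sum>s\<in>S. cvol CARD('n) (m (fst s))) + M / 8 * cvol CARD('n) (m j)"
    using mult_right_mono[OF cG, of "cvol CARD('n) (m j)"] by simp
  have lv: "fst s < Suc j" if "s \<in> S'" for s using that S(2)[of s] by (auto simp: S'_def)
  show ?thesis by (rule that[OF adm lv]) (use c' s' in \<open>auto simp: M_def\<close>)
qed

text \<open>Greedy choice through the levels. As long as the selected volume is below an eighth of
  the cube, level \<open>j\<close> contributes at least that eighth times the \<open>j\<close>-th
  term of the divergent series, so the eighth is reached after finitely many levels.\<close>

lemma selection:
  assumes Q: "dyadic_at c z \<subseteq> U" and X: "finite X"
    and m: "\<And>j. 4 * int j \<le> m j" and div: "\<not> summable (\<lambda>j. cvol CARD('n) (m j) / cvol CARD('n) (4 * int j))"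
  obtains S where "admissible m J0 X (dyadic_at c z) S" "(\<Sum>s\<in>S. cvol CARD('n) (m (fst s))) \<ge> cvol CARD('n) c / 8"
proof -
  define Q where "Q = dyadic_at c z"
  define M where "M j = cvol CARD('n) c / cvol CARD('n) (4 * int j)" for j
  define a where "a j = cvol CARD('n) (m j) / cvol CARD('n) (4 * int j)" for j
  define T where "T = (2::real) powr (4 * real CARD('n))"
  have T: "T \<ge> 16"
  proof -
    have "2 powr (4 * 1) \<le> T" unfolding T_def by (intro powr_mono mult_left_mono) auto
    then show ?thesis by simp
  qed
  have volT: "cvol CARD('n) (4 * int j) = 1 / T ^ j" for j
    by (simp add: T_def powr_realpow[symmetric] powr_powr powr_minus divide_inverse mult.commute mult.left_commute)
  have MT: "M j = cvol CARD('n) c * T ^ j" for j unfolding M_def volT by simp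
  have MSuc: "M (Suc j) \<ge> 16 * M j" for j
    using T by (simp add: MT mult.assoc mult_right_mono)
  have M0: "M j > 0" for j by (simp add: M_def)
  have "filterlim (\<lambda>j. T ^ j) at_top sequentially"
  proof (rule filterlim_at_top_mono[OF filterlim_real_sequentially])
    have "real j \<le> T ^ j" for j
      using power_mono[of 2 T j] T of_nat_less_two_power[of j, where 'a = real] by linarith
    then show "\<forall>\<^sub>F j in sequentially. real j \<le> T ^ j" by simp
  qed
  then have "filterlim (\<lambda>j. cvol CARD('n) c * T ^ j) at_top sequentially"
    by (intro filterlim_tendsto_pos_mult_at_top[OF tendsto_const]) auto
  then have e1: "\<forall>\<^sub>F j in sequentially. 16 * real (card X) \<le> M j"
    unfolding MT by (rule filterlim_at_top_dense[THEN iffD1, THEN spec, of _ _ "16 * real (card X)", THEN eventually_mono]) simp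
  have e2: "\<forall>\<^sub>F j in sequentially. M j \<le> 2 * real (card {q \<in> subcubes (4 * int j) Q. \<exists>i\<in>I. b j \<le> rr i \<and> xx i \<in> q})"
    using dense[OF Q] unfolding Q_def M_def by (simp add: powr_diff[symmetric] algebra_simps)
  have e3: "\<forall>\<^sub>F j in sequentially. c \<le> 4 * int j"
    by (rule eventually_sequentiallyI[of "nat c"]) linarith
  obtain J1 where J1: "\<And>j. j \<ge> J1 \<Longrightarrow> 16 * real (card X) \<le> M j \<and>
      M j \<le> 2 * real (card {q \<in> subcubes (4 * int j) Q. \<exists>i\<in>I. b j \<le> rr i \<and> xx i \<in> q}) \<and> c \<le> 4 * int j \<and> J0 \<le> j"
    using eventually_conj[OF e1 eventually_conj[OF e2 eventually_conj[OF e3 eventually_ge_at_top[of J0]]]]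
    unfolding eventually_sequentially by auto
  have a0: "a j > 0" for j by (simp add: a_def)
  \<comment> \<open>The \<open>min\<close> with 1 covers both phases, before and after the target is
    reached. The bound on the cardinality survives a step: a fifteenth of \<open>M j\<close> plus
    \<open>M j\<close> is \<open>16 / 15 * M j\<close>, at most a fifteenth of
    \<open>M (Suc j)\<close>.\<close>
  have "\<exists>S. admissible m J0 X Q S \<and> (\<forall>s\<in>S. fst s < J1 + n) \<and> 15 * real (card S) \<le> M (J1 + n) \<and>
      (\<Sum>s\<in>S. cvol CARD('n) (m (fst s))) \<ge> cvol CARD('n) c / 8 * min 1 (\<Sum>k<n. a (J1 + k))" for n
  proof (induction n)
    case 0
    show ?case by (rule exI[of _ "{}"]) (use M0[of J1] in \<open>auto simp: admissible_def\<close>)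
  next
    case (Suc n)
    then obtain S where S: "admissible m J0 X Q S" "\<And>s. s \<in> S \<Longrightarrow> fst s < J1 + n" "15 * real (card S) \<le> M (J1 + n)"
      "(\<Sum>s\<in>S. cvol CARD('n) (m (fst s))) \<ge> cvol CARD('n) c / 8 * min 1 (\<Sum>k<n. a (J1 + k))" by blast
    show ?case
    proof (cases "(\<Sum>s\<in>S. cvol CARD('n) (m (fst s))) \<ge> cvol CARD('n) c / 8")
      case True
      have "15 * real (card S) \<le> M (J1 + Suc n)" using S(3) MSuc[of "J1 + n"] M0[of "J1 + n"] by simp
      moreover have "cvol CARD('n) c / 8 * min 1 (\<Sum>k<Suc n. a (J1 + k)) \<le> cvol CARD('n) c / 8"
        by (simp add: mult_left_le)
      moreover note True
      moreover have "\<forall>s\<in>S. fst s < J1 + Suc n" using S(2) by fastforce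
      ultimately show ?thesis using S(1) by (meson order_trans)
    next
      case False
      note J = J1[of "J1 + n"]
      obtain S' where S': "admissible m J0 X Q S'" "\<And>s. s \<in> S' \<Longrightarrow> fst s < Suc (J1 + n)"
        "real (card S') \<le> real (card S) + cvol CARD('n) c / cvol CARD('n) (4 * int (J1 + n))"
        "(\<Sum>s\<in>S'. cvol CARD('n) (m (fst s))) \<ge> (\<Sum>s\<in>S. cvol CARD('n) (m (fst s))) + cvol CARD('n) c / 8 * (cvol CARD('n) (m (J1 + n)) / cvol CARD('n) (4 * int (J1 + n)))"
      proof (rule selection_step[OF Q_def X, where j = "J1 + n" and ?J0.0 = J0 and m = m and S = S])
        show "4 * int (J1 + n) \<le> m (J1 + n)" by (rule m)
      qed (use J S False in \<open>auto simp: M_def\<close>)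
      have "15 * real (card S') \<le> M (J1 + Suc n)"
        using S'(3) S(3) MSuc[of "J1 + n"] by (simp add: M_def)
      moreover have "(\<Sum>s\<in>S'. cvol CARD('n) (m (fst s))) \<ge> cvol CARD('n) c / 8 * min 1 (\<Sum>k<Suc n. a (J1 + k))"
      proof -
        have "cvol CARD('n) c / 8 * min 1 (\<Sum>k<n. a (J1 + k)) < cvol CARD('n) c / 8 * 1" using False S(4) by linarith
        then have "min 1 (\<Sum>k<n. a (J1 + k)) < 1" by (simp add: mult_less_cancel_left)
        then have "min 1 (\<Sum>k<n. a (J1 + k)) = (\<Sum>k<n. a (J1 + k))" by linarith
        then have "(\<Sum>s\<in>S'. cvol CARD('n) (m (fst s))) \<ge> cvol CARD('n) c / 8 * (\<Sum>k<Suc n. a (J1 + k))"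
          using S'(4) S(4) by (simp add: a_def distrib_left)
        moreover have "cvol CARD('n) c / 8 * min 1 (\<Sum>k<Suc n. a (J1 + k)) \<le> cvol CARD('n) c / 8 * (\<Sum>k<Suc n. a (J1 + k))"
          by (intro mult_left_mono) auto
        ultimately show ?thesis by linarith
      qed
      ultimately show ?thesis using S'(1,2) by (intro exI[of _ S']) auto
    qed
  qed
  moreover obtain n where "(\<Sum>k<n. a (J1 + k)) \<ge> 1"
  proof (rule ccontr)
    assume "\<not> thesis"
    then have "(\<Sum>k<n. a (k + J1)) \<le> 1" for n
    proof -
      have "\<not> 1 \<le> (\<Sum>k<n. a (J1 + k))" using that[of n] \<open>\<not> thesis\<close> by blast
      then show ?thesis by (simp add: add.commute)
    qed
    note bd = this
    have "summable (\<lambda>k. a (k + J1))"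
    proof (rule bounded_imp_summable[where B = 1])
      fix n
      show "0 \<le> a (n + J1)" using a0 less_imp_le by blast
      show "(\<Sum>k\<le>n. a (k + J1)) \<le> 1"
        using bd[of "Suc n"] unfolding lessThan_Suc_atMost .
    qed
    then have "summable a" by (simp add: summable_iff_shift)
    then show False using div unfolding a_def by contradiction
  qed
  ultimately obtain S where "admissible m J0 X Q S" "(\<Sum>s\<in>S. cvol CARD('n) (m (fst s))) \<ge> cvol CARD('n) c / 8"
    by (metis min.absorb1 mult.right_neutral)
  then show ?thesis using that unfolding Q_def by blast
qed

abbreviation limsup_set :: "(real^'n) set" where
  "limsup_set \<equiv> limsup_balls N I rr xx"

text \<open>For every \<open>k\<close>, even with the indices below \<open>k\<close> forbidden,
  selected cubes fill an eighth of each dyadic cube in \<open>U\<close>, and each lies in the ball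
  of its atom because its diameter is below \<open>b j\<close>. So \<open>U - G k\<close> has
  density at most 7/8 in every such cube and is null.\<close>

lemma full_measure:
  assumes U: "open U" and m: "\<And>j. 4 * int j \<le> m j" and div: "\<not> summable (\<lambda>j. cvol CARD('n) (m j) / cvol CARD('n) (4 * int j))"
    and mb: "\<And>j. unit_diam N * 2 powr (- real_of_int (m j)) < b j"
  shows "U - limsup_set \<in> null_sets lborel"
proof -
  define G where "G k = (\<Union>i\<in>I - {..<k}. {y. N (y - xx i) < rr i})" for k
  have Gb: "G k \<in> sets borel" for k unfolding G_def using open_norm_ball[OF norm] by (intro borel_open open_UN) auto
  have "emeasure lborel (U - G k) = 0" for k
  proof (rule null_if_dyadic_density[OF U, of _ "7/8"])
    fix c :: int and z :: "real^'n" assume Q: "dyadic_at c z \<subseteq> U"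
    obtain S where S: "admissible m 0 {..<k} (dyadic_at c z) S" "(\<Sum>s\<in>S. cvol CARD('n) (m (fst s))) \<ge> cvol CARD('n) c / 8"
      using selection[OF Q _ m div, of "{..<k}" 0] by blast
    define D where "D s = dyadic_at (m (fst s)) (xx (snd s))" for s
    have DG: "D s \<subseteq> G k \<inter> dyadic_at c z" if "s \<in> S" for s
    proof -
      obtain j i where s: "s = (j, i)" by force
      have h: "i \<in> I" "i \<notin> {..<k}" "b j \<le> rr i" "dyadic_at (m j) (xx i) \<subseteq> dyadic_at c z"
        using S(1) that s by (auto simp: admissible_def)
      have "y \<in> G k" if "y \<in> D s" for y
        using dyadic_at_norm_diff[OF norm _ dyadic_at_refl, of y "m j" "xx i"] that mb[of j] h s
        unfolding G_def D_def by fastforce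
      then show ?thesis using h(4) s by (auto simp: D_def)
    qed
    have "emeasure lborel (\<Union>s\<in>S. D s) = ennreal (\<Sum>s\<in>S. cvol CARD('n) (m (fst s)))"
      unfolding D_def using S(1) by (intro emeasure_UN_dyadic_at) (auto simp: admissible_def)
    note emD = this
    then have 1: "ennreal (cvol CARD('n) c / 8) \<le> emeasure lborel (\<Union>s\<in>S. D s)" using S(2) by (simp add: ennreal_leI)
    have fS: "finite S" using S(1) by (simp add: admissible_def)
    have Db: "(\<Union>s\<in>S. D s) \<in> sets borel" using fS by (auto simp: D_def)
    have "emeasure lborel ((U - G k) \<inter> dyadic_at c z) \<le> emeasure lborel (dyadic_at c z - (\<Union>s\<in>S. D s))"
      using Db DG by (intro emeasure_mono) auto
    also have "\<dots> = emeasure lborel (dyadic_at c z) - emeasure lborel (\<Union>s\<in>S. D s)"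
      using Db DG emD by (intro emeasure_Diff) auto
    also have "\<dots> \<le> ennreal (cvol CARD('n) c) - ennreal (cvol CARD('n) c / 8)"
      unfolding emeasure_dyadic_at by (intro ennreal_minus_mono 1) auto
    also have "\<dots> = ennreal (7/8) * emeasure lborel (dyadic_at c z)"
      by (simp add: emeasure_dyadic_at ennreal_mult[symmetric] ennreal_minus)
    finally show "emeasure lborel ((U - G k) \<inter> dyadic_at c z) \<le> ennreal (7/8) * emeasure lborel (dyadic_at c z)" .
  qed (use U Gb in auto)
  then have "(\<Union>k. U - G k) \<in> null_sets lborel"
    using U Gb by (intro null_sets_UN') (auto simp: null_sets_def)
  moreover have "U - limsup_set = (\<Union>k. U - G k)"
  proof -
    have "y \<in> limsup_set \<longleftrightarrow> (\<forall>k. y \<in> G k)" for y unfolding limsup_balls_iff G_def by simp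
    then show ?thesis by blast
  qed
  ultimately show ?thesis by simp
qed

end

text \<open>\<open>f\<close> prices a cube of scale \<open>j\<close> at \<open>\<eta> j\<close>.
  Around a selected atom of level \<open>j\<close> there are two scales: \<open>m j\<close> for the
  reserved cube, whose volume relative to the level has a divergent sum, and \<open>e j\<close> for
  a cube inside the ball. \<open>growth\<close> is the room between them, \<open>eta_vol\<close>
  states that the price per volume does not drop towards small cubes, and the 4 in \<open>eb\<close>
  lets even a cube of scale \<open>e j - 2\<close> around the atom fit in its ball.\<close>

locale ubiquity_cost = ubiquity N I rr xx b U
  for N :: "real^'n \<Rightarrow> real" and I rr xx b U +
  fixes f :: "(real^'n) set \<Rightarrow> ennreal" and \<eta> :: "int \<Rightarrow> ennreal" and e0 :: int
    and m e :: "nat \<Rightarrow> int"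
  assumes f: "\<And>j x. e0 \<le> j \<Longrightarrow> f (dyadic_at j x) = \<eta> j"
    and eta_mono: "\<And>j j'. e0 \<le> j \<Longrightarrow> j \<le> j' \<Longrightarrow> \<eta> j' \<le> \<eta> j"
    and eta_vol: "\<And>j j'. e0 \<le> j \<Longrightarrow> j \<le> j' \<Longrightarrow>
      \<eta> j * ennreal (2 powr (- real CARD('n) * real_of_int j')) \<le> \<eta> j' * ennreal (2 powr (- real CARD('n) * real_of_int j))"
    and eta_fin: "\<And>j. e0 \<le> j \<Longrightarrow> \<eta> j < \<infinity>"
    and m: "\<And>j. 4 * int j \<le> m j"
    and e: "\<And>j. m j + 2 \<le> e j"
    and eb: "\<And>j. 4 * (unit_diam N * 2 powr (- real_of_int (e j))) < b j"
    and div: "\<not> summable (\<lambda>j. 2 powr (- real CARD('n) * real_of_int (m j)) / 2 powr (- real CARD('n) * real_of_int (4 * int j)))"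
    and growth: "\<And>K. \<forall>\<^sub>F j in sequentially. ennreal K * ennreal (2 powr (- real CARD('n) * real_of_int (m j))) \<le> \<eta> (e j)"
begin

context
  fixes C :: "(real^'n) set set"
  assumes C: "C \<subseteq> dyadic_cubes"
begin

text \<open>\<open>C\<close> is a covering by dyadic cubes that is too cheap to cover the points of the limsup set in a
  good cube.\<close>

definition good :: "(real^'n) set \<Rightarrow> bool" where
  "good Q \<longleftrightarrow> (\<forall>K\<in>C. \<not> Q \<subseteq> K) \<and> 32 * cost f {K \<in> C. K \<subseteq> Q} < f Q"

text \<open>Price per volume is least for the large cube itself, so the share of its volume that is
  covered by cubes inside it is at most the share of its price that they cost.\<close>

lemma vol_le_cost:
  assumes "e0 \<le> c"
  shows "\<eta> c * emeasure lborel (\<Union>{K \<in> C. K \<subseteq> dyadic_at c z}) \<le> ennreal (cvol CARD('n) c) * cost f {K \<in> C. K \<subseteq> dyadic_at c z}"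
proof -
  let ?C = "{K \<in> C. K \<subseteq> dyadic_at c z}"
  have count: "countable ?C" using C countable_dyadic_cubes by (metis (no_types, lifting) countable_subset mem_Collect_eq subsetI subsetD)
  have "emeasure lborel (\<Union>?C) \<le> (\<integral>\<^sup>+K. emeasure lborel K \<partial>count_space ?C)"
    using count C by (intro emeasure_Union_le_nn_integral) (auto intro: dyadic_cubes_borel)
  then have "\<eta> c * emeasure lborel (\<Union>?C) \<le> \<eta> c * (\<integral>\<^sup>+K. emeasure lborel K \<partial>count_space ?C)"
    by (intro mult_left_mono) auto
  also have "\<dots> = (\<integral>\<^sup>+K. \<eta> c * emeasure lborel K \<partial>count_space ?C)"
    by (simp add: nn_integral_cmult)
  also have "\<dots> \<le> (\<integral>\<^sup>+K. ennreal (cvol CARD('n) c) * f K \<partial>count_space ?C)"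
  proof (rule nn_integral_mono)
    fix K assume "K \<in> space (count_space ?C)"
    then have K: "K \<in> C" "K \<subseteq> dyadic_at c z" by auto
    then obtain j x where jx: "K = dyadic_at j x" using C dyadic_cubesE by blast
    then have "c \<le> j" using K dyadic_at_subset_gen by blast
    then show "\<eta> c * emeasure lborel K \<le> ennreal (cvol CARD('n) c) * f K"
      using eta_vol[OF assms, of j] f[of j x] assms by (simp add: jx emeasure_dyadic_at mult.commute)
  qed
  also have "\<dots> = ennreal (cvol CARD('n) c) * cost f ?C" by (simp add: nn_integral_cmult cost_eq)
  finally show ?thesis .
qed

text \<open>Suppose the inner cube \<open>Q' s\<close> is bad for every selected pair. Then each
  reserved cube \<open>D s\<close> either contains cover cubes of total price at least
  \<open>\<eta> (e (fst s)) / 32\<close>, or lies in one cover cube inside \<open>Q\<close>. Either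
  kind can occupy at most \<open>v / 32\<close> of the volume, against the \<open>v / 8\<close> that
  was selected.\<close>

lemma good_step:
  assumes c: "e0 \<le> c" and QU: "dyadic_at c z \<subseteq> U" and good: "good (dyadic_at c z)" and X: "finite X"
  obtains i c' z' where "i \<in> I" "i \<notin> X" "c < c'" "good (dyadic_at c' z')" "closure (dyadic_at c' z') \<subseteq> dyadic_at c z"
    "dyadic_at c' z' \<subseteq> {y. N (y - xx i) < rr i}"
proof -
  define Q where "Q = dyadic_at c z"
  define h where "h = enn2real (\<eta> c)"
  have \<eta>h: "\<eta> c = ennreal h" using eta_fin[OF c] by (simp add: h_def)
  have fQ: "f Q = ennreal h" using f[OF c] \<eta>h by (simp add: Q_def)
  have "0 < f Q" using good unfolding good_def Q_def by (metis not_gr_zero not_less_zero)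
  then have h0: "h > 0" by (simp add: fQ)
  define CQ where "CQ = {K \<in> C. K \<subseteq> Q}"
  have costQ: "32 * cost f CQ < ennreal h" using good fQ by (simp add: good_def CQ_def Q_def)
  define v where "v = cvol CARD('n) c"
  have v: "v > 0" by (simp add: v_def)
  \<comment> \<open>With this value, \<open>K0\<close> times a volume of \<open>v / 32\<close>
    equals \<open>h\<close>, the bound on 32 times the cost of the cover inside
    \<open>Q\<close>.\<close>
  define K0 where "K0 = 32 * h / v"
  have K0: "K0 > 0" using h0 v by (simp add: K0_def)
  have "\<forall>\<^sub>F j in sequentially. ennreal K0 * ennreal (cvol CARD('n) (m j)) \<le> \<eta> (e j)" by (rule growth)
  then obtain J1 where J1: "\<And>j. j \<ge> J1 \<Longrightarrow> ennreal K0 * ennreal (cvol CARD('n) (m j)) \<le> \<eta> (e j)"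
    unfolding eventually_sequentially by blast
  obtain S where S: "admissible m J1 X Q S" "(\<Sum>s\<in>S. cvol CARD('n) (m (fst s))) \<ge> v / 8"
    using selection[OF QU X m div, of J1] unfolding Q_def v_def by blast
  define D where "D s = dyadic_at (m (fst s)) (xx (snd s))" for s :: "nat \<times> nat"
  have finS: "finite S" using S(1) by (simp add: admissible_def)
  have dis: "D s \<inter> D t = {}" if "s \<in> S" "t \<in> S" "s \<noteq> t" for s t
    using S(1) that by (simp add: admissible_def D_def)
  have DQ: "D s \<subseteq> Q" if "s \<in> S" for s using S(1) that unfolding admissible_def D_def by (cases s) auto
  have "\<exists>p. closure (dyadic_at (g + 2) p) \<subseteq> dyadic_at g x" for g and x :: "real^'n"
    using inner_subcube by blast
  then obtain pp where pp: "\<And>g (x::real^'n). closure (dyadic_at (g + 2) (pp g x)) \<subseteq> dyadic_at g x" by metis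
  \<comment> \<open>The cube of scale \<open>e (fst s) - 2\<close> around the atom lies in its ball;
    \<open>Q' s\<close> is a subcube of it whose closure does not leave it.\<close>
  define p where "p s = pp (e (fst s) - 2) (xx (snd s))" for s :: "nat \<times> nat"
  define Q' where "Q' s = dyadic_at (e (fst s)) (p s)" for s
  have Q'1: "closure (Q' s) \<subseteq> dyadic_at (e (fst s) - 2) (xx (snd s))" for s
    using pp[of "e (fst s) - 2" "xx (snd s)"] by (simp add: Q'_def p_def)
  have Q'D: "closure (Q' s) \<subseteq> D s" for s
    using Q'1[of s] dyadic_at_mono[of "m (fst s)" "e (fst s) - 2" "xx (snd s)"] e[of "fst s"] by (auto simp: D_def)
  have Q'D': "Q' s \<subseteq> D s" for s using Q'D closure_subset by blast
  have "\<exists>s\<in>S. good (Q' s)"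
  proof (rule ccontr)
    assume bad: "\<not> (\<exists>s\<in>S. good (Q' s))"
    have gens: "c \<le> m (fst s)" if "s \<in> S" for s
      using DQ[OF that] dyadic_at_subset_gen unfolding D_def Q_def by blast
    \<comment> \<open>A cover cube \<open>K\<close> that swallows \<open>Q' s\<close> is nested with
      \<open>D s\<close>. If \<open>K\<close> is the smaller one, it alone costs at least
      \<open>\<eta> (e (fst s))\<close>; otherwise it swallows \<open>D s\<close>, and it lies in
      \<open>Q\<close> since no cover cube contains \<open>Q\<close>.\<close>
    have alt: "(\<exists>K\<in>CQ. D s \<subseteq> K) \<or> \<eta> (e (fst s)) \<le> 32 * cost f {K \<in> C. K \<subseteq> D s}" if s: "s \<in> S" for s
    proof -
      have es: "e0 \<le> e (fst s)" using gens[OF s] e[of "fst s"] c by linarith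
      have fQ': "f (Q' s) = \<eta> (e (fst s))" using f[OF es] by (simp add: Q'_def)
      have "(\<exists>K\<in>C. Q' s \<subseteq> K) \<or> 32 * cost f {K \<in> C. K \<subseteq> Q' s} \<ge> \<eta> (e (fst s))"
        using bad s by (auto simp: good_def fQ'[symmetric] not_less)
      then show ?thesis
      proof
        assume "\<exists>K\<in>C. Q' s \<subseteq> K"
        then obtain K where K: "K \<in> C" "Q' s \<subseteq> K" by blast
        then obtain g y where gy: "K = dyadic_at g y" using C dyadic_cubesE by blast
        have ne: "p s \<in> Q' s" by (simp add: Q'_def)
        then have pK: "p s \<in> K" "p s \<in> D s" using K Q'D'[of s] by auto
        consider "K \<subseteq> D s" | "D s \<subseteq> K" 
          using dyadic_at_cases[of g y "m (fst s)" "xx (snd s)"] pK unfolding gy D_def by blast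
        then show ?thesis
        proof cases
          case 1
          have "g \<le> e (fst s)" using K(2) dyadic_at_subset_gen unfolding Q'_def gy by blast
          moreover have "e0 \<le> g" using 1 gens[OF s] c dyadic_at_subset_gen[of g y "m (fst s)" "xx (snd s)"] unfolding gy D_def by linarith
          ultimately have "\<eta> (e (fst s)) \<le> f K" using f[of g y] eta_mono[of g "e (fst s)"] gy by simp
          also have "\<dots> \<le> cost f {K \<in> C. K \<subseteq> D s}" using K 1 by (intro cost_ge) auto
          also have "\<dots> \<le> 32 * cost f {K \<in> C. K \<subseteq> D s}"
            using mult_right_mono[of 1 "32::ennreal" "cost f {K \<in> C. K \<subseteq> D s}"] by simp
          finally show ?thesis by blast
        next
          case 2
          have "K \<subseteq> Q" using dyadic_at_cases[of g y c z] pK DQ[OF s] good K unfolding gy Q_def good_def by blast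
          then show ?thesis using 2 K by (auto simp: CQ_def)
        qed
      next
        assume *: "32 * cost f {K \<in> C. K \<subseteq> Q' s} \<ge> \<eta> (e (fst s))"
        have "cost f {K \<in> C. K \<subseteq> Q' s} \<le> cost f {K \<in> C. K \<subseteq> D s}" using Q'D'[of s] by (intro cost_mono) auto
        then show ?thesis using * by (meson mult_left_mono order_trans zero_le)
      qed
    qed
    define Sa where "Sa = {s \<in> S. \<eta> (e (fst s)) \<le> 32 * cost f {K \<in> C. K \<subseteq> D s}}"
    define Sb where "Sb = {s \<in> S. \<exists>K\<in>CQ. D s \<subseteq> K}"
    have fin: "finite Sa" "finite Sb" using finS by (auto simp: Sa_def Sb_def)
    have SS: "S = Sa \<union> Sb" using alt by (auto simp: Sa_def Sb_def)
    \<comment> \<open>The reserved cubes are disjoint, so the costs inside them add up to at most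
      that of the cover inside \<open>Q\<close>.\<close>
    have va: "(\<Sum>s\<in>Sa. cvol CARD('n) (m (fst s))) < v / 32"
    proof -
      have "ennreal (K0 * (\<Sum>s\<in>Sa. cvol CARD('n) (m (fst s)))) = (\<Sum>s\<in>Sa. ennreal K0 * ennreal (cvol CARD('n) (m (fst s))))"
      proof -
        have "(\<Sum>s\<in>Sa. ennreal K0 * ennreal (cvol CARD('n) (m (fst s)))) = (\<Sum>s\<in>Sa. ennreal (K0 * cvol CARD('n) (m (fst s))))"
          using K0 by (intro sum.cong refl) (simp add: ennreal_mult)
        also have "\<dots> = ennreal (\<Sum>s\<in>Sa. K0 * cvol CARD('n) (m (fst s)))"
          using K0 by (intro sum_ennreal) auto
        finally show ?thesis by (simp add: sum_distrib_left)
      qed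
      also have "\<dots> \<le> (\<Sum>s\<in>Sa. 32 * cost f {K \<in> C. K \<subseteq> D s})"
      proof (rule sum_mono)
        fix s assume "s \<in> Sa"
        then have "J1 \<le> fst s" "\<eta> (e (fst s)) \<le> 32 * cost f {K \<in> C. K \<subseteq> D s}"
          using S(1) by (auto simp: Sa_def admissible_def)
        then show "ennreal K0 * ennreal (cvol CARD('n) (m (fst s))) \<le> 32 * cost f {K \<in> C. K \<subseteq> D s}"
          using J1[of "fst s"] order_trans by blast
      qed
      also have "\<dots> = 32 * cost f (\<Union>s\<in>Sa. {K \<in> C. K \<subseteq> D s})"
      proof -
        have "{K \<in> C. K \<subseteq> D s} \<inter> {K \<in> C. K \<subseteq> D t} = {}" if st: "s \<in> Sa" "t \<in> Sa" "s \<noteq> t" for s t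
        proof -
          have "D s \<inter> D t = {}" using dis st by (auto simp: Sa_def)
          moreover have "K \<noteq> {}" if "K \<in> C" for K using that C dyadic_cubesE dyadic_at_refl by (metis empty_iff subsetD)
          ultimately show ?thesis by blast
        qed
        then show ?thesis by (subst cost_sum_disjoint[symmetric]) (auto simp: fin sum_distrib_left)
      qed
      also have "\<dots> \<le> 32 * cost f CQ"
        using DQ by (intro mult_left_mono cost_mono) (auto simp: Sa_def CQ_def)
      also have "\<dots> < ennreal h" by (rule costQ)
      finally have "K0 * (\<Sum>s\<in>Sa. cvol CARD('n) (m (fst s))) < h"
        using K0 by (subst (asm) ennreal_less_iff) (auto intro!: mult_nonneg_nonneg sum_nonneg)
      then show ?thesis using h0 v by (simp add: K0_def field_simps)
    qed
    \<comment> \<open>Here the reserved volume is swallowed by cover cubes, whose volume is bounded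
      by their price through \<open>vol_le_cost\<close>.\<close>
    have vb: "(\<Sum>s\<in>Sb. cvol CARD('n) (m (fst s))) \<le> v / 32"
    proof -
      have cd: "countable CQ" using C countable_dyadic_cubes unfolding CQ_def
        by (metis (no_types, lifting) countable_subset mem_Collect_eq subsetI subsetD)
      have "ennreal (h * (\<Sum>s\<in>Sb. cvol CARD('n) (m (fst s)))) = \<eta> c * emeasure lborel (\<Union>s\<in>Sb. D s)"
        unfolding D_def using dis[unfolded D_def] fin h0
        by (subst emeasure_UN_dyadic_at) (auto simp: Sb_def \<eta>h ennreal_mult sum_nonneg)
      also have "\<dots> \<le> \<eta> c * emeasure lborel (\<Union>CQ)"
      proof (intro mult_left_mono emeasure_mono)
        show "(\<Union>s\<in>Sb. D s) \<subseteq> \<Union>CQ" by (auto simp: Sb_def)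
        show "\<Union>CQ \<in> sets lborel" using cd C by (intro sets.countable_Union) (auto simp: CQ_def intro!: dyadic_cubes_borel)
      qed auto
      also have "\<dots> \<le> ennreal v * cost f CQ" using vol_le_cost[OF c, of z] by (simp add: CQ_def Q_def v_def)
      finally have "32 * ennreal (h * (\<Sum>s\<in>Sb. cvol CARD('n) (m (fst s)))) \<le> 32 * (ennreal v * cost f CQ)"
        by (intro mult_left_mono) auto
      also have "\<dots> = ennreal v * (32 * cost f CQ)" by (simp add: mult.left_commute)
      also have "\<dots> \<le> ennreal v * ennreal h" using costQ by (intro mult_left_mono) auto
      finally have "ennreal (32 * (h * (\<Sum>s\<in>Sb. cvol CARD('n) (m (fst s))))) \<le> ennreal (v * h)"
        using h0 v by (simp add: ennreal_mult sum_nonneg)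
      then have "32 * (h * (\<Sum>s\<in>Sb. cvol CARD('n) (m (fst s)))) \<le> v * h"
        using h0 v by (simp add: ennreal_le_iff)
      then show ?thesis using h0 by (simp add: field_simps)
    qed
    have "(\<Sum>s\<in>S. cvol CARD('n) (m (fst s))) \<le> (\<Sum>s\<in>Sa. cvol CARD('n) (m (fst s))) + (\<Sum>s\<in>Sb. cvol CARD('n) (m (fst s)))"
      unfolding SS using fin sum.union_inter[of Sa Sb "\<lambda>s. cvol CARD('n) (m (fst s))"] sum_nonneg[of "Sa \<inter> Sb" "\<lambda>s. cvol CARD('n) (m (fst s))"] by simp
    then show False using S(2) va vb v by linarith
  qed
  then obtain s where s: "s \<in> S" "good (Q' s)" by blast
  obtain j i where ji: "s = (j, i)" by force
  have h: "i \<in> I" "i \<notin> X" "b j \<le> rr i" "D s \<subseteq> Q" using S(1) s(1) ji DQ by (auto simp: admissible_def)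
  have "c \<le> m j" using h(4) dyadic_at_subset_gen unfolding D_def Q_def ji fst_conv snd_conv by blast
  then have ce: "c < e j" using e[of j] by linarith
  have ball: "Q' s \<subseteq> {y. N (y - xx i) < rr i}"
  proof
    fix y assume "y \<in> Q' s"
    then have "y \<in> dyadic_at (e j - 2) (xx i)" using Q'1[of s] closure_subset ji by fastforce
    then have "N (y - xx i) \<le> unit_diam N * 2 powr (- real_of_int (e j - 2))"
      by (intro dyadic_at_norm_diff[OF norm]) auto
    also have "\<dots> = 4 * (unit_diam N * 2 powr (- real_of_int (e j)))" by (simp add: powr_diff powr_minus field_simps)
    also have "\<dots> < b j" by (rule eb)
    finally show "y \<in> {y. N (y - xx i) < rr i}" using h(3) by simp
  qed
  show ?thesis
    by (rule that[of i "e j" "p s"]) (use h ce ball s(2) Q'D[of s] ji in \<open>auto simp: Q'_def Q_def\<close>)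
qed

text \<open>Iterating \<open>good_step\<close> gives good cubes with closures inside their
  predecessors, each in the ball of a further atom. A common point \<open>y\<close> belongs to the
  limsup set, hence to a cover cube \<open>K\<close>; once the scale has reached that of
  \<open>K\<close>, the good cube around \<open>y\<close> lies in \<open>K\<close>, contrary to
  goodness.\<close>

theorem not_good:
  assumes c: "e0 \<le> c" and QU: "dyadic_at c z \<subseteq> U" and cover: "limsup_set \<inter> dyadic_at c z \<subseteq> \<Union>C"
  shows "\<not> good (dyadic_at c z)"
proof
  assume good0: "good (dyadic_at c z)"
  \<comment> \<open>\<open>X\<close> collects the distinct atoms used so far;
    \<open>n \<le> card X\<close> makes their number unbounded, and
    \<open>c + int n \<le> c'\<close> makes the scale unbounded.\<close>
  define P where "P n = (\<lambda>(c', z', X). finite X \<and> c + int n \<le> c' \<and> n \<le> card X \<and> X \<subseteq> I \<and> dyadic_at c' z' \<subseteq> dyadic_at c z \<and>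
      good (dyadic_at c' z') \<and> (\<forall>i\<in>X. dyadic_at c' z' \<subseteq> {y. N (y - xx i) < rr i}))" for n :: nat
  define R where "R = (\<lambda>(c', z', X::nat set) (c'', z'', X'::nat set). closure (dyadic_at c'' z'') \<subseteq> dyadic_at c' (z'::real^'n))"
  have "\<exists>g. \<forall>n. P n (g n) \<and> R (g n) (g (Suc n))"
  proof (rule dependent_nat_choice)
    show "\<exists>x. P 0 x" by (rule exI[of _ "(c, z, {})"]) (use good0 in \<open>auto simp: P_def\<close>)
  next
    fix s n assume Ps: "P n s"
    obtain c' z' X where s: "s = (c', z', X)" by (cases s) auto
    have h: "finite X" "c + int n \<le> c'" "n \<le> card X" "X \<subseteq> I" "dyadic_at c' z' \<subseteq> dyadic_at c z" "good (dyadic_at c' z')"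
      "\<And>i. i \<in> X \<Longrightarrow> dyadic_at c' z' \<subseteq> {y. N (y - xx i) < rr i}" using Ps by (auto simp: P_def s)
    have "e0 \<le> c'" "dyadic_at c' z' \<subseteq> U" using h c QU by auto
    then obtain i c'' z'' where st: "i \<in> I" "i \<notin> X" "c' < c''" "good (dyadic_at c'' z'')"
      "closure (dyadic_at c'' z'') \<subseteq> dyadic_at c' z'" "dyadic_at c'' z'' \<subseteq> {y. N (y - xx i) < rr i}"
      using good_step[OF _ _ h(6,1)] by blast
    have sub: "dyadic_at c'' z'' \<subseteq> dyadic_at c' z'" using st(5) closure_subset by blast
    have "P (Suc n) (c'', z'', insert i X)"
    proof -
      have "\<forall>i'\<in>insert i X. dyadic_at c'' z'' \<subseteq> {y. N (y - xx i') < rr i'}" using h(7) st(6) sub by blast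
      then show ?thesis unfolding P_def using h(1-6) st sub by auto
    qed
    moreover have "R s (c'', z'', insert i X)" using st(5) by (simp add: R_def s)
    ultimately show "\<exists>y. P (Suc n) y \<and> R s y" by blast
  qed
  then obtain g where g: "\<And>n. P n (g n)" "\<And>n. R (g n) (g (Suc n))" by blast
  define A where "A n = (case g n of (c', z', X) \<Rightarrow> dyadic_at c' z')" for n
  have AS: "closure (A (Suc n)) \<subseteq> A n" for n using g(2)[of n] by (auto simp: A_def R_def split: prod.splits)
  have "\<Inter> (range (\<lambda>n. closure (A n))) \<noteq> {}"
  proof (rule compact_nest)
    fix n
    show "compact (closure (A n))" using bounded_dyadic_at by (auto simp: A_def compact_closure split: prod.splits)
    show "closure (A n) \<noteq> {}" by (auto simp: A_def split: prod.splits intro: dyadic_at_refl)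
  next
    fix m n :: nat assume "m \<le> n"
    then show "closure (A n) \<subseteq> closure (A m)"
      by (induction n rule: dec_induct) (use AS closure_subset in \<open>blast+\<close>)
  qed
  then obtain y where "\<And>n. y \<in> closure (A n)" by blast
  then have y: "y \<in> A n" for n using AS by blast
  have "infinite {i \<in> I. N (y - xx i) < rr i}"
  proof
    assume fin: "finite {i \<in> I. N (y - xx i) < rr i}"
    define n where "n = Suc (card {i \<in> I. N (y - xx i) < rr i})"
    obtain c' z' X where gn: "g n = (c', z', X)" by (cases "g n") auto
    have "X \<subseteq> {i \<in> I. N (y - xx i) < rr i}" "n \<le> card X"
      using g(1)[of n] y[of n] by (auto simp: P_def A_def gn)
    then show False using card_mono[OF fin, of X] by (simp add: n_def)
  qed
  moreover have "y \<in> dyadic_at c z" using y[of 0] g(1)[of 0] by (auto simp: P_def A_def split: prod.splits)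
  ultimately obtain K where K: "K \<in> C" "y \<in> K" using cover by (auto simp: limsup_balls_def)
  then obtain k x where "K = dyadic_at k x" using C dyadic_cubesE by blast
  then have Ky: "K = dyadic_at k y" using K(2) dyadic_at_eq by metis
  define n where "n = nat (k - c)"
  obtain c' z' X where gn: "g n = (c', z', X)" by (cases "g n") auto
  have h: "c + int n \<le> c'" "good (dyadic_at c' z')" "y \<in> dyadic_at c' z'" using g(1)[of n] y[of n] by (auto simp: P_def A_def gn)
  then have "dyadic_at c' z' = dyadic_at c' y" using dyadic_at_eq by metis
  then have "dyadic_at c' z' \<subseteq> K" proof -
    have "k \<le> c'" using h(1) unfolding n_def by linarith
    then show ?thesis using \<open>dyadic_at c' z' = dyadic_at c' y\<close> dyadic_at_mono[of k c' y] Ky by simp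
  qed
  then show False using h(2) K(1) by (auto simp: good_def)
qed

corollary cover_cost:
  assumes "e0 \<le> c" "dyadic_at c z \<subseteq> U" "limsup_set \<inter> dyadic_at c z \<subseteq> \<Union>C"
  obtains K where "K \<in> C" "dyadic_at c z \<subseteq> K" | "f (dyadic_at c z) \<le> 32 * cost f {K \<in> C. K \<subseteq> dyadic_at c z}"
  using not_good[OF assms] by (auto simp: good_def not_less)

end

end

section \<open>From families of cubes to sequences and net content\<close>

lemma cost_sequence:
  assumes "countable C" "f {} = 0"
  obtains c where "\<And>n::nat. c n \<in> C \<or> c n = {}" "\<Union>C \<subseteq> (\<Union>n. c n)" "(\<Sum>n. f (c n)) \<le> cost f C"
proof -
  define T where "T = to_nat_on C ` C"
  define c where "c n = (if n \<in> T then from_nat_into C n else {})" for n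
  define A where "A n = (if n \<in> T then {from_nat_into C n} else {})" for n
  have T: "from_nat_into C n \<in> C \<and> to_nat_on C (from_nat_into C n) = n" if "n \<in> T" for n
    using that assms(1) by (auto simp: T_def)
  have "\<Union>C \<subseteq> (\<Union>n. c n)"
  proof
    fix x assume "x \<in> \<Union>C"
    then obtain K where K: "K \<in> C" "x \<in> K" by blast
    then have "c (to_nat_on C K) = K" using assms(1) by (simp add: c_def T_def)
    then show "x \<in> (\<Union>n. c n)" using K by blast
  qed
  moreover have "(\<Sum>n. f (c n)) \<le> (\<Sum>n. cost f (A n))"
    by (intro suminf_le) (auto simp: c_def A_def assms(2))
  moreover have "(\<Sum>n. cost f (A n)) = cost f (\<Union>n. A n)"
    unfolding cost_def
  proof (intro suminf_emeasure)
    have "from_nat_into C m \<noteq> from_nat_into C n" if "m \<in> T" "n \<in> T" "m \<noteq> n" for m n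
      using T[OF that(1)] T[OF that(2)] that(3) by metis
    then show "disjoint_family A" by (auto simp: disjoint_family_on_def A_def)
  qed auto
  moreover have "cost f (\<Union>n. A n) \<le> cost f C" by (intro cost_mono) (auto simp: A_def T split: if_splits)
  moreover have "c n \<in> C \<or> c n = {}" for n using T by (auto simp: c_def)
  ultimately show ?thesis using that order_trans by metis
qed

text \<open>Removing repetitions and empty members from a sequence does not raise the cost;
  \<open>cost_sequence\<close> is the converse passage, which pads with empty sets.\<close>

lemma cost_range_le: "cost f (range c - {{}}) \<le> (\<Sum>n. f (c n))"
proof -
  have "cost f (range c - {{}}) \<le> cost f (\<Union>n. {c n})" by (intro cost_mono) auto
  also have "\<dots> \<le> (\<Sum>n. cost f {c n})" by (rule cost_UN_le)
  finally show ?thesis by simp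
qed

abbreviation dcost :: "(real^'n \<Rightarrow> real) \<Rightarrow> (ennreal \<Rightarrow> ennreal) \<Rightarrow> (real^'n) set set \<Rightarrow> ennreal" where
  "dcost N h \<equiv> cost (\<lambda>K. h (ndiam N K))"

lemma M_inf_le_cost:
  fixes N :: "real^'n \<Rightarrow> real"
  assumes "h 0 = 0" "eps_h CARD('n) h > 0" "C \<subseteq> dyadic_cubes" "\<And>K. K \<in> C \<Longrightarrow> ndiam N K < eps_h CARD('n) h" "E \<subseteq> \<Union>C"
  shows "M_inf N h E \<le> dcost N h C"
proof -
  have "countable C" using assms(3) countable_dyadic_cubes countable_subset by blast
  then obtain c where c: "\<And>n::nat. c n \<in> C \<or> c n = {}" "\<Union>C \<subseteq> (\<Union>n. c n)" "(\<Sum>n. h (ndiam N (c n))) \<le> dcost N h C"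
    using cost_sequence[of C "\<lambda>K. h (ndiam N K)"] assms(1) by auto
  have "(c n \<in> dyadic_cubes \<or> c n = {}) \<and> ndiam N (c n) < eps_h CARD('n) h" for n
    using c(1)[of n] assms(2-4) by auto
  moreover have "E \<subseteq> (\<Union>n. c n)" using assms(5) c(2) by blast
  ultimately have "M_inf N h E \<le> (\<Sum>n. h (ndiam N (c n)))"
    unfolding M_inf_def by (intro INF_lower) simp
  then show ?thesis using c(3) by order
qed

lemma M_inf_mono: "E \<subseteq> E' \<Longrightarrow> M_inf N h E \<le> M_inf N h E'"
  unfolding M_inf_def by (intro INF_superset_mono) auto

lemma M_inf_greatest:
  fixes N :: "real^'n \<Rightarrow> real"
  assumes "\<And>C. C \<subseteq> dyadic_cubes \<Longrightarrow> (\<And>K. K \<in> C \<Longrightarrow> ndiam N K < eps_h CARD('n) h) \<Longrightarrow> E \<subseteq> \<Union>C \<Longrightarrow>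
    B \<le> dcost N h C"
  shows "B \<le> M_inf N h E"
  unfolding M_inf_def
proof (rule INF_greatest)
  fix c assume c: "c \<in> {C::nat \<Rightarrow> (real^'n) set. E \<subseteq> (\<Union>n. C n) \<and>
        (\<forall>n. (C n \<in> dyadic_cubes \<or> C n = {}) \<and> ndiam N (C n) < eps_h CARD('n) h)}"
  have "B \<le> dcost N h (range c - {{}})"
  proof (rule assms)
    show "E \<subseteq> \<Union> (range c - {{}})" 
    proof
      fix x assume "x \<in> E"
      then obtain n where "x \<in> c n" using c by blast
      then show "x \<in> \<Union> (range c - {{}})" by blast
    qed
  qed (use c in auto)
  also have "\<dots> \<le> (\<Sum>n. h (ndiam N (c n)))" by (rule cost_range_le)
  finally show "B \<le> (\<Sum>n. h (ndiam N (c n)))" .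
qed

text \<open>Continuity from above of the cost measure; finiteness of the cost is what makes the
  tails vanish.\<close>

lemma cost_tail:
  assumes "cost f C < \<infinity>" "(\<Inter>n. A n) = {}" "decseq A" "\<And>n. A n \<subseteq> C" "0 < (d::ennreal)"
  obtains n0 :: nat where "\<And>n. n \<ge> n0 \<Longrightarrow> cost f (A n) < d"
proof -
  have "emeasure (density (count_space UNIV) f) (A n) \<noteq> \<infinity>" for n
    using cost_mono[OF assms(4), of f n] assms(1) by (auto simp: cost_def top_unique)
  then have "(\<lambda>n. emeasure (density (count_space UNIV) f) (A n)) \<longlonglongrightarrow> emeasure (density (count_space UNIV) f) (\<Inter>n. A n)"
    using assms(3) by (intro Lim_emeasure_decseq) auto
  then have "(\<lambda>n. cost f (A n)) \<longlonglongrightarrow> 0" using assms(2) by (simp add: cost_def)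
  then have "\<forall>\<^sub>F n in sequentially. cost f (A n) < d" using assms(5) by (rule order_tendstoD(2))
  then show ?thesis using that unfolding eventually_sequentially by blast
qed

context ubiquity_cost
begin

text \<open>Let \<open>C\<close> cover \<open>limsup_set \<inter> V\<close> at finite cost. For each
  dyadic cube inside \<open>V\<close>, pass to a scale so fine that all cover cubes of at least that
  scale together cost almost nothing. A subcube of that scale is swallowed by a cover cube or, by
  \<open>cover_cost\<close>, costs at most 32 times the cover cubes inside it. Only the subcubes of
  the second kind have to be added to \<open>C\<close>.\<close>

theorem M_inf_limsup_set:
  assumes fh: "f = (\<lambda>K. h (ndiam N K))" and h0: "h 0 = 0" and V: "open V" "V \<subseteq> U"
    and small: "\<And>j. e0 \<le> j \<Longrightarrow> ennreal (unit_diam N * 2 powr (- real_of_int j)) < eps_h CARD('n) h"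
  shows "M_inf N h (limsup_set \<inter> V) = M_inf N h V"
proof (rule antisym)
  show "M_inf N h (limsup_set \<inter> V) \<le> M_inf N h V" by (intro M_inf_mono) auto
  have eps: "eps_h CARD('n) h > 0" using small[of e0] by (metis linorder_neqE_linordered_idom not_gr_zero not_less_zero order_refl)
  show "M_inf N h V \<le> M_inf N h (limsup_set \<inter> V)"
  proof (rule M_inf_greatest)
    fix C assume C: "C \<subseteq> dyadic_cubes" "\<And>K. K \<in> C \<Longrightarrow> ndiam N K < eps_h CARD('n) h" "limsup_set \<inter> V \<subseteq> \<Union>C"
    show "M_inf N h V \<le> dcost N h C"
    proof (cases "V = {} \<or> cost f C = \<infinity>")
      case True
      then show ?thesis
      proof
        assume "V = {}"
        then have "M_inf N h V \<le> dcost N h {}" using h0 eps by (intro M_inf_le_cost) auto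
        also have "\<dots> \<le> dcost N h C" by (intro cost_mono) auto
        finally show ?thesis .
      qed (simp add: fh)
    next
      case False
      then have Vne: "V \<noteq> {}" and fin: "cost f C < \<infinity>" by (auto simp: top.not_eq_extremum)
      define W where "W = {dyadic_at j x | j x. e0 \<le> j \<and> dyadic_at j x \<subseteq> V}"
      have Wc: "countable W" by (rule countable_subset[OF _ countable_dyadic_cubes]) (auto simp: W_def)
      have VW: "\<exists>w\<in>W. x \<in> w" if xV: "x \<in> V" for x
      proof -
        obtain j0 where "\<And>j. j \<ge> j0 \<Longrightarrow> dyadic_at j x \<subseteq> V" using dyadic_at_in_open[OF V(1) xV] by blast
        then have "dyadic_at (max j0 e0) x \<in> W" unfolding W_def by (metis (mono_tags, lifting) max.cobounded1 max.cobounded2 mem_Collect_eq)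
        then show ?thesis using dyadic_at_refl by blast
      qed
      then have Wne: "W \<noteq> {}" using Vne by blast
      \<comment> \<open>The cover cubes of scale at least \<open>n\<close>. A cube has only one
        scale, so these tails decrease to the empty family.\<close>
      define A where "A n = {K \<in> C. \<exists>g y. K = dyadic_at g y \<and> int n \<le> g}" for n :: nat
      have Adec: "decseq A" by (auto simp: decseq_def A_def)
      have Aemp: "(\<Inter>n. A n) = {}"
      proof (rule ccontr)
        assume "(\<Inter>n. A n) \<noteq> {}"
        then obtain K where K: "\<And>n. K \<in> A n" by blast
        then obtain g y where gy: "K = dyadic_at g y" unfolding A_def by blast
        obtain g' y' where "K = dyadic_at g' y'" "int (nat g + 1) \<le> g'" using K[of "nat g + 1"] unfolding A_def by blast
        then show False using gy dyadic_at_eq_gen[of g' y' g y] by (simp split: if_splits)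
      qed
      show ?thesis
      proof (rule ennreal_le_epsilon)
        fix \<epsilon> :: real assume \<epsilon>: "0 < \<epsilon>"
        \<comment> \<open>The \<open>k\<close>-th cube gets the budget
          \<open>\<epsilon> * (1/2) ^ Suc k\<close> and a scale \<open>n\<close> that meets it even
          after the loss of the factor 32.\<close>
        have "\<exists>n j y. from_nat_into W k = dyadic_at j y \<and> e0 \<le> j \<and> dyadic_at j y \<subseteq> V \<and> j \<le> int n \<and>
            32 * cost f (A n) \<le> ennreal (\<epsilon> * (1/2) ^ Suc k)" for k
        proof -
          obtain j y where jy: "from_nat_into W k = dyadic_at j y" "e0 \<le> j" "dyadic_at j y \<subseteq> V"
          proof -
            have "from_nat_into W k \<in> {dyadic_at j x | j x. e0 \<le> j \<and> dyadic_at j x \<subseteq> V}"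
              using from_nat_into[OF Wne, of k] unfolding W_def .
            then show ?thesis using that by blast
          qed
          have pos: "0 < ennreal (\<epsilon> * (1/2) ^ Suc k / 32)" using \<epsilon> by simp
          obtain n0 where n0: "\<And>n. n \<ge> n0 \<Longrightarrow> cost f (A n) < ennreal (\<epsilon> * (1/2) ^ Suc k / 32)"
            using cost_tail[OF fin Aemp Adec _ pos] by (auto simp: A_def)
          have "32 * cost f (A (max n0 (nat j))) \<le> 32 * ennreal (\<epsilon> * (1/2) ^ Suc k / 32)"
            using n0[of "max n0 (nat j)"] by (intro mult_left_mono) auto
          also have "\<dots> = ennreal (32 * (\<epsilon> * (1/2) ^ Suc k / 32))" using \<epsilon> by (subst ennreal_mult) auto
          finally show ?thesis using jy by (intro exI[of _ "max n0 (nat j)"] exI[of _ j] exI[of _ y]) auto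
        qed
        then obtain n j y where nj: "\<And>k. from_nat_into W k = dyadic_at (j k) (y k)" "\<And>k. e0 \<le> j k"
          "\<And>k. dyadic_at (j k) (y k) \<subseteq> V" "\<And>k. j k \<le> int (n k)" "\<And>k. 32 * cost f (A (n k)) \<le> ennreal (\<epsilon> * (1/2) ^ Suc k)"
          by metis
        define X where "X k = {q \<in> subcubes (int (n k)) (dyadic_at (j k) (y k)). \<forall>K\<in>C. \<not> q \<subseteq> K}" for k
        have Xq: "\<exists>x. q = dyadic_at (int (n k)) x \<and> q \<subseteq> V" if "q \<in> X k" for q k
          using that subcubes_subset[OF nj(4)] nj(3)[of k] unfolding X_def subcubes_def by blast
        have cX: "cost f (X k) \<le> ennreal (\<epsilon> * (1/2) ^ Suc k)" for k
        proof -
          have finX: "finite (X k)" unfolding X_def by (rule finite_subset[OF _ card_subcubes(1)[OF nj(4)[of k]]]) blast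
          have "cost f (X k) = (\<Sum>q\<in>X k. f q)" using finX by (rule cost_finite_sum)
          also have "\<dots> \<le> (\<Sum>q\<in>X k. 32 * cost f {K \<in> C. K \<subseteq> q})"
          proof (rule sum_mono)
            fix q assume q: "q \<in> X k"
            obtain x where x: "q = dyadic_at (int (n k)) x" "q \<subseteq> V" using Xq[OF q] by blast
            have h: "limsup_set \<inter> q \<subseteq> \<Union>C" "e0 \<le> int (n k)" "q \<subseteq> U"
              using C(3) x(2) V(2) nj(2,4) order_trans by blast+
            have nK: "\<not> q \<subseteq> K" if "K \<in> C" for K using q that unfolding X_def by blast
            show "f q \<le> 32 * cost f {K \<in> C. K \<subseteq> q}"
              by (rule cover_cost[OF C(1) h(2) h(3)[unfolded x(1)] h(1)[unfolded x(1)]])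
                 (use nK in \<open>auto simp: x(1)\<close>)
          qed
          also have "\<dots> = 32 * (\<Sum>q\<in>X k. cost f {K \<in> C. K \<subseteq> q})" by (simp add: sum_distrib_left)
          also have "(\<Sum>q\<in>X k. cost f {K \<in> C. K \<subseteq> q}) = cost f (\<Union>q\<in>X k. {K \<in> C. K \<subseteq> q})"
          proof (rule cost_sum_disjoint[OF finX])
            fix s t assume st: "s \<in> X k" "t \<in> X k" "s \<noteq> t"
            then have "s \<inter> t = {}" using subcubes_disjoint by (metis (no_types, lifting) X_def mem_Collect_eq)
            moreover have "K \<noteq> {}" if "K \<in> C" for K using that C(1) dyadic_cubesE dyadic_at_refl by (metis empty_iff subsetD)
            ultimately show "{K \<in> C. K \<subseteq> s} \<inter> {K \<in> C. K \<subseteq> t} = {}" by blast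
          qed
          also have "\<dots> \<le> cost f (A (n k))"
          proof (rule cost_mono, safe)
            fix q K assume q: "q \<in> X k" and K: "K \<in> C" "K \<subseteq> q"
            obtain x where x: "q = dyadic_at (int (n k)) x" using Xq[OF q] by blast
            obtain g z where gz: "K = dyadic_at g z" using C(1) K(1) dyadic_cubesE by blast
            then have "int (n k) \<le> g" using K(2) x dyadic_at_subset_gen by blast
            then show "K \<in> A (n k)" using K(1) gz by (auto simp: A_def)
          qed
          finally show ?thesis using nj(5)[of k] by (meson mult_left_mono order_trans zero_le)
        qed
        have "M_inf N h V \<le> dcost N h (C \<union> (\<Union>k. X k))"
        proof (rule M_inf_le_cost[OF h0 eps])
          show "C \<union> (\<Union>k. X k) \<subseteq> dyadic_cubes" using C(1) Xq by fastforce
          fix K assume "K \<in> C \<union> (\<Union>k. X k)"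
          then consider "K \<in> C" | k where "K \<in> X k" by blast
          then show "ndiam N K < eps_h CARD('n) h"
          proof cases
            case 1 then show ?thesis by (rule C(2))
          next
            case 2
            then obtain x where "K = dyadic_at (int (n k)) x" using Xq by blast
            moreover have "e0 \<le> int (n k)" using nj(2,4) order_trans by blast
            ultimately show ?thesis using small[of "int (n k)"] ndiam_dyadic_at[OF norm] by metis
          qed
        next
          show "V \<subseteq> \<Union> (C \<union> (\<Union>k. X k))"
          proof
            fix x assume "x \<in> V"
            then obtain w where w: "w \<in> W" "x \<in> w" using VW by blast
            then obtain k where k: "from_nat_into W k = w" using from_nat_into_surj[OF Wc w(1)] by blast
            define q where "q = dyadic_at (int (n k)) x"
            have "q \<in> subcubes (int (n k)) (dyadic_at (j k) (y k))" 
            proof -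
              have "x \<in> dyadic_at (j k) (y k)" using nj(1)[of k] k w(2) by metis
              then show ?thesis by (simp add: q_def subcubes_def)
            qed
            then have "q \<in> X k \<or> (\<exists>K\<in>C. q \<subseteq> K)" by (auto simp: X_def)
            moreover have "x \<in> q" by (simp add: q_def)
            ultimately show "x \<in> \<Union> (C \<union> (\<Union>k. X k))" by blast
          qed
        qed
        also have "\<dots> \<le> cost f C + cost f (\<Union>k. X k)" unfolding fh by (rule cost_Un_le)
        also have "cost f (\<Union>k. X k) \<le> (\<Sum>k. cost f (X k))" by (rule cost_UN_le)
        also have "\<dots> \<le> (\<Sum>k. ennreal (\<epsilon> * (1/2) ^ Suc k))" by (intro suminf_le cX) auto
        also have "\<dots> = ennreal (\<epsilon> * 1)"
          using \<epsilon> by (intro suminf_ennreal_eq sums_mult power_half_series) auto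
        finally show "M_inf N h V \<le> dcost N h C + ennreal \<epsilon>"
          by (simp add: fh)
      qed
    qed
  qed
qed

end

section \<open>Gauge functions as real functions\<close>

text \<open>\<open>f\<close> is the restriction to \<open>(0, \<epsilon>]\<close> of a \<open>d\<close>-normalized gauge, read as a real function.\<close>

definition regular :: "nat \<Rightarrow> real \<Rightarrow> (real \<Rightarrow> real) \<Rightarrow> bool" where
  "regular d \<epsilon> f \<longleftrightarrow> 0 < \<epsilon> \<and> (\<forall>r s. 0 < r \<and> r \<le> s \<and> s \<le> \<epsilon> \<longrightarrow> 0 < f r \<and> f r \<le> f s \<and> f s / s ^ d \<le> f r / r ^ d)"

lemma regularD:
  assumes "regular d \<epsilon> f" "0 < r" "r \<le> s" "s \<le> \<epsilon>"
  shows "0 < f r" "f r \<le> f s" "f s / s ^ d \<le> f r / r ^ d"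
  using assms by (auto simp: regular_def)

lemma regular_scale_le:
  assumes "regular d \<epsilon> f" "0 < r" "r \<le> s" "s \<le> \<epsilon>" "s \<le> c * r"
  shows "f s \<le> c ^ d * f r"
proof -
  have "f s * r ^ d \<le> f r * s ^ d" using regularD(3)[OF assms(1-4)] assms(2,3) by (simp add: field_simps)
  also have "\<dots> \<le> f r * (c * r) ^ d"
    using regularD(1)[OF assms(1,2), of r] assms by (intro mult_left_mono power_mono) auto
  also have "\<dots> = c ^ d * f r * r ^ d" by (simp add: power_mult_distrib)
  finally show ?thesis using assms(2) by simp
qed

text \<open>If the truncated series converged, its terms would tend to 0 and the truncation would
  eventually be inactive.\<close>

lemma not_summable_min:
  fixes a :: "nat \<Rightarrow> real"
  assumes "\<not> summable a" "c > 0"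
  shows "\<not> summable (\<lambda>j. min 1 (c * a j))"
proof
  assume s: "summable (\<lambda>j. min 1 (c * a j))"
  then have "(\<lambda>j. min 1 (c * a j)) \<longlonglongrightarrow> 0" by (rule summable_LIMSEQ_zero)
  then have "\<forall>\<^sub>F j in sequentially. min 1 (c * a j) < 1" by (rule order_tendstoD(2)) simp
  then have "\<forall>\<^sub>F j in sequentially. min 1 (c * a j) = c * a j" by eventually_elim linarith
  then have "summable (\<lambda>j. c * a j)" using s summable_cong by fast
  then show False using assms by (simp add: summable_cmult_iff)
qed

lemma cvol_power: "cvol d j = (2 powr (- real_of_int j)) ^ d"
  by (simp add: powr_powr powr_realpow[symmetric] mult.commute)

text \<open>Rounds a length down to a power of 2 with a loss of at most a factor 2. The companion
  \<open>powr_floor_bounds\<close> gives the strict inequality that is required for a cube inside an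
  open ball.\<close>

lemma powr_ceiling_bounds:
  assumes "0 < (x::real)"
  shows "x / 2 \<le> 2 powr (- real_of_int \<lceil>- log 2 x\<rceil>)" "2 powr (- real_of_int \<lceil>- log 2 x\<rceil>) \<le> x"
proof -
  have "log 2 x - 1 \<le> - real_of_int \<lceil>- log 2 x\<rceil>" "- real_of_int \<lceil>- log 2 x\<rceil> \<le> log 2 x" by linarith+
  then have "2 powr (log 2 x - 1) \<le> 2 powr (- real_of_int \<lceil>- log 2 x\<rceil>)" "2 powr (- real_of_int \<lceil>- log 2 x\<rceil>) \<le> 2 powr (log 2 x)"
    by (intro powr_mono; simp)+
  then show "x / 2 \<le> 2 powr (- real_of_int \<lceil>- log 2 x\<rceil>)" "2 powr (- real_of_int \<lceil>- log 2 x\<rceil>) \<le> x"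
    using assms by (simp_all add: powr_diff)
qed

lemma powr_floor_bounds:
  assumes "0 < (x::real)"
  shows "x / 2 \<le> 2 powr (- real_of_int (\<lfloor>- log 2 x\<rfloor> + 1))" "2 powr (- real_of_int (\<lfloor>- log 2 x\<rfloor> + 1)) < x"
proof -
  have "log 2 x - 1 \<le> - real_of_int (\<lfloor>- log 2 x\<rfloor> + 1)" "- real_of_int (\<lfloor>- log 2 x\<rfloor> + 1) < log 2 x" by linarith+
  then have "2 powr (log 2 x - 1) \<le> 2 powr (- real_of_int (\<lfloor>- log 2 x\<rfloor> + 1))" "2 powr (- real_of_int (\<lfloor>- log 2 x\<rfloor> + 1)) < 2 powr (log 2 x)"
    by (intro powr_mono powr_less_mono; simp)+
  then show "x / 2 \<le> 2 powr (- real_of_int (\<lfloor>- log 2 x\<rfloor> + 1))" "2 powr (- real_of_int (\<lfloor>- log 2 x\<rfloor> + 1)) < x"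
    using assms by (simp_all add: powr_diff)
qed

text \<open>A reserved cube may not exceed the cubes of its level, so lengths are cut off at the
  side of level \<open>j\<close>. After division by the volume of that level this truncates the
  terms of the series at 1, which keeps the divergence.\<close>

lemma not_summable_cvol:
  assumes div: "\<not> summable (\<lambda>j. t j ^ d / cvol d (4 * int j))" and "0 < c" "\<And>j. 0 \<le> t j"
    and m: "\<And>j. min (2 powr (- real_of_int (4 * int j))) (c * t j) \<le> 2 powr (- real_of_int (m j))"
  shows "\<not> summable (\<lambda>j. cvol d (m j) / cvol d (4 * int j))"
proof
  assume s: "summable (\<lambda>j. cvol d (m j) / cvol d (4 * int j))"
  have "summable (\<lambda>j. min 1 (c ^ d * (t j ^ d / cvol d (4 * int j))))"
  proof (rule summable_comparison_test'[OF s, of 0])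
    fix j :: nat
    let ?p = "2 powr (- real_of_int (4 * int j))"
    have mono: "min x y ^ d = min (x ^ d) (y ^ d)" if "0 \<le> x" "0 \<le> y" for x y :: real
      using that by (simp add: min_def power_mono) (meson power_mono antisym linear)
    have "cvol d (4 * int j) * min 1 (c ^ d * (t j ^ d / cvol d (4 * int j))) = min (?p ^ d) ((c * t j) ^ d)"
      unfolding cvol_power by (subst min_mult_distrib_left) (auto simp: power_mult_distrib)
    also have "\<dots> = min ?p (c * t j) ^ d" using assms by (subst mono) auto
    also have "\<dots> \<le> cvol d (m j)" unfolding cvol_power using m[of j] assms by (intro power_mono) auto
    finally have "min 1 (c ^ d * (t j ^ d / cvol d (4 * int j))) \<le> cvol d (m j) / cvol d (4 * int j)"
      by (simp add: pos_le_divide_eq mult.commute)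
    moreover have "0 \<le> min 1 (c ^ d * (t j ^ d / cvol d (4 * int j)))" using assms by simp
    ultimately show "norm (min 1 (c ^ d * (t j ^ d / cvol d (4 * int j)))) \<le> cvol d (m j) / cvol d (4 * int j)" by simp
  qed
  then show False using not_summable_min[OF div, of "c ^ d"] assms by simp
qed

section \<open>Choosing the scales for given weights\<close>

context ubiquity
begin

text \<open>The weights are comparable with the volumes of balls of radius \<open>b j\<close>:
  \<open>m j\<close> is the coarsest scale at which cubes have diameter below \<open>b j\<close>,
  cut off at level \<open>j\<close>.\<close>

lemma full_measure_of_divergence:
  assumes U: "open U" and b: "\<And>j. 0 < b j" and div: "\<not> summable (\<lambda>j. b j ^ CARD('n) / cvol CARD('n) (4 * int j))"
  shows "U - limsup_set \<in> null_sets lborel"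
proof -
  define \<Delta> where "\<Delta> = unit_diam N"
  have D: "\<Delta> > 0" using ndiam_unit(2)[OF norm] by (simp add: \<Delta>_def)
  define x where "x j = b j / \<Delta>" for j
  have x: "0 < x j" for j using b D by (simp add: x_def)
  define m where "m j = max (4 * int j) (\<lfloor>- log 2 (x j)\<rfloor> + 1)" for j
  show ?thesis
  proof (rule full_measure[OF U, of m])
    show "4 * int j \<le> m j" for j by (simp add: m_def)
    have "2 powr (- real_of_int (m j)) \<le> 2 powr (- real_of_int (\<lfloor>- log 2 (x j)\<rfloor> + 1))" for j
      by (intro powr_mono) (auto simp: m_def)
    then have "2 powr (- real_of_int (m j)) < x j" for j using powr_floor_bounds(2)[OF x[of j]] order_le_less_trans by blast
    then show "unit_diam N * 2 powr (- real_of_int (m j)) < b j" for j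
      using D by (simp add: x_def \<Delta>_def[symmetric] field_simps)
    show "\<not> summable (\<lambda>j. cvol CARD('n) (m j) / cvol CARD('n) (4 * int j))"
    proof (rule not_summable_cvol[OF div, of "1 / (2 * \<Delta>)"])
      fix j
      have "1 / (2 * \<Delta>) * b j = x j / 2" by (simp add: x_def)
      then show "min (2 powr (- real_of_int (4 * int j))) (1 / (2 * \<Delta>) * b j) \<le> 2 powr (- real_of_int (m j))"
        using powr_floor_bounds(1)[OF x[of j]] unfolding m_def max_def by auto
      show "0 \<le> b j" using b less_imp_le by blast
    qed (use D in auto)
  qed
qed

text \<open>\<open>t j\<close> is the side of a cube of volume \<open>w j\<close>;
  \<open>m j\<close> and \<open>e j\<close> are obtained by rounding down \<open>t j\<close> and
  \<open>b j / (4 * \<Delta>)\<close>, subject to the order of the scales that the locale demands.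
  Growth then has two sources: \<open>big\<close> when \<open>e j\<close> is tied to
  \<open>m j\<close>, and \<open>ratio\<close> with the doubling property of \<open>hr\<close> when
  \<open>e j\<close> is governed by \<open>b j\<close>.\<close>

lemma exists_ubiquity_cost:
  assumes reg: "regular CARD('n) \<epsilon> hr" and h: "\<And>r. 0 < r \<Longrightarrow> r \<le> \<epsilon> \<Longrightarrow> h (ennreal r) = ennreal (hr r)"
    and big: "filterlim (\<lambda>r. hr r / r ^ CARD('n)) at_top (at_right 0)"
    and b: "\<And>j. 0 < b j" "b \<longlonglongrightarrow> 0" and w: "\<And>j. 0 < w j"
    and div: "\<not> summable (\<lambda>j. w j / cvol CARD('n) (4 * int j))"
    and ratio: "filterlim (\<lambda>j. hr (b j) / w j) at_top sequentially" and \<epsilon>': "0 < \<epsilon>'"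
  obtains \<eta> e0 m e where "ubiquity_cost N I rr xx b U (\<lambda>K. h (ndiam N K)) \<eta> e0 m e"
    "\<And>j. e0 \<le> j \<Longrightarrow> unit_diam N * 2 powr (- real_of_int j) < \<epsilon>'" "\<And>j. e0 \<le> j \<Longrightarrow> 0 < \<eta> j"
proof -
  define d where "d = CARD('n)"
  have d: "d > 0" by (simp add: d_def)
  define \<Delta> where "\<Delta> = unit_diam N"
  have D: "\<Delta> > 0" using ndiam_unit(2)[OF norm] by (simp add: \<Delta>_def)
  have eps: "\<epsilon> > 0" using reg by (simp add: regular_def)
  obtain e0 :: int where e0: "\<And>j. j \<ge> e0 \<Longrightarrow> \<Delta> * 2 powr (- real_of_int j) < min \<epsilon> \<epsilon>'"
    using two_powr_small[of "min \<epsilon> \<epsilon>'" \<Delta>] eps \<epsilon>' by auto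
  define \<eta> where "\<eta> j = ennreal (hr (\<Delta> * 2 powr (- real_of_int j)))" for j :: int
  define t where "t j = w j powr (1 / real d)" for j
  have t: "t j > 0" for j using w[of j] by (simp add: t_def)
  have td: "t j ^ d = w j" for j using w[of j] d by (simp add: t_def powr_realpow[symmetric] powr_powr)
  define m where "m j = max (4 * int j) \<lceil>- log 2 (t j)\<rceil>" for j
  define y where "y j = b j / (4 * \<Delta>)" for j
  have y: "0 < y j" for j using b D by (simp add: y_def)
  define e where "e j = max (m j + 2) (\<lfloor>- log 2 (y j)\<rfloor> + 1)" for j
  have r0: "0 < \<Delta> * 2 powr (- real_of_int j)" for j :: int using D by simp
  have gen_le: "\<Delta> * 2 powr (- real_of_int j') \<le> \<Delta> * 2 powr (- real_of_int j)" if "j \<le> j'" for j j' :: int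
    using D that by (intro mult_left_mono powr_mono) auto
  have m_le: "cvol d (m j) \<le> w j" for j
  proof -
    have "2 powr (- real_of_int (m j)) \<le> 2 powr (- real_of_int \<lceil>- log 2 (t j)\<rceil>)"
      by (intro powr_mono) (auto simp: m_def)
    then have "2 powr (- real_of_int (m j)) \<le> t j" using powr_ceiling_bounds(2)[OF t[of j]] order_trans by blast
    then show ?thesis unfolding cvol_power td[symmetric] by (intro power_mono) auto
  qed
  have eb: "2 powr (- real_of_int (e j)) < y j" for j
  proof -
    have "2 powr (- real_of_int (e j)) \<le> 2 powr (- real_of_int (\<lfloor>- log 2 (y j)\<rfloor> + 1))"
      by (intro powr_mono) (auto simp: e_def)
    then show ?thesis using powr_floor_bounds(2)[OF y[of j]] order_le_less_trans by blast
  qed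
  have "ubiquity_cost N I rr xx b U (\<lambda>K. h (ndiam N K)) \<eta> e0 m e"
  proof (unfold_locales, goal_cases)
    case (1 j x)
    then show ?case using h[OF r0, of j] e0[OF 1] by (simp add: ndiam_dyadic_at[OF norm] \<eta>_def \<Delta>_def[symmetric])
  next
    case (2 j j')
    then show ?case unfolding \<eta>_def
      using regularD(2)[OF reg r0 gen_le[OF 2(2)]] e0[OF 2(1)] by (intro ennreal_leI) auto
  next
    case (3 j j')
    define s where "s = \<Delta> * 2 powr (- real_of_int j)"
    define r where "r = \<Delta> * 2 powr (- real_of_int j')"
    have rs: "0 < r" "r \<le> s" "s \<le> \<epsilon>" using r0 gen_le[OF 3(2)] e0[OF 3(1)] by (auto simp: r_def s_def)
    have "hr s / s ^ d \<le> hr r / r ^ d" using regularD(3)[OF reg rs] by (simp add: d_def)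
    then have "hr s * r ^ d \<le> hr r * s ^ d" using rs by (simp add: field_simps)
    moreover have "s ^ d = \<Delta> ^ d * cvol d j" "r ^ d = \<Delta> ^ d * cvol d j'"
      by (simp_all only: cvol_power power_mult_distrib s_def r_def)
    ultimately have "\<Delta> ^ d * (hr s * cvol d j') \<le> \<Delta> ^ d * (hr r * cvol d j)" by (simp only: mult_ac)
    then have "hr s * cvol d j' \<le> hr r * cvol d j" using D by (simp add: mult_le_cancel_left_pos)
    moreover have "0 < hr s" "0 < hr r" using regularD(1)[OF reg] rs by auto
    ultimately show ?case unfolding \<eta>_def s_def[symmetric] r_def[symmetric] d_def[symmetric]
      by (subst (1 2) ennreal_mult[symmetric]) (auto intro: ennreal_leI)
  next
    case (4 j) then show ?case by (simp add: \<eta>_def)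
  next
    case (5 j) then show ?case by (simp add: m_def)
  next
    case (6 j) then show ?case by (simp add: e_def)
  next
    case (7 j) then show ?case using eb[of j] D by (simp add: y_def \<Delta>_def[symmetric] field_simps)
  next
    case 8
    show ?case
    proof (rule not_summable_cvol[of t _ "1/2"])
      show "\<not> summable (\<lambda>j. t j ^ CARD('n) / cvol CARD('n) (4 * int j))" using div td unfolding d_def by presburger
      show "min (2 powr (- real_of_int (4 * int j))) (1 / 2 * t j) \<le> 2 powr (- real_of_int (m j))" for j
        using powr_ceiling_bounds(1)[OF t[of j]] unfolding m_def max_def by auto
      show "0 \<le> t j" for j using t less_imp_le by blast
    qed simp
  next
    case (9 K)
    define K1 where "K1 = max K 0"
    have K1: "K1 \<ge> 0" "K \<le> K1" by (auto simp: K1_def)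
    have "\<forall>\<^sub>F r in at_right 0. hr r / r ^ d \<ge> K1 * (4 / \<Delta>) ^ d"
      using big unfolding filterlim_at_top d_def by blast
    then obtain \<delta> where \<delta>: "\<delta> > 0" "\<And>r. 0 < r \<Longrightarrow> r < \<delta> \<Longrightarrow> hr r / r ^ d \<ge> K1 * (4 / \<Delta>) ^ d"
      unfolding eventually_at_right_field by blast
    have ev1: "\<forall>\<^sub>F j in sequentially. hr (b j) / w j \<ge> K1 * 4 ^ d * 2 ^ d"
      using ratio unfolding filterlim_at_top by blast
    have ev2: "\<forall>\<^sub>F j in sequentially. b j < min \<epsilon> \<delta>" using eps \<delta>(1) by (intro order_tendstoD(2)[OF b(2)]) simp
    from ev1 ev2 show ?case
    proof eventually_elim
      case (elim j)
      define r where "r = \<Delta> * 2 powr (- real_of_int (e j))"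
      have r: "0 < r" by (simp add: r_def D)
      have rb: "r < b j / 4" using eb[of j] D by (simp add: r_def y_def field_simps)
      have rlt: "r < \<delta>" "r \<le> \<epsilon>" using rb elim b(1)[of j] by auto
      have "K1 * cvol d (m j) \<le> hr r"
      \<comment> \<open>In the first case the reserved cube has volume
        \<open>(4 / \<Delta>) ^ d * r ^ d\<close>. In the second, rounding leaves
        \<open>b j \<le> 8 * r\<close>, whence the constant \<open>4 ^ d * 2 ^ d\<close> demanded of
        the ratio.\<close>
      proof (cases "e j = m j + 2")
        case True
        have "cvol d (m j) = (2 powr (- real_of_int (e j)) * 4) ^ d"
          unfolding cvol_power True by (simp add: powr_diff powr_minus field_simps power_divide powr_add)
        also have "2 powr (- real_of_int (e j)) * 4 = r * (4 / \<Delta>)" using D by (simp add: r_def)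
        finally have "K1 * cvol d (m j) = K1 * (4 / \<Delta>) ^ d * r ^ d" by (simp only: power_mult_distrib mult_ac)
        also have "\<dots> \<le> hr r" using \<delta>(2)[OF r rlt(1)] r by (simp add: pos_le_divide_eq)
        finally show ?thesis .
      next
        case False
        then have "e j = \<lfloor>- log 2 (y j)\<rfloor> + 1" by (simp add: e_def max_def split: if_splits)
        then have "y j / 2 \<le> 2 powr (- real_of_int (e j))" using powr_floor_bounds(1)[OF y[of j]] by simp
        then have "b j \<le> 8 * r" using D by (simp add: r_def y_def field_simps)
        then have "hr (b j) \<le> 8 ^ d * hr r"
          unfolding d_def using rb elim b(1)[of j] by (intro regular_scale_le[OF reg r]) auto
        moreover have "K1 * 8 ^ d * w j \<le> hr (b j)"
          using elim(1) w[of j] by (simp add: pos_le_divide_eq mult.assoc flip: power_mult_distrib)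
        moreover have "8 ^ d * (K1 * w j) = K1 * 8 ^ d * w j" by (simp only: mult_ac)
        ultimately have "8 ^ d * (K1 * w j) \<le> 8 ^ d * hr r" by linarith
        then have "K1 * w j \<le> hr r" by simp
        then show ?thesis using m_le[of j] K1(1) mult_left_mono order_trans by blast
      qed
      moreover have "K * cvol d (m j) \<le> K1 * cvol d (m j)" using K1 by (intro mult_right_mono) auto
      ultimately have "ennreal (K1 * cvol d (m j)) \<le> \<eta> (e j)" unfolding \<eta>_def r_def by (intro ennreal_leI)
      moreover have "ennreal K * ennreal (cvol d (m j)) \<le> ennreal (K1 * cvol d (m j))"
        using K1 by (subst ennreal_mult) (auto intro!: mult_right_mono ennreal_leI)
      ultimately show ?case unfolding d_def by order
    qed
  qed
  moreover have "0 < \<eta> j" if "e0 \<le> j" for j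
    using regularD(1)[OF reg r0 order_refl, of j] e0[OF that] by (simp add: \<eta>_def)
  ultimately show ?thesis using that e0 by (simp add: \<Delta>_def)
qed

end

section \<open>Passing from \<open>ennreal\<close> gauges to real functions near 0\<close>

lemma filterlim_ennreal_at_right_0: "filterlim ennreal (at_right 0) (at_right 0)"
  unfolding filterlim_at
proof
  show "\<forall>\<^sub>F x in at_right 0. ennreal x \<in> {0<..} \<and> ennreal x \<noteq> 0"
    by (rule eventually_at_right_less[THEN eventually_mono]) auto
  show "(ennreal \<longlongrightarrow> 0) (at_right 0)"
    using tendsto_ennrealI[OF tendsto_ident_at, of 0 "{0<..}"] by simp
qed

lemma dnorm_ennreal:
  assumes "0 < r"
  shows "dnorm d g (ennreal r) = ennreal (r ^ d) * (INF \<rho>\<in>{0<..ennreal r}. g \<rho> / \<rho> ^ d)"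
  using assms by (simp add: dnorm_def ennreal_power)

lemma gauge_ratio_near_0:
  assumes "g \<in> gauges_inf d"
  obtains \<delta> where "\<delta> > 0" "\<And>r. 0 < r \<Longrightarrow> r < \<delta> \<Longrightarrow> ennreal K < g (ennreal r) / ennreal (r ^ d)"
proof -
  have "ennreal K < Liminf (at_right 0) (\<lambda>r. g r / r ^ d)"
    using assms by (simp add: gauges_inf_def ell_def)
  then have "\<forall>\<^sub>F r in at_right 0. ennreal K < g r / r ^ d" by (rule less_LiminfD)
  then have "\<forall>\<^sub>F r in at_right 0. ennreal K < g (ennreal r) / ennreal r ^ d"
    using filterlim_ennreal_at_right_0 by (rule filterlim_iff[THEN iffD1, rule_format, rotated])
  then obtain \<delta> where "\<delta> > 0" "\<And>r. 0 < r \<Longrightarrow> r < \<delta> \<Longrightarrow> ennreal K < g (ennreal r) / ennreal r ^ d"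
    unfolding eventually_at_right_field by blast
  then show ?thesis using that by (simp add: ennreal_power)
qed

lemma ennreal_in_Ioc:
  assumes "\<rho> \<in> {0<..ennreal r}" "0 < r"
  obtains s where "\<rho> = ennreal s" "0 < s" "s \<le> r"
proof -
  have "\<rho> < \<infinity>" using assms by (auto simp: order_le_less_trans)
  then obtain s where "\<rho> = ennreal s" "0 \<le> s" by (metis ennreal_cases infinity_ennreal_def order_less_irrefl)
  then show ?thesis using that assms by (auto simp: ennreal_less_zero_iff ennreal_le_iff)
qed

text \<open>The condition on \<open>ell\<close> makes the infimum in \<open>dnorm\<close> positive
  near 0 and sends it to infinity; smallness of \<open>g\<close> near 0 makes it finite.
  Monotonicity of \<open>g\<close> itself is exported too, because Hausdorff coverings are priced by
  \<open>g\<close> and not by its normalization.\<close>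

lemma gauges_inf_regular:
  assumes g: "g \<in> gauges_inf d"
  obtains \<epsilon> f where "regular d \<epsilon> f" "\<And>r. 0 < r \<Longrightarrow> r \<le> \<epsilon> \<Longrightarrow> dnorm d g (ennreal r) = ennreal (f r)"
    "(f \<longlongrightarrow> 0) (at_right 0)" "filterlim (\<lambda>r. f r / r ^ d) at_top (at_right 0)"
    "\<And>r s. 0 \<le> r \<Longrightarrow> r \<le> s \<Longrightarrow> s \<le> \<epsilon> \<Longrightarrow> g (ennreal r) \<le> g (ennreal s)"
    "\<epsilon> \<le> 1" "\<And>r. 0 < r \<Longrightarrow> r \<le> \<epsilon> \<Longrightarrow> g (ennreal r) < \<infinity>"
proof -
  have gauge: "gauge_fun g" using g by (simp add: gauges_inf_def)
  obtain \<epsilon>1 where \<epsilon>1: "0 < \<epsilon>1" "mono_on {0..\<epsilon>1} g" using gauge by (auto simp: gauge_fun_def)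
  have lim: "((\<lambda>r. g (ennreal r)) \<longlongrightarrow> 0) (at_right 0)"
    using gauge filterlim_compose[OF _ filterlim_ennreal_at_right_0, of g "nhds 0"] by (simp add: gauge_fun_def)
  then have "\<forall>\<^sub>F r in at_right 0. g (ennreal r) < 1" by (rule order_tendstoD(2)) simp
  then obtain \<delta>1 where \<delta>1: "\<delta>1 > 0" "\<And>r. 0 < r \<Longrightarrow> r < \<delta>1 \<Longrightarrow> g (ennreal r) < 1"
    unfolding eventually_at_right_field by blast
  obtain \<delta>2 where \<delta>2: "\<delta>2 > 0" "\<And>r. 0 < r \<Longrightarrow> r < \<delta>2 \<Longrightarrow> ennreal 1 < g (ennreal r) / ennreal (r ^ d)"
    using gauge_ratio_near_0[OF g, of 1] by blast
  obtain \<delta>3 where \<delta>3: "\<delta>3 > 0" "ennreal \<delta>3 \<le> \<epsilon>1"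
    using \<epsilon>1(1) by (metis ennreal_cases ennreal_less_zero_iff infinity_ennreal_def order_refl top_greatest zero_less_one ennreal_1)
  define \<epsilon> where "\<epsilon> = min (min (\<delta>1/2) (\<delta>2/2)) (min \<delta>3 1)"
  have eps: "\<epsilon> > 0" "\<epsilon> < \<delta>1" "\<epsilon> < \<delta>2" "\<epsilon> \<le> \<delta>3" "\<epsilon> \<le> 1" using \<delta>1(1) \<delta>2(1) \<delta>3(1) by (auto simp: \<epsilon>_def)
  have g1: "g (ennreal r) < 1" if "0 < r" "r \<le> \<epsilon>" for r using \<delta>1(2)[of r] that eps by simp
  have gmono: "g (ennreal r) \<le> g (ennreal s)" if "0 \<le> r" "r \<le> s" "s \<le> \<epsilon>" for r s
  proof -
    have "ennreal s \<le> \<epsilon>1" using that eps \<delta>3(2) by (meson ennreal_leI order_trans)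
    then show ?thesis using that \<epsilon>1(2) by (auto intro!: mono_onD[OF \<epsilon>1(2)] ennreal_leI order_trans[of "ennreal r" "ennreal s"])
  qed
  define J where "J r = (INF \<rho>\<in>{0<..ennreal r}. g \<rho> / \<rho> ^ d)" for r
  define j where "j r = enn2real (J r)" for r
  define f where "f r = r ^ d * j r" for r
  have J_le: "J r \<le> g (ennreal s) / ennreal (s ^ d)" if "0 < s" "s \<le> r" for r s
  proof -
    have "J r \<le> g (ennreal s) / ennreal s ^ d" unfolding J_def using that by (intro INF_lower) (auto intro: ennreal_leI)
    then show ?thesis using that by (simp add: ennreal_power)
  qed
  have J_ge: "K \<le> J r" if r: "0 < r" and "\<And>s. 0 < s \<Longrightarrow> s \<le> r \<Longrightarrow> K \<le> g (ennreal s) / ennreal (s ^ d)" for r K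
    unfolding J_def
  proof (rule INF_greatest)
    fix \<rho> assume "\<rho> \<in> {0<..ennreal r}"
    then obtain s where "\<rho> = ennreal s" "0 < s" "s \<le> r" using ennreal_in_Ioc r by blast
    then show "K \<le> g \<rho> / \<rho> ^ d" using that(2)[of s] by (simp add: ennreal_power)
  qed
  have Jfin: "J r = ennreal (j r)" if "0 < r" "r \<le> \<epsilon>" for r
  proof -
    have "J r \<le> g (ennreal r) / ennreal (r ^ d)" using that by (intro J_le) auto
    also have "\<dots> < \<infinity>"
      using g1[OF that] that by (simp add: ennreal_divide_eq_top_iff less_top[symmetric]) (metis not_one_less_zero order_less_irrefl top.not_eq_extremum top.extremum_strict)
    finally show ?thesis by (simp add: j_def)
  qed
  have J1: "1 \<le> J r" if "0 < r" "r \<le> \<epsilon>" for r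
  proof (rule J_ge[OF that(1)])
    fix s assume "0 < s" "s \<le> r"
    then show "1 \<le> g (ennreal s) / ennreal (s ^ d)"
      using \<delta>2(2)[of s] that eps by (simp add: order.strict_implies_order)
  qed
  have j1: "1 \<le> j r" if "0 < r" "r \<le> \<epsilon>" for r
    using J1[OF that] Jfin[OF that] by (metis ennreal_1 ennreal_le_iff2 not_one_le_zero le_numeral_extra(3) order_trans zero_le_one)
  have dn: "dnorm d g (ennreal r) = ennreal (f r)" if "0 < r" "r \<le> \<epsilon>" for r
    using dnorm_ennreal[OF that(1), of d g] Jfin[OF that] that j1[OF that] by (simp add: J_def[symmetric] f_def ennreal_mult)
  have fg: "ennreal (f r) \<le> g (ennreal r)" if "0 < r" "r \<le> \<epsilon>" for r
  proof -
    have "ennreal (f r) = ennreal (r ^ d) * J r" using Jfin[OF that] j1[OF that] that by (simp add: f_def ennreal_mult)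
    also have "\<dots> \<le> ennreal (r ^ d) * (g (ennreal r) / ennreal (r ^ d))"
      using that by (intro mult_left_mono J_le) auto
    also have "\<dots> = g (ennreal r)" using that by (simp add: ennreal_times_divide ennreal_mult_divide_eq mult.commute)
    finally show ?thesis .
  qed
  have f0: "0 < f r" if "0 < r" "r \<le> \<epsilon>" for r using j1[OF that] that by (simp add: f_def)
  have reg: "regular d \<epsilon> f"
    unfolding regular_def
  proof (intro conjI allI impI eps(1))
    fix r s assume rs: "0 < r \<and> r \<le> s \<and> s \<le> \<epsilon>"
    then show "0 < f r" using f0 by simp
    have "J s \<le> J r"
    proof (rule J_ge)
      fix q assume "0 < q" "q \<le> r"
      then show "J s \<le> g (ennreal q) / ennreal (q ^ d)" using rs by (intro J_le) auto
    qed (use rs in auto)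
    then have "ennreal (j s) \<le> ennreal (j r)" using Jfin[of r] Jfin[of s] rs by simp
    then have "j s \<le> j r" using j1[of r] rs by (subst (asm) ennreal_le_iff) auto
    then show "f s / s ^ d \<le> f r / r ^ d" using rs by (simp add: f_def)
    \<comment> \<open>To get \<open>f r \<le> f s\<close>, each quotient in the infimum at
      \<open>s\<close> is compared with \<open>f r / s ^ d\<close>: for \<open>q \<le> r\<close>
      through the infimum at \<open>r\<close>, for \<open>q\<close> between \<open>r\<close> and
      \<open>s\<close> through \<open>f r \<le> g r \<le> g q\<close>.\<close>
    have "ennreal (f r / s ^ d) \<le> J s"
    proof (rule J_ge)
      fix q assume q: "0 < q" "q \<le> s"
      show "ennreal (f r / s ^ d) \<le> g (ennreal q) / ennreal (q ^ d)"
      proof (cases "q \<le> r")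
        case True
        have "f r / s ^ d \<le> f r / r ^ d" using rs f0[of r] by (intro divide_left_mono power_mono mult_pos_pos) auto
        also have "\<dots> = j r" using rs by (simp add: f_def)
        finally have "ennreal (f r / s ^ d) \<le> J r" using Jfin rs by (simp add: ennreal_leI)
        also have "\<dots> \<le> g (ennreal q) / ennreal (q ^ d)" using q True by (intro J_le) auto
        finally show ?thesis .
      next
        case False
        have "f r / s ^ d \<le> f r / q ^ d" using rs f0[of r] q by (intro divide_left_mono power_mono mult_pos_pos) auto
        then have "ennreal (f r / s ^ d) \<le> ennreal (f r) / ennreal (q ^ d)"
          using q f0[of r] rs by (simp add: divide_ennreal ennreal_leI)
        also have "\<dots> \<le> g (ennreal q) / ennreal (q ^ d)"
          using fg[of r] gmono[of r q] False rs q by (intro divide_right_mono_ennreal) auto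
        finally show ?thesis .
      qed
    qed (use rs in auto)
    then have "ennreal (f r / s ^ d) \<le> ennreal (j s)" using Jfin rs by simp
    then have "f r / s ^ d \<le> j s" using j1[of s] rs by (subst (asm) ennreal_le_iff) auto
    then show "f r \<le> f s" using rs by (simp add: f_def pos_divide_le_eq mult.commute)
  qed
  have flim: "(f \<longlongrightarrow> 0) (at_right 0)"
  proof (rule tendsto_sandwich)
    have ev: "\<forall>\<^sub>F r in at_right 0. 0 < r \<and> r \<le> \<epsilon>"
      unfolding eventually_at_right_field using eps(1) by (intro exI[of _ \<epsilon>]) auto
    show "\<forall>\<^sub>F r in at_right 0. 0 \<le> f r" using ev by eventually_elim (use f0 less_imp_le in blast)
    show "\<forall>\<^sub>F r in at_right 0. f r \<le> enn2real (g (ennreal r))" using ev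
    proof eventually_elim
      case (elim r)
      have "g (ennreal r) < \<top>" using g1[of r] elim by (meson order_less_trans ennreal_one_less_top)
      then have "enn2real (ennreal (f r)) \<le> enn2real (g (ennreal r))" using fg[of r] elim by (intro enn2real_mono) auto
      then show ?case using f0[of r] elim by simp
    qed
    show "((\<lambda>r. enn2real (g (ennreal r))) \<longlongrightarrow> 0) (at_right 0)" using tendsto_enn2real[OF _ _ , of "\<lambda>r. g (ennreal r)" 0 "at_right 0"] lim by simp
  qed simp
  have fbig: "filterlim (\<lambda>r. f r / r ^ d) at_top (at_right 0)"
    unfolding filterlim_at_top
  proof
    fix K :: real
    obtain \<delta> where \<delta>: "\<delta> > 0" "\<And>r. 0 < r \<Longrightarrow> r < \<delta> \<Longrightarrow> ennreal K < g (ennreal r) / ennreal (r ^ d)"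
      using gauge_ratio_near_0[OF g] by blast
    show "\<forall>\<^sub>F r in at_right 0. K \<le> f r / r ^ d"
      unfolding eventually_at_right_field
    proof (intro exI[of _ "min \<delta> \<epsilon>"] conjI allI impI)
      fix r assume r: "0 < r" "r < min \<delta> \<epsilon>"
      have "ennreal K \<le> J r"
      proof (rule J_ge[OF r(1)])
        fix s assume "0 < s" "s \<le> r"
        then show "ennreal K \<le> g (ennreal s) / ennreal (s ^ d)"
          using \<delta>(2)[of s] r by (simp add: order.strict_implies_order)
      qed
      then have "ennreal K \<le> ennreal (j r)" using Jfin[of r] r by simp
      then have "K \<le> j r" using j1[of r] r by (subst (asm) ennreal_le_iff) auto
      then show "K \<le> f r / r ^ d" using r by (simp add: f_def)
    qed (use \<delta>(1) eps(1) in auto)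
  qed
  have gfin: "g (ennreal r) < \<infinity>" if "0 < r" "r \<le> \<epsilon>" for r
    using g1[OF that] by (metis ennreal_one_less_top infinity_ennreal_def order_less_trans)
  show ?thesis using that[OF reg dn flim fbig gmono eps(5) gfin] by blast
qed

section \<open>Coverings of limsup sets\<close>

text \<open>This is why \<open>g\<close> and its normalization give comparable coverings: the
  infimum defining \<open>f r\<close> is nearly attained at some \<open>s \<le> r\<close>, and
  cutting a cube of diameter \<open>r\<close> into \<open>2 ^ (d * l)\<close> cubes of diameter at
  most \<open>s\<close> costs about \<open>f r\<close>. The 2 pays for near attainment,
  \<open>2 ^ d\<close> for rounding \<open>r / s\<close> up to a power of 2.\<close>

lemma gauge_refine:
  assumes reg: "regular d \<epsilon> f" and dn: "\<And>r. 0 < r \<Longrightarrow> r \<le> \<epsilon> \<Longrightarrow> dnorm d g (ennreal r) = ennreal (f r)"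
    and gm: "\<And>r s. 0 \<le> r \<Longrightarrow> r \<le> s \<Longrightarrow> s \<le> \<epsilon> \<Longrightarrow> g (ennreal r) \<le> g (ennreal s)"
    and r: "0 < r" "r \<le> \<epsilon>"
  obtains l :: nat where "ennreal (2 ^ (d * l)) * g (ennreal (r / 2 ^ l)) \<le> ennreal (2 * 2 ^ d * f r)"
proof -
  have f0: "0 < f r" using regularD(1)[OF reg r(1) order_refl r(2)] .
  define q where "q = 2 * f r / r ^ d"
  have q: "q > 0" using f0 r by (simp add: q_def)
  obtain s where s: "0 < s" "s \<le> r" "g (ennreal s) / ennreal (s ^ d) < ennreal q"
  proof (rule ccontr)
    assume neg: "\<not> thesis"
    have "ennreal q \<le> (INF \<rho>\<in>{0<..ennreal r}. g \<rho> / \<rho> ^ d)"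
    proof (rule INF_greatest)
      fix \<rho> assume "\<rho> \<in> {0<..ennreal r}"
      then obtain s where s: "\<rho> = ennreal s" "0 < s" "s \<le> r" using ennreal_in_Ioc r(1) by blast
      then have "\<not> g (ennreal s) / ennreal (s ^ d) < ennreal q" using neg that[of s] by blast
      then show "ennreal q \<le> g \<rho> / \<rho> ^ d" using s by (simp add: ennreal_power not_less)
    qed
    then have "ennreal (r ^ d) * ennreal q \<le> ennreal (r ^ d) * (INF \<rho>\<in>{0<..ennreal r}. g \<rho> / \<rho> ^ d)"
      by (intro mult_left_mono) auto
    also have "\<dots> = ennreal (f r)" using dn[OF r] dnorm_ennreal[OF r(1), of d g] by simp
    finally have "r ^ d * q \<le> f r" using r q f0 by (simp add: ennreal_mult[symmetric] ennreal_le_iff)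
    then show False using r f0 by (simp add: q_def)
  qed
  have sd: "ennreal (s ^ d) \<noteq> 0" "ennreal (s ^ d) \<noteq> top" using s by auto
  have "g (ennreal s) = g (ennreal s) / ennreal (s ^ d) * ennreal (s ^ d)"
    using sd by (simp add: ennreal_divide_times divide_mult_eq)
  also have "\<dots> \<le> ennreal q * ennreal (s ^ d)" using s by (intro mult_right_mono) auto
  also have "\<dots> = ennreal (q * s ^ d)" using q s by (simp add: ennreal_mult)
  finally have gs: "g (ennreal s) \<le> ennreal (q * s ^ d)" .
  define l where "l = nat \<lceil>log 2 (r / s)\<rceil>"
  have lg: "0 \<le> log 2 (r / s)" using s r by (simp add: le_log_iff)
  then have "log 2 (r / s) \<le> real l" "real l \<le> log 2 (r / s) + 1" unfolding l_def by linarith+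
  then have "2 powr (log 2 (r / s)) \<le> 2 powr (real l)" "2 powr (real l) \<le> 2 powr (log 2 (r / s) + 1)"
    by (intro powr_mono; simp)+
  then have l: "r / s \<le> 2 ^ l" "2 ^ l \<le> 2 * (r / s)" using s r by (simp_all add: powr_realpow powr_add mult.commute)
  have "r / 2 ^ l \<le> s" using l(1) s by (simp add: field_simps)
  then have "g (ennreal (r / 2 ^ l)) \<le> g (ennreal s)" using r s by (intro gm) auto
  then have "ennreal (2 ^ (d * l)) * g (ennreal (r / 2 ^ l)) \<le> ennreal (2 ^ (d * l)) * ennreal (q * s ^ d)"
    using gs by (intro mult_left_mono) auto
  also have "\<dots> = ennreal ((2 ^ l) ^ d * (q * s ^ d))"
    using q s by (simp add: ennreal_mult[symmetric] power_mult[symmetric] mult.commute)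
  also have "\<dots> \<le> ennreal ((2 * (r / s)) ^ d * (q * s ^ d))"
    using l q s by (intro ennreal_leI mult_right_mono power_mono) auto
  also have "(2 * (r / s)) ^ d * (q * s ^ d) = 2 * 2 ^ d * f r"
    using s r by (simp add: q_def power_mult_distrib power_divide)
  finally show ?thesis using that by blast
qed

text \<open>\<open>g\<close> prices the cubes, \<open>w\<close> bounds the price of covering a set
  of diameter \<open>r\<close>. They are kept apart for gauges that are not normalized, where the
  cubes used may be much smaller than \<open>r\<close>.\<close>

definition coverable :: "(real^'n \<Rightarrow> real) \<Rightarrow> (ennreal \<Rightarrow> ennreal) \<Rightarrow> (real \<Rightarrow> real) \<Rightarrow> real \<Rightarrow> real \<Rightarrow> bool" where
  "coverable N g w \<rho> B \<longleftrightarrow> (\<forall>r A. 0 < r \<and> r \<le> \<rho> \<and> ndiam N A \<le> ennreal r \<longrightarrow>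
     (\<exists>K. finite K \<and> K \<subseteq> dyadic_cubes \<and> A \<subseteq> \<Union>K \<and> (\<forall>k\<in>K. ndiam N k \<le> ennreal (2 * unit_diam N * r)) \<and>
       (\<Sum>k\<in>K. g (ndiam N k)) \<le> ennreal (B * w r)))"

lemma exists_coverable:
  fixes N :: "real^'n \<Rightarrow> real"
  assumes N: "is_norm N" and reg: "regular CARD('n) \<epsilon> w" and B: "B \<ge> 0"
    and ref: "\<And>r. 0 < r \<Longrightarrow> r \<le> \<epsilon> \<Longrightarrow> \<exists>l::nat. ennreal (2 ^ (CARD('n) * l)) * g (ennreal (r / 2 ^ l)) \<le> ennreal (B * w r)"
  obtains \<rho> B' where "0 < \<rho>" "\<rho> \<le> \<epsilon>" "0 \<le> B'" "coverable N g w \<rho> B'"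
proof -
  define d where "d = CARD('n)"
  define \<Delta> where "\<Delta> = unit_diam N"
  have D: "\<Delta> > 0" using ndiam_unit(2)[OF N] by (simp add: \<Delta>_def)
  have eps: "\<epsilon> > 0" using reg by (simp add: regular_def)
  obtain L :: real where L: "L > 0" "\<And>A r. 0 < r \<Longrightarrow> ndiam N A \<le> ennreal r \<Longrightarrow>
    \<exists>j. r \<le> 2 powr (- real_of_int j) \<and> 2 powr (- real_of_int j) \<le> 2 * r \<and>
       finite (dyadic_at j ` A) \<and> real (card (dyadic_at j ` A)) \<le> L" using cover_by_dyadic[OF N] by blast
  \<comment> \<open>\<open>c\<close> bounds the ratio of the diameter \<open>t\<close> of the cubes
    before subdivision to \<open>r\<close>, so that \<open>w t \<le> c ^ d * w r\<close>.\<close>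
  define c where "c = max 1 (2 * \<Delta>)"
  define \<rho> where "\<rho> = \<epsilon> / c"
  have c: "c \<ge> 1" "2 * \<Delta> \<le> c" by (auto simp: c_def)
  have \<rho>: "0 < \<rho>" "\<rho> \<le> \<epsilon>" "c * \<rho> = \<epsilon>" using eps c by (auto simp: \<rho>_def field_simps)
  have "coverable N g w \<rho> (L * B * c ^ d)"
    unfolding coverable_def
  proof (intro allI impI)
    fix r A assume rA: "0 < r \<and> r \<le> \<rho> \<and> ndiam N A \<le> ennreal r"
    then obtain j where j: "r \<le> 2 powr (- real_of_int j)" "2 powr (- real_of_int j) \<le> 2 * r"
      "finite (dyadic_at j ` A)" "real (card (dyadic_at j ` A)) \<le> L" using L(2) by blast
    define t where "t = \<Delta> * 2 powr (- real_of_int j)"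
    have "t \<le> \<Delta> * (2 * r)" unfolding t_def using D j(2) by (intro mult_left_mono) auto
    also have "\<dots> \<le> c * r" using c rA by (simp add: mult.assoc[symmetric] mult.commute mult_left_mono)
    finally have tc: "t \<le> c * r" .
    have "c * r \<le> \<epsilon>" using mult_left_mono[of r \<rho> c] rA c \<rho> by simp
    then have t: "0 < t" "t \<le> \<epsilon>" using tc D by (auto simp: t_def)
    have t2: "t \<le> 2 * \<Delta> * r" using \<open>t \<le> \<Delta> * (2 * r)\<close> by (simp add: mult_ac)
    obtain l :: nat where l: "ennreal (2 ^ (d * l)) * g (ennreal (t / 2 ^ l)) \<le> ennreal (B * w t)"
      using ref[OF t] by (auto simp: d_def)
    define K where "K = (\<Union>Q\<in>dyadic_at j ` A. subcubes (j + int l) Q)"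
    have cs: "finite (subcubes (j + int l) (dyadic_at j x))" "real (card (subcubes (j + int l) (dyadic_at j x))) = 2 ^ (d * l)" for x :: "real^'n"
      using card_subcubes[of j "j + int l" x] by (auto simp: d_def powr_realpow[symmetric])
    have finK: "finite K" unfolding K_def using j(3) cs(1) by (intro finite_UN_I) auto
    have "card K \<le> (\<Sum>Q\<in>dyadic_at j ` A. card (subcubes (j + int l) Q))"
      unfolding K_def using j(3) by (rule card_UN_le)
    then have "real (card K) \<le> (\<Sum>Q\<in>dyadic_at j ` A. real (card (subcubes (j + int l) Q)))"
      by (simp only: of_nat_sum[symmetric] of_nat_le_iff)
    also have "\<dots> = (\<Sum>Q\<in>dyadic_at j ` A. 2 ^ (d * l))" using cs(2) by (intro sum.cong) auto
    also have "\<dots> \<le> L * 2 ^ (d * l)" using j(4) by (simp add: mult_right_mono)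
    finally have cK: "real (card K) \<le> L * 2 ^ (d * l)" .
    have diam: "ndiam N k = ennreal (t / 2 ^ l)" if "k \<in> K" for k
    proof -
      obtain x where "k = dyadic_at (j + int l) x" using \<open>k \<in> K\<close> by (auto simp: K_def subcubes_def)
      then show ?thesis
        by (simp add: ndiam_dyadic_at[OF N] t_def \<Delta>_def powr_diff powr_realpow)
    qed
    show "\<exists>K. finite K \<and> K \<subseteq> dyadic_cubes \<and> A \<subseteq> \<Union>K \<and> (\<forall>k\<in>K. ndiam N k \<le> ennreal (2 * unit_diam N * r)) \<and>
       (\<Sum>k\<in>K. g (ndiam N k)) \<le> ennreal (L * B * c ^ d * w r)"
    proof (intro exI[of _ K] conjI ballI)
      show "finite K" by (rule finK)
      show "K \<subseteq> dyadic_cubes" by (auto simp: K_def subcubes_def)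
      show "A \<subseteq> \<Union>K"
      proof
        fix x assume "x \<in> A"
        then have "dyadic_at (j + int l) x \<in> K" unfolding K_def subcubes_def by blast
        then show "x \<in> \<Union>K" using dyadic_at_refl by blast
      qed
      show "ndiam N k \<le> ennreal (2 * unit_diam N * r)" if "k \<in> K" for k
      proof -
        have "t / 2 ^ l \<le> t" using t by (simp add: field_simps)
        then show ?thesis unfolding diam[OF that] using t2 by (intro ennreal_leI) (simp add: \<Delta>_def)
      qed
      have w0: "0 \<le> w t" using regularD(1)[OF reg t(1) order_refl t(2)] by simp
      have wt: "w t \<le> c ^ d * w r"
      proof (cases "t \<le> r")
        case True
        have "w t \<le> w r" "0 < w r" using regularD[OF reg t(1) True] regularD(1)[OF reg, of r r] rA \<rho> by auto
        then have "1 * w t \<le> c ^ d * w r" using c w0 by (intro mult_mono one_le_power) auto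
        then show ?thesis by simp
      next
        case False
        then show ?thesis unfolding d_def using rA t tc by (intro regular_scale_le[OF reg]) auto
      qed
      have "(\<Sum>k\<in>K. g (ndiam N k)) = ennreal (real (card K)) * g (ennreal (t / 2 ^ l))"
        using diam by (simp add: ennreal_of_nat_eq_real_of_nat)
      also have "\<dots> \<le> ennreal (L * 2 ^ (d * l)) * g (ennreal (t / 2 ^ l))"
        using cK by (intro mult_right_mono ennreal_leI) auto
      also have "\<dots> = ennreal L * (ennreal (2 ^ (d * l)) * g (ennreal (t / 2 ^ l)))"
        using L(1) by (simp add: ennreal_mult mult.assoc)
      also have "\<dots> \<le> ennreal L * ennreal (B * w t)" using l by (intro mult_left_mono) auto
      also have "\<dots> = ennreal (L * B * w t)" using L(1) B w0 by (simp add: ennreal_mult mult.assoc)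
      also have "\<dots> \<le> ennreal (L * B * (c ^ d * w r))" using L(1) B wt by (intro ennreal_leI mult_left_mono) auto
      finally show "(\<Sum>k\<in>K. g (ndiam N k)) \<le> ennreal (L * B * c ^ d * w r)" by (simp add: mult.assoc)
    qed
  qed
  moreover have "0 \<le> L * B * c ^ d" using L(1) B c by auto
  ultimately show ?thesis using that \<rho> by blast
qed

lemma cost_empty [simp]: "cost f {} = 0"
  by (simp add: cost_def)

lemma cost_nat: "cost u S = (\<Sum>i. if i \<in> S then u i else 0)" for S :: "nat set"
proof -
  have "cost u S = (\<integral>\<^sup>+i. u i * indicator S i \<partial>count_space UNIV)"
    by (simp add: cost_eq nn_integral_count_space_indicator)
  also have "\<dots> = (\<Sum>i. u i * indicator S i)" by (rule nn_integral_count_space_nat)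
  also have "\<dots> = (\<Sum>i. if i \<in> S then u i else 0)" by (intro suminf_cong) auto
  finally show ?thesis .
qed

locale sparse =
  fixes N :: "real^'n \<Rightarrow> real" and I :: "nat set" and rr :: "nat \<Rightarrow> real" and xx :: "nat \<Rightarrow> real^'n"
    and b :: "nat \<Rightarrow> real"
  assumes norm: "is_norm N"
    and rr: "\<And>i. i \<in> I \<Longrightarrow> 0 < rr i" "\<And>i. i \<in> I \<Longrightarrow> rr i \<le> 1"
    and b: "\<And>j. 0 < b j" "decseq b" "b \<longlonglongrightarrow> 0"
    and few: "\<And>R. \<exists>C. \<forall>\<^sub>F j in sequentially. finite {i \<in> I. b j < rr i \<and> norm (xx i) \<le> R} \<and>
      real (card {i \<in> I. b j < rr i \<and> norm (xx i) \<le> R}) \<le> C / cvol CARD('n) (4 * int j)"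
begin

text \<open>In a bounded region the atoms with radius between \<open>b (Suc j)\<close> and
  \<open>b j\<close> number at most a constant times the count of level \<open>Suc j\<close>, and
  each costs at most \<open>w (b j)\<close>. The total is thus controlled by the convergent series,
  and its tails are small.\<close>

lemma small_radii_cost:
  assumes reg: "regular CARD('n) \<epsilon> w" and sum: "summable (\<lambda>j. w (min (b j) \<epsilon>) / cvol CARD('n) (4 * int j))"
    and e: "0 < (e::ennreal)" and \<delta>: "0 < \<delta>"
  obtains j where "b j < \<delta>" "finite {i \<in> I. b j < rr i \<and> norm (xx i) \<le> R}"
    "cost (\<lambda>i. ennreal (w (rr i))) {i \<in> I. rr i \<le> b j \<and> norm (xx i) \<le> R} < e"
proof -
  define d where "d = CARD('n)"
  define u where "u i = ennreal (w (rr i))" for i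
  define S where "S j = {i \<in> I. rr i \<le> b j \<and> norm (xx i) \<le> R}" for j
  define G where "G j = {i \<in> I. b j < rr i \<and> norm (xx i) \<le> R}" for j
  have eps: "\<epsilon> > 0" using reg by (simp add: regular_def)
  obtain C where C: "\<forall>\<^sub>F j in sequentially. finite (G j) \<and> real (card (G j)) \<le> C / cvol d (4 * int j)"
    using few[of R] unfolding G_def d_def by blast
  have Bt: "\<forall>\<^sub>F j in sequentially. b j < min \<delta> \<epsilon>" using \<delta> eps by (intro order_tendstoD(2)[OF b(3)]) simp
  obtain j0 where j0: "\<And>j. j \<ge> j0 \<Longrightarrow> finite (G j) \<and> real (card (G j)) \<le> C / cvol d (4 * int j) \<and> b j < min \<delta> \<epsilon>"
    using eventually_conj[OF C Bt] unfolding eventually_sequentially by auto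
  define P where "P k = {i \<in> I. b (j0 + Suc k) < rr i \<and> rr i \<le> b (j0 + k) \<and> norm (xx i) \<le> R}" for k
  define a where "a k = C / cvol d (4 * int (j0 + Suc k)) * w (b (j0 + k))" for k
  \<comment> \<open>Counting at the lower end of a shell costs one extra factor, the ratio
    \<open>q\<close> of consecutive levels.\<close>
  define q where "q = 1 / cvol d (4::int)"
  have w0: "0 < w (b (j0 + k))" for k using regularD(1)[OF reg b(1) order_refl, of "j0 + k"] j0[of "j0 + k"] by simp
  have C0: "0 \<le> C / cvol d (4 * int j)" if "j \<ge> j0" for j 
  proof -
    have "0 \<le> real (card (G j))" by simp
    also have "\<dots> \<le> C / cvol d (4 * int j)" using j0[OF that] by blast
    finally show ?thesis .
  qed
  have SP: "S j0 \<subseteq> (\<Union>k. P k)"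
  proof
    fix i assume i: "i \<in> S j0"
    have "\<forall>\<^sub>F j in sequentially. b j < rr i" using i rr by (intro order_tendstoD(2)[OF b(3)]) (auto simp: S_def)
    then obtain j1 where "\<And>j. j \<ge> j1 \<Longrightarrow> b j < rr i" unfolding eventually_sequentially by blast
    then have ex: "b (j0 + j1) < rr i" by simp
    define k where "k = (LEAST k. b (j0 + k) < rr i)"
    have k: "b (j0 + k) < rr i" unfolding k_def using ex by (rule LeastI)
    then have "k \<noteq> 0" using i unfolding S_def by (intro notI) simp
    then obtain k' where k': "k = Suc k'" using not0_implies_Suc by blast
    have "\<not> b (j0 + k') < rr i" using not_less_Least[of k' "\<lambda>k. b (j0 + k) < rr i"] k' by (simp add: k_def)
    then have "i \<in> P k'" using i k k' by (auto simp: P_def S_def)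
    then show "i \<in> (\<Union>k. P k)" by blast
  qed
  have cP: "cost u (P k) \<le> ennreal (a k)" for k
  proof -
    have sub: "P k \<subseteq> G (j0 + Suc k)" by (auto simp: P_def G_def)
    have fin: "finite (P k)" using sub j0[of "j0 + Suc k"] by (auto intro: finite_subset)
    have "card (P k) \<le> card (G (j0 + Suc k))" using sub j0[of "j0 + Suc k"] by (intro card_mono) auto
    then have cle: "real (card (P k)) \<le> C / cvol d (4 * int (j0 + Suc k))" using j0[of "j0 + Suc k"] by (meson le_add1 of_nat_mono order_trans)
    have "cost u (P k) = (\<Sum>i\<in>P k. u i)" using fin by (rule cost_finite_sum)
    also have "\<dots> \<le> (\<Sum>i\<in>P k. ennreal (w (b (j0 + k))))"
    proof (rule sum_mono)
      fix i assume "i \<in> P k"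
      then have "0 < rr i" "rr i \<le> b (j0 + k)" using rr by (auto simp: P_def)
      then show "u i \<le> ennreal (w (b (j0 + k)))"
        unfolding u_def using regularD(2)[OF reg] j0[of "j0 + k"] by (intro ennreal_leI) auto
    qed
    also have "\<dots> = ennreal (real (card (P k)) * w (b (j0 + k)))"
      using w0[of k] by (simp add: ennreal_mult ennreal_of_nat_eq_real_of_nat)
    also have "\<dots> \<le> ennreal (a k)" unfolding a_def using cle w0[of k] by (intro ennreal_leI mult_right_mono) auto
    finally show ?thesis .
  qed
  have a_eq: "a k = (C * q) * (w (min (b (k + j0)) \<epsilon>) / cvol d (4 * int (k + j0)))" for k
  proof -
    have "cvol d (4 * int (j0 + Suc k)) = cvol d (4 * int (k + j0)) * cvol d 4"
      by (simp add: powr_add[symmetric] algebra_simps)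
    moreover have "min (b (k + j0)) \<epsilon> = b (j0 + k)" using j0[of "j0 + k"] by (simp add: add.commute)
    ultimately show ?thesis by (simp add: a_def q_def)
  qed
  have "summable (\<lambda>k. w (min (b (k + j0)) \<epsilon>) / cvol d (4 * int (k + j0)))"
    using sum unfolding d_def by (rule summable_ignore_initial_segment)
  then have suma: "summable a" unfolding a_eq by (rule summable_mult)
  have a0: "0 \<le> a k" for k unfolding a_def using C0[of "j0 + Suc k"] w0[of k] by (intro mult_nonneg_nonneg) auto
  have "cost u (S j0) \<le> cost u (\<Union>k. P k)" by (rule cost_mono[OF SP])
  also have "\<dots> \<le> (\<Sum>k. cost u (P k))" by (rule cost_UN_le)
  also have "\<dots> \<le> (\<Sum>k. ennreal (a k))" by (intro suminf_le cP) auto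
  also have "\<dots> = ennreal (suminf a)" using a0 suma by (intro suminf_ennreal2) auto
  also have "\<dots> < \<infinity>" by simp
  finally have fin: "cost u (S j0) < \<infinity>" .
  define A where "A n = S (j0 + n)" for n
  have bdec: "b j \<le> b i" if "i \<le> j" for i j using b(2) that by (auto simp: decseq_def)
  have "decseq A" unfolding decseq_def A_def S_def using bdec by (auto intro: order_trans)
  moreover have "(\<Inter>n. A n) = {}"
  proof (rule ccontr)
    assume "(\<Inter>n. A n) \<noteq> {}"
    then obtain i where i: "\<And>n. i \<in> A n" by blast
    then have "0 < rr i" using rr by (auto simp: A_def S_def)
    then have "\<forall>\<^sub>F j in sequentially. b j < rr i" by (intro order_tendstoD(2)[OF b(3)])
    then obtain j1 where "\<And>j. j \<ge> j1 \<Longrightarrow> b j < rr i" unfolding eventually_sequentially by blast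
    then have "b (j0 + j1) < rr i" by simp
    then show False using i[of j1] by (simp add: A_def S_def)
  qed
  moreover have "A n \<subseteq> S j0" for n unfolding A_def S_def using bdec[of j0 "j0 + n"] by (auto intro: order_trans)
  ultimately obtain n0 where n0: "\<And>n. n \<ge> n0 \<Longrightarrow> cost u (A n) < e"
    using cost_tail[OF fin _ _ _ e, of A] by blast
  have "b (j0 + n0) < \<delta>" "finite (G (j0 + n0))" using j0[of "j0 + n0"] by auto
  moreover have "cost u (S (j0 + n0)) < e" using n0[of n0] by (simp add: A_def)
  ultimately show ?thesis using that unfolding u_def S_def G_def by blast
qed

text \<open>Counts are available only in bounded regions, so points of norm at most \<open>R\<close>
  get their own level \<open>J R\<close> and their own budget. Such a point of the limsup set lies
  in infinitely many balls, of which only finitely many have radius above \<open>b (J R)\<close>;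
  one of the others is therefore among the balls covered.\<close>

theorem cover_limsup:
  assumes reg: "regular CARD('n) \<epsilon> w" and sum: "summable (\<lambda>j. w (min (b j) \<epsilon>) / cvol CARD('n) (4 * int j))"
    and cov: "coverable N g w \<rho> B" and \<rho>: "0 < \<rho>" "\<rho> \<le> \<epsilon>" and B: "0 \<le> B" and e: "0 < (e::real)" and \<delta>: "0 < \<delta>"
  obtains C where "C \<subseteq> dyadic_cubes" "limsup_balls N I rr xx \<subseteq> \<Union>C" "\<And>K. K \<in> C \<Longrightarrow> ndiam N K \<le> ennreal \<delta>"
    "dcost N g C \<le> ennreal e"
proof -
  define d where "d = CARD('n)"
  define f where "f = (\<lambda>K. g (ndiam N K))"
  define \<Delta> where "\<Delta> = unit_diam N"
  have D: "\<Delta> > 0" using ndiam_unit(2)[OF norm] by (simp add: \<Delta>_def)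
  obtain a where a: "a > 0" "\<And>x. a * norm x \<le> N x" using is_norm_lower[OF norm] by blast
  have sym: "N (x - y) = N (y - x)" and tri: "N (x + y) \<le> N x + N y" for x y
    using norm is_norm_minus_commute by (auto simp: is_norm_def)
  define ball where "ball i = {y. N (y - xx i) < rr i}" for i
  \<comment> \<open>\<open>w (2 * r) \<le> 2 ^ d * w r\<close> accounts for the diameter of a ball;
    the 1 makes the constant positive, since budgets are divided by it.\<close>
  define B1 where "B1 = B * 2 ^ d + 1"
  have B1: "B1 > 0" using B by (simp add: B1_def add_nonneg_pos)
  \<comment> \<open>The two bounds admit a ball of diameter \<open>2 * r\<close> to
    \<open>coverable\<close> and keep the diameters of its cubes, at most
    \<open>2 * \<Delta> * (2 * r)\<close>, within \<open>\<delta>\<close>.\<close>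
  define \<delta>1 where "\<delta>1 = min (\<rho> / 2) (\<delta> / (4 * \<Delta>))"
  have \<delta>1: "\<delta>1 > 0" using \<rho> \<delta> D by (simp add: \<delta>1_def)
  have ex: "\<exists>K. finite K \<and> K \<subseteq> dyadic_cubes \<and> ball i \<subseteq> \<Union>K \<and> (\<forall>k\<in>K. ndiam N k \<le> ennreal \<delta>) \<and> cost f K \<le> ennreal B1 * ennreal (w (rr i))"
    if i: "i \<in> I" "rr i < \<delta>1" for i
  proof -
    have ri: "0 < rr i" "2 * rr i \<le> \<rho>" "4 * \<Delta> * rr i \<le> \<delta>" using rr(1)[OF i(1)] i(2) D by (auto simp: \<delta>1_def field_simps)
    have "ndiam N (ball i) \<le> ennreal (2 * rr i)"
      unfolding ndiam_def
    proof (intro SUP_least ennreal_leI)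
      fix x y assume "x \<in> ball i" "y \<in> ball i"
      then have "N (x - xx i) < rr i" "N (xx i - y) < rr i" by (auto simp: ball_def sym[of "xx i" y])
      then show "N (x - y) \<le> 2 * rr i" using tri[of "x - xx i" "xx i - y"] by simp
    qed
    then obtain K where K: "finite K" "K \<subseteq> dyadic_cubes" "ball i \<subseteq> \<Union>K" "\<forall>k\<in>K. ndiam N k \<le> ennreal (2 * unit_diam N * (2 * rr i))"
      "(\<Sum>k\<in>K. g (ndiam N k)) \<le> ennreal (B * w (2 * rr i))"
      using cov[unfolded coverable_def, rule_format, of "2 * rr i" "ball i"] ri by auto
    have "w (2 * rr i) \<le> 2 ^ d * w (rr i)" unfolding d_def using ri \<rho> by (intro regular_scale_le[OF reg]) auto
    then have "B * w (2 * rr i) \<le> B * 2 ^ d * w (rr i)" using B by (simp add: mult_left_mono mult.assoc)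
    also have "\<dots> \<le> B1 * w (rr i)"
      using regularD(1)[OF reg ri(1) order_refl] ri \<rho> by (intro mult_right_mono) (auto simp: B1_def)
    finally have "cost f K \<le> ennreal (B1 * w (rr i))"
      using K(1,5) by (simp add: cost_finite_sum f_def) (meson ennreal_leI order_trans)
    moreover have "ndiam N k \<le> ennreal \<delta>" if "k \<in> K" for k
    proof -
      have "ndiam N k \<le> ennreal (2 * unit_diam N * (2 * rr i))" using K(4) that by blast
      also have "\<dots> \<le> ennreal \<delta>" using ri(3) by (intro ennreal_leI) (simp add: \<Delta>_def)
      finally show ?thesis .
    qed
    ultimately show ?thesis using K(1-3) B1 by (intro exI[of _ K]) (auto simp: ennreal_mult')
  qed
  then obtain KK where KK: "\<And>i. i \<in> I \<Longrightarrow> rr i < \<delta>1 \<Longrightarrow> finite (KK i) \<and> KK i \<subseteq> dyadic_cubes \<and> ball i \<subseteq> \<Union>(KK i) \<and>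
      (\<forall>k\<in>KK i. ndiam N k \<le> ennreal \<delta>) \<and> cost f (KK i) \<le> ennreal B1 * ennreal (w (rr i))" by metis
  have exJ: "\<forall>R::nat. \<exists>j. b j < \<delta>1 \<and> finite {i \<in> I. b j < rr i \<and> norm (xx i) \<le> real R + 1 / a} \<and>
      cost (\<lambda>i. ennreal (w (rr i))) {i \<in> I. rr i \<le> b j \<and> norm (xx i) \<le> real R + 1 / a} < ennreal (e * (1/2) ^ Suc R / B1)"
  proof
    fix R :: nat
    have pos: "0 < ennreal (e * (1/2) ^ Suc R / B1)" using e B1 by simp
    show "\<exists>j. b j < \<delta>1 \<and> finite {i \<in> I. b j < rr i \<and> norm (xx i) \<le> real R + 1 / a} \<and>
      cost (\<lambda>i. ennreal (w (rr i))) {i \<in> I. rr i \<le> b j \<and> norm (xx i) \<le> real R + 1 / a} < ennreal (e * (1/2) ^ Suc R / B1)"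
      using small_radii_cost[OF reg sum pos \<delta>1, of "real R + 1 / a"] by blast
  qed
  from choice[OF exJ] obtain J where J: "\<And>R. b (J R) < \<delta>1" "\<And>R. finite {i \<in> I. b (J R) < rr i \<and> norm (xx i) \<le> real R + 1 / a}"
     "\<And>R. cost (\<lambda>i. ennreal (w (rr i))) {i \<in> I. rr i \<le> b (J R) \<and> norm (xx i) \<le> real R + 1 / a} < ennreal (e * (1/2) ^ Suc R / B1)"
    by blast
  define S where "S R = {i \<in> I. rr i \<le> b (J R) \<and> norm (xx i) \<le> real R + 1 / a}" for R
  have SI: "i \<in> I" "rr i < \<delta>1" if "i \<in> S R" for i R using that J(1)[of R] by (auto simp: S_def)
  define C where "C R = (\<Union>i. if i \<in> S R then KK i else {})" for R
  have cC: "cost f (C R) \<le> ennreal (e * (1/2) ^ Suc R)" for R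
  proof -
    have "cost f (C R) \<le> (\<Sum>i. cost f (if i \<in> S R then KK i else {}))" unfolding C_def by (rule cost_UN_le)
    also have "\<dots> \<le> (\<Sum>i. ennreal B1 * (if i \<in> S R then ennreal (w (rr i)) else 0))"
      using KK SI by (intro suminf_le) auto
    also have "\<dots> = ennreal B1 * cost (\<lambda>i. ennreal (w (rr i))) (S R)"
      by (simp add: cost_nat ennreal_suminf_cmult)
    also have "\<dots> \<le> ennreal B1 * ennreal (e * (1/2) ^ Suc R / B1)"
      using J(3)[of R] unfolding S_def by (intro mult_left_mono) auto
    also have "\<dots> = ennreal (e * (1/2) ^ Suc R)" using B1 e by (subst ennreal_mult[symmetric]) auto
    finally show ?thesis .
  qed
  show ?thesis
  proof (rule that[of "\<Union>R. C R"])
    show "(\<Union>R. C R) \<subseteq> dyadic_cubes" using KK SI by (fastforce simp: C_def split: if_splits)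
    show "ndiam N K \<le> ennreal \<delta>" if "K \<in> (\<Union>R. C R)" for K
      using that KK SI by (fastforce simp: C_def split: if_splits)
    have "cost f (\<Union>R. C R) \<le> (\<Sum>R. cost f (C R))" by (rule cost_UN_le)
    also have "\<dots> \<le> (\<Sum>R. ennreal (e * (1/2) ^ Suc R))" by (intro suminf_le cC) auto
    also have "\<dots> = ennreal (e * 1)"
      using e by (intro suminf_ennreal_eq sums_mult power_half_series) auto
    finally show "dcost N g (\<Union>R. C R) \<le> ennreal e" by (simp add: f_def)
    show "limsup_balls N I rr xx \<subseteq> \<Union> (\<Union>R. C R)"
    proof
      fix y assume "y \<in> limsup_balls N I rr xx"
      then have inf: "infinite {i \<in> I. N (y - xx i) < rr i}" by (simp add: limsup_balls_def)
      obtain R :: nat where R: "norm y \<le> real R" using real_arch_simple by blast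
      have near: "norm (xx i) \<le> real R + 1 / a" if "i \<in> I" "N (y - xx i) < rr i" for i
      proof -
        have "a * norm (y - xx i) \<le> 1" using a(2)[of "y - xx i"] that rr(2)[OF that(1)] by linarith
        then have "norm (y - xx i) \<le> 1 / a" using a(1) by (simp add: field_simps)
        then show ?thesis using R norm_triangle_ineq4[of y "y - xx i"] by simp
      qed
      obtain i where i: "i \<in> I" "N (y - xx i) < rr i" "\<not> b (J R) < rr i"
      proof (rule ccontr)
        assume "\<not> thesis"
        then have "{i \<in> I. N (y - xx i) < rr i} \<subseteq> {i \<in> I. b (J R) < rr i \<and> norm (xx i) \<le> real R + 1 / a}"
          using that near by blast
        then show False using inf J(2)[of R] finite_subset by blast
      qed
      then have iS: "i \<in> S R" using near by (auto simp: S_def)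
      have "y \<in> ball i" using i by (simp add: ball_def)
      then obtain k where "k \<in> KK i" "y \<in> k" using KK[OF SI[OF iS]] by blast
      moreover have "k \<in> C R" unfolding C_def using \<open>k \<in> KK i\<close> iS by (intro UN_I[of i]) auto
      ultimately show "y \<in> \<Union> (\<Union>R. C R)" by blast
    qed
  qed
qed

end

section \<open>Comparison of gauge functions\<close>

lemma ennreal_le_realE:
  assumes "0 < x" "x \<le> ennreal r"
  obtains s where "x = ennreal s" "0 < s" "s \<le> r"
proof -
  have "0 < r" using assms by (metis ennreal_less_zero_iff order_less_le_trans)
  then show ?thesis using ennreal_in_Ioc[of x r] assms that by auto
qed

lemma eventually_at_right_ennrealI:
  assumes "0 < \<delta>" "\<And>s. 0 < s \<Longrightarrow> s < \<delta> \<Longrightarrow> P (ennreal s)"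
  shows "eventually P (at_right (0::ennreal))"
proof -
  have "P y" if y: "0 < y" "y < ennreal \<delta>" for y
  proof -
    obtain s where "y = ennreal s" "0 < s" "s \<le> \<delta>" using ennreal_le_realE[OF y(1) less_imp_le[OF y(2)]] by blast
    then show ?thesis using assms(2)[of s] y(2) by (simp add: ennreal_less_iff)
  qed
  then show ?thesis using assms(1) by (subst eventually_at_right[of 0 1]) (auto intro!: exI[of _ "ennreal \<delta>"])
qed

text \<open>For a normalized gauge the quotient is itself the infimum in \<open>dnorm\<close>, taken
  over an interval that grows with the argument.\<close>

lemma dnorm_ratio_antimono:
  assumes "\<And>r. r \<le> e \<Longrightarrow> h r = dnorm d h r" "e < \<infinity>" "0 < r" "r \<le> s" "s \<le> e"
  shows "h s / s ^ d \<le> h r / r ^ d"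
proof -
  have *: "h q / q ^ d = (INF \<rho>\<in>{0<..q}. h \<rho> / \<rho> ^ d)" if "0 < q" "q \<le> e" for q
  proof -
    have "q < \<infinity>" using that assms(2) order_le_less_trans by blast
    then have "q ^ d \<noteq> 0" "q ^ d \<noteq> top" "h q = q ^ d * (INF \<rho>\<in>{0<..q}. h \<rho> / \<rho> ^ d)"
      using that assms(1)[of q] by (auto simp: dnorm_def power_eq_top_ennreal)
    then show ?thesis by (metis mult.commute mult_divide_eq_ennreal)
  qed
  have "(INF \<rho>\<in>{0<..s}. h \<rho> / \<rho> ^ d) \<le> (INF \<rho>\<in>{0<..r}. h \<rho> / \<rho> ^ d)"
    using assms(4) by (intro INF_superset_mono) auto
  then show ?thesis using *[of s] *[of r] assms by auto
qed

text \<open>Translates \<open>gauge_prec\<close> into a limit of real functions on a common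
  interval. Positivity of \<open>hr\<close> is itself a consequence of the large ratio, and the
  interval stays within \<open>eps_h d h\<close>, so that small cubes are admissible in
  \<open>M_inf\<close>.\<close>

lemma gauge_prec_regular:
  assumes h: "gauge_fun h" "d_normalized d h" and prec: "gauge_prec h (dnorm d g)"
    and reg: "regular d \<epsilon> f" and dn: "\<And>r. 0 < r \<Longrightarrow> r \<le> \<epsilon> \<Longrightarrow> dnorm d g (ennreal r) = ennreal (f r)"
  obtains \<epsilon>' hr where "regular d \<epsilon>' hr" "\<epsilon>' \<le> \<epsilon>" "\<And>r. 0 < r \<Longrightarrow> r \<le> \<epsilon>' \<Longrightarrow> h (ennreal r) = ennreal (hr r)"
    "filterlim (\<lambda>r. hr r / f r) at_top (at_right 0)" "ennreal \<epsilon>' \<le> eps_h d h"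
proof -
  have eps: "\<epsilon> > 0" using reg by (simp add: regular_def)
  have f0: "0 < f r" if "0 < r" "r \<le> \<epsilon>" for r using regularD(1)[OF reg that(1) order_refl that(2)] .
  obtain \<epsilon>1 where \<epsilon>1: "0 < \<epsilon>1" "mono_on {0..\<epsilon>1} h" using h(1) by (auto simp: gauge_fun_def)
  obtain \<epsilon>2 where \<epsilon>2: "0 < \<epsilon>2" "\<And>r. r < \<epsilon>2 \<Longrightarrow> h r = dnorm d h r" using h(2) by (auto simp: d_normalized_def)
  have lim: "((\<lambda>r. h (ennreal r)) \<longlongrightarrow> 0) (at_right 0)"
    using h(1) filterlim_compose[OF _ filterlim_ennreal_at_right_0, of h "nhds 0"] by (simp add: gauge_fun_def)
  then have "\<forall>\<^sub>F r in at_right 0. h (ennreal r) < 1" by (rule order_tendstoD(2)) simp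
  then obtain \<delta>1 where \<delta>1: "\<delta>1 > 0" "\<And>r. 0 < r \<Longrightarrow> r < \<delta>1 \<Longrightarrow> h (ennreal r) < 1"
    unfolding eventually_at_right_field by blast
  have ex: "\<exists>\<delta>>0. ennreal \<delta> < e" if e: "0 < e" for e :: ennreal
  proof -
    obtain x where x: "0 < x" "x < e" using dense[OF e] by blast
    then have "x < top" using order_less_le_trans top_greatest by blast
    then have "x = ennreal (enn2real x)" "0 < enn2real x" using x by (auto simp: enn2real_positive_iff)
    then show ?thesis using x(2) by (intro exI[of _ "enn2real x"]) simp
  qed
  \<comment> \<open>The normalized \<open>g\<close> is positive near 0, which excludes the
    conventional case of \<open>gauge_prec\<close>.\<close>
  have nv: "\<not> (\<exists>e>0. \<forall>r. 0 < r \<and> r < e \<longrightarrow> dnorm d g r = 0)"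
  proof
    assume "\<exists>e>0. \<forall>r. 0 < r \<and> r < e \<longrightarrow> dnorm d g r = 0"
    then obtain e where e: "0 < e" "\<And>r. 0 < r \<Longrightarrow> r < e \<Longrightarrow> dnorm d g r = 0" by blast
    obtain \<delta> where \<delta>: "\<delta> > 0" "ennreal \<delta> < e" using ex[OF e(1)] by blast
    define s where "s = min \<delta> \<epsilon>"
    have "ennreal s \<le> ennreal \<delta>" by (intro ennreal_leI) (simp add: s_def)
    then have "ennreal s < e" using \<delta>(2) by order
    moreover have "0 < s" using \<delta>(1) eps by (simp add: s_def)
    ultimately have "dnorm d g (ennreal s) = 0" by (intro e(2)) auto
    then show False using dn[of s] f0[of s] \<delta>(1) eps by (simp add: s_def)
  qed
  then have ratio: "((\<lambda>r. h r / dnorm d g r) \<longlongrightarrow> \<infinity>) (at_right 0)" using prec unfolding gauge_prec_def by blast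
  have big: "\<exists>\<delta>>0. \<forall>r. 0 < r \<and> r < \<delta> \<longrightarrow> ennreal K < h (ennreal r) / ennreal (f r)" for K
  proof -
    have "\<forall>\<^sub>F r in at_right 0. ennreal K < h r / dnorm d g r"
      using order_tendstoD(1)[OF ratio, of "ennreal K"] by simp
    from eventually_compose_filterlim[OF this filterlim_ennreal_at_right_0]
    have "\<forall>\<^sub>F r in at_right 0. ennreal K < h (ennreal r) / dnorm d g (ennreal r)" .
    then obtain \<delta> where \<delta>: "\<delta> > 0" "\<And>r. 0 < r \<Longrightarrow> r < \<delta> \<Longrightarrow> ennreal K < h (ennreal r) / dnorm d g (ennreal r)"
      unfolding eventually_at_right_field by blast
    show ?thesis
    proof (intro exI[of _ "min \<delta> \<epsilon>"] conjI allI impI)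
      fix r assume "0 < r \<and> r < min \<delta> \<epsilon>"
      then show "ennreal K < h (ennreal r) / ennreal (f r)" using \<delta>(2)[of r] dn[of r] by simp
    qed (use \<delta>(1) eps in auto)
  qed
  obtain \<delta>2 where \<delta>2: "\<delta>2 > 0" "\<And>r. 0 < r \<Longrightarrow> r < \<delta>2 \<Longrightarrow> ennreal 1 < h (ennreal r) / ennreal (f r)" using big by blast
  obtain \<delta>3 where \<delta>3: "\<delta>3 > 0" "ennreal \<delta>3 < min \<epsilon>1 \<epsilon>2" using ex[of "min \<epsilon>1 \<epsilon>2"] \<epsilon>1(1) \<epsilon>2(1) by auto
  define \<epsilon>' where "\<epsilon>' = min (min (\<delta>1 / 2) (\<delta>2 / 2)) (min \<delta>3 \<epsilon>)"
  have e': "0 < \<epsilon>'" "\<epsilon>' < \<delta>1" "\<epsilon>' < \<delta>2" "\<epsilon>' \<le> \<delta>3" "\<epsilon>' \<le> \<epsilon>" using \<delta>1(1) \<delta>2(1) \<delta>3(1) eps by (auto simp: \<epsilon>'_def)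
  have "ennreal \<epsilon>' \<le> ennreal \<delta>3" using e' by (intro ennreal_leI)
  then have e'': "ennreal \<epsilon>' < \<epsilon>1" "ennreal \<epsilon>' < \<epsilon>2" using \<delta>3(2) by auto
  have mono: "mono_on {0..ennreal \<epsilon>'} h" using e''(1) by (intro mono_on_subset[OF \<epsilon>1(2)]) auto
  have quot: "h s / s ^ d \<le> h r / r ^ d" if "0 < r" "r \<le> s" "s \<le> ennreal \<epsilon>'" for r s
  proof (rule dnorm_ratio_antimono[where e = "ennreal \<epsilon>'"])
    show "h q = dnorm d h q" if "q \<le> ennreal \<epsilon>'" for q using that e'' by (intro \<epsilon>2(2)) order
  qed (use that in auto)
  have epsh: "ennreal \<epsilon>' \<le> eps_h d h"
    unfolding eps_h_def using e' mono quot by (intro Sup_upper) auto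
  define hr where "hr r = enn2real (h (ennreal r))" for r
  have hh: "h (ennreal r) = ennreal (hr r)" if "0 < r" "r \<le> \<epsilon>'" for r
  proof -
    have "h (ennreal r) < 1" using that e' by (intro \<delta>1(2)) auto
    then have "h (ennreal r) < top" using ennreal_one_less_top order_less_trans by blast
    then show ?thesis by (simp add: hr_def)
  qed
  have hr0: "0 < hr r" if "0 < r" "r \<le> \<epsilon>'" for r
  proof (rule ccontr)
    assume "\<not> 0 < hr r"
    then have "h (ennreal r) = 0" using hh[OF that] by (simp add: ennreal_neg)
    then have "ennreal 1 < 0" using \<delta>2(2)[of r] that e' by simp
    then show False by simp
  qed
  have "regular d \<epsilon>' hr"
    unfolding regular_def
  proof (intro conjI allI impI e'(1))
    fix r s assume rs: "0 < r \<and> r \<le> s \<and> s \<le> \<epsilon>'"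
    then have le: "ennreal r \<le> ennreal s" "ennreal s \<le> ennreal \<epsilon>'" by (auto intro: ennreal_leI)
    show "0 < hr r" using hr0 rs by simp
    have "h (ennreal r) \<le> h (ennreal s)" using le by (intro mono_onD[OF mono]) (auto intro: order_trans)
    then show "hr r \<le> hr s" using hh[of r] hh[of s] rs hr0[of s] by (simp add: ennreal_le_iff)
    have "h (ennreal s) / ennreal s ^ d \<le> h (ennreal r) / ennreal r ^ d" using le rs by (intro quot) auto
    then have "ennreal (hr s / s ^ d) \<le> ennreal (hr r / r ^ d)"
      using hh[of r] hh[of s] rs hr0[of s] hr0[of r] by (simp add: ennreal_power divide_ennreal)
    then show "hr s / s ^ d \<le> hr r / r ^ d" using hr0[of r] rs by (subst (asm) ennreal_le_iff) auto
  qed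
  moreover have "filterlim (\<lambda>r. hr r / f r) at_top (at_right 0)"
    unfolding filterlim_at_top
  proof
    fix K :: real
    obtain \<delta> where \<delta>: "\<delta> > 0" "\<And>r. 0 < r \<Longrightarrow> r < \<delta> \<Longrightarrow> ennreal K < h (ennreal r) / ennreal (f r)" using big by blast
    show "\<forall>\<^sub>F r in at_right 0. K \<le> hr r / f r"
      unfolding eventually_at_right_field
    proof (intro exI[of _ "min \<delta> \<epsilon>'"] conjI allI impI)
      fix r assume r: "0 < r" "r < min \<delta> \<epsilon>'"
      then have "ennreal K < ennreal (hr r / f r)"
        using \<delta>(2)[of r] hh[of r] hr0[of r] f0[of r] e' by (simp add: divide_ennreal)
      then have "\<not> hr r / f r \<le> K" using ennreal_leI[of "hr r / f r" K] by (meson leD)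
      then show "K \<le> hr r / f r" by linarith
    qed (use \<delta>(1) e'(1) in auto)
  qed
  ultimately show ?thesis by (intro that[OF _ e'(5) hh _ epsh])
qed

text \<open>A tail of the series is small without truncation; a small \<open>a\<close> then makes
  the remaining finite sum small.\<close>

lemma truncation_level:
  fixes v D :: "nat \<Rightarrow> real"
  assumes "\<And>j. 0 < v j" "\<And>j. 0 < D j" "summable (\<lambda>j. v j * D j)" "0 < \<eta>"
  obtains a where "0 < a" "a \<le> \<eta>" "(\<Sum>j. min (v j) a * D j) \<le> \<eta>"
proof -
  have vD: "0 \<le> v j * D j" for j using assms(1,2)[of j] by simp
  obtain n where n: "\<And>m. m \<ge> n \<Longrightarrow> norm (\<Sum>i. v (i + m) * D (i + m)) < \<eta> / 2"
    using suminf_exist_split[of "\<eta> / 2" "\<lambda>j. v j * D j"] assms(3,4) by auto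
  define M where "M = (\<Sum>j<n. D j)"
  have M: "M \<ge> 0" unfolding M_def using assms(2) by (intro sum_nonneg) (auto intro: less_imp_le)
  define a where "a = min \<eta> (\<eta> / 2 / (1 + M))"
  have a: "0 < a" "a \<le> \<eta>" "a \<le> \<eta> / 2 / (1 + M)" using assms(4) M by (auto simp: a_def)
  have t0: "0 \<le> min (v j) a * D j" for j using assms(1,2)[of j] a(1) by simp
  have tle: "min (v j) a * D j \<le> v j * D j" for j using assms(2)[of j] by (intro mult_right_mono) auto
  have s: "summable (\<lambda>j. min (v j) a * D j)"
    by (rule summable_comparison_test'[OF assms(3), of 0]) (use t0 tle in auto)
  have "(\<Sum>j. min (v j) a * D j) = (\<Sum>j. min (v (j + n)) a * D (j + n)) + (\<Sum>j<n. min (v j) a * D j)"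
    by (rule suminf_split_initial_segment[OF s])
  also have "(\<Sum>j. min (v (j + n)) a * D (j + n)) \<le> (\<Sum>j. v (j + n) * D (j + n))"
    using tle s assms(3) by (intro suminf_le) (auto intro!: summable_ignore_initial_segment[of "\<lambda>j. min (v j) a * D j"] summable_ignore_initial_segment[of "\<lambda>j. v j * D j"])
  also have "\<dots> \<le> \<eta> / 2" using n[of n] by simp
  also have "(\<Sum>j<n. min (v j) a * D j) \<le> (\<Sum>j<n. a * D j)"
    using assms(2) by (intro sum_mono mult_right_mono) (auto intro: less_imp_le)
  also have "\<dots> = a * M" by (simp add: M_def sum_distrib_left)
  also have "\<dots> \<le> \<eta> / 2 / (1 + M) * M" using a M by (intro mult_right_mono) auto
  also have "\<dots> \<le> \<eta> / 2"
  proof -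
    have "\<eta> / 2 / (1 + M) * M = \<eta> / 2 * (M / (1 + M))" by simp
    also have "\<dots> \<le> \<eta> / 2 * 1" using M assms(4) by (intro mult_left_mono) auto
    finally show ?thesis by simp
  qed
  finally show ?thesis using that a by simp
qed

lemma min_ratio_antimono:
  fixes x y a :: real
  assumes "0 < x" "x \<le> y" "0 < a"
  shows "min y a / y \<le> min x a / x"
  using assms by (auto simp: min_def field_simps)

text \<open>The gauge is \<open>\<Sum>\<^sub>k min (f, a k)\<close>: each summand keeps both monotonicity properties and
  \<open>min (f, a) / f\<close> increases to 1, so a sequence \<open>a\<close> tending to 0 fast enough preserves summability.\<close>

lemma exists_smaller_gauge:
  assumes reg: "regular d \<epsilon> f" and dn: "\<And>r. 0 < r \<Longrightarrow> r \<le> \<epsilon> \<Longrightarrow> dnorm d g (ennreal r) = ennreal (f r)"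
    and flim: "(f \<longlongrightarrow> 0) (at_right 0)" and b: "\<And>j. 0 < b j" and D: "\<And>j. 0 < D j"
    and sum: "summable (\<lambda>j. f (min (b j) \<epsilon>) * D j)"
  obtains h hr where "gauge_fun h" "d_normalized d h" "gauge_prec h (dnorm d g)" "regular d \<epsilon> hr"
    "\<And>r. 0 < r \<Longrightarrow> r \<le> \<epsilon> \<Longrightarrow> h (ennreal r) = ennreal (hr r)" "summable (\<lambda>j. hr (min (b j) \<epsilon>) * D j)"
    "ennreal \<epsilon> \<le> eps_h d h"
proof -
  have eps: "\<epsilon> > 0" using reg by (simp add: regular_def)
  have f0: "0 < f r" if "0 < r" "r \<le> \<epsilon>" for r using regularD(1)[OF reg that(1) order_refl that(2)] .
  define v where "v j = f (min (b j) \<epsilon>)" for j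
  have v0: "0 < v j" for j using f0[of "min (b j) \<epsilon>"] b[of j] eps by (simp add: v_def)
  \<comment> \<open>The first bound makes the sum of all \<open>a k\<close> converge, hence
    \<open>hr\<close> finite and small near 0; the second makes the sums over \<open>j\<close> of
    the truncated series summable in \<open>k\<close>.\<close>
  have "\<forall>k::nat. \<exists>a>0. a \<le> (1/2) ^ k \<and> (\<Sum>j. min (v j) a * D j) \<le> (1/2) ^ k"
  proof
    fix k :: nat
    show "\<exists>a>0. a \<le> (1/2) ^ k \<and> (\<Sum>j. min (v j) a * D j) \<le> (1/2) ^ k"
      using truncation_level[OF v0 D sum[folded v_def], of "(1/2) ^ k"] by auto
  qed
  from choice[OF this] obtain a where a: "\<And>k. 0 < a k" "\<And>k. a k \<le> (1/2) ^ k" "\<And>k. (\<Sum>j. min (v j) (a k) * D j) \<le> (1/2) ^ k"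
    by blast
  have geo: "summable (\<lambda>k. (1/2::real) ^ k)" by (simp add: summable_geometric)
  define hr where "hr r = (\<Sum>k. min (f r) (a k))" for r
  have sa: "summable a" by (rule summable_comparison_test'[OF geo, of 0]) (use a less_imp_le in \<open>auto simp: abs_of_pos\<close>)
  have sm: "summable (\<lambda>k. min (f r) (a k))" if "0 < r" "r \<le> \<epsilon>" for r
    by (rule summable_comparison_test'[OF sa, of 0]) (use f0[OF that] a(1) in \<open>auto simp: abs_of_pos\<close>)
  have t0: "0 < min (f r) (a k)" if "0 < r" "r \<le> \<epsilon>" for r k using f0[OF that] a(1)[of k] by simp
  have hr0: "0 < hr r" if "0 < r" "r \<le> \<epsilon>" for r unfolding hr_def using sm[OF that] t0[OF that] by (intro suminf_pos)
  have ratio: "hr s / f s \<le> hr r / f r" if "0 < r" "r \<le> s" "s \<le> \<epsilon>" for r s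
  proof -
    have fs: "0 < f r" "f r \<le> f s" using regularD[OF reg that] by auto
    have "hr s / f s = (\<Sum>k. min (f s) (a k) / f s)" unfolding hr_def using sm[of s] that by (intro suminf_divide[symmetric]) auto
    also have "\<dots> \<le> (\<Sum>k. min (f r) (a k) / f r)"
      using sm[of r] sm[of s] that fs a(1) by (intro suminf_le min_ratio_antimono summable_divide) auto
    also have "\<dots> = hr r / f r" unfolding hr_def using sm[of r] that by (intro suminf_divide) auto
    finally show ?thesis .
  qed
  have reghr: "regular d \<epsilon> hr"
    unfolding regular_def
  proof (intro conjI allI impI eps)
    fix r s assume rs: "0 < r \<and> r \<le> s \<and> s \<le> \<epsilon>"
    show "0 < hr r" using hr0 rs by simp
    have fs: "0 < f r" "f r \<le> f s" "f s / s ^ d \<le> f r / r ^ d" using regularD[OF reg] rs by auto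
    show "hr r \<le> hr s" unfolding hr_def using sm[of r] sm[of s] rs fs by (intro suminf_le) auto
    have "hr s / s ^ d = (hr s / f s) * (f s / s ^ d)" using fs by simp
    also have "\<dots> \<le> (hr r / f r) * (f r / r ^ d)"
      using ratio[of r s] fs rs hr0[of r] by (intro mult_mono) auto
    also have "\<dots> = hr r / r ^ d" using fs by simp
    finally show "hr s / s ^ d \<le> hr r / r ^ d" .
  qed
  have hrlim: "(hr \<longlongrightarrow> 0) (at_right 0)"
  proof (rule tendstoI)
    fix e :: real assume e: "e > 0"
    obtain n where n: "\<And>m. m \<ge> n \<Longrightarrow> norm (\<Sum>i. a (i + m)) < e / 2"
      using suminf_exist_split[of "e / 2" a] sa e by auto
    have "\<forall>\<^sub>F r in at_right 0. f r < e / 2 / (real n + 1)" using e by (intro order_tendstoD(2)[OF flim]) auto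
    moreover have "\<forall>\<^sub>F r in at_right 0. 0 < r \<and> r \<le> \<epsilon>"
      unfolding eventually_at_right_field using eps by (intro exI[of _ \<epsilon>]) auto
    ultimately show "\<forall>\<^sub>F r in at_right 0. dist (hr r) 0 < e"
    proof eventually_elim
      case (elim r)
      have "hr r = (\<Sum>k. min (f r) (a (k + n))) + (\<Sum>k<n. min (f r) (a k))"
        unfolding hr_def using sm elim by (intro suminf_split_initial_segment) auto
      also have "(\<Sum>k. min (f r) (a (k + n))) \<le> (\<Sum>k. a (k + n))"
        using sm[of r] elim sa by (intro suminf_le) (auto intro: summable_ignore_initial_segment[of a] summable_ignore_initial_segment[of "\<lambda>k. min (f r) (a k)"])
      also have "\<dots> < e / 2" using n[of n] by simp
      also have "(\<Sum>k<n. min (f r) (a k)) \<le> (\<Sum>k<n. f r)" by (intro sum_mono) auto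
      also have "\<dots> = real n * f r" by simp
      also have "\<dots> \<le> (real n + 1) * f r" using f0[of r] elim by (intro mult_right_mono) auto
      also have "\<dots> < e / 2" using elim by (simp add: field_simps)
      finally have "hr r < e" by simp
      then show ?case using hr0[of r] elim by simp
    qed
  qed
  \<comment> \<open>Where \<open>f r\<close> lies below \<open>a 0, ..., a (n - 1)\<close>, the
    first \<open>n\<close> summands of \<open>hr r\<close> all equal \<open>f r\<close>.\<close>
  have hrbig: "\<exists>\<delta>>0. \<forall>r. 0 < r \<and> r < \<delta> \<longrightarrow> real n \<le> hr r / f r" for n
  proof -
    define A where "A = Min (insert 1 (a ` {..<n}))"
    have A: "A > 0" "\<And>k. k < n \<Longrightarrow> A \<le> a k" using a(1) by (auto simp: A_def)
    have "\<forall>\<^sub>F r in at_right 0. f r < A" using A(1) by (intro order_tendstoD(2)[OF flim]) auto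
    then obtain \<delta> where \<delta>: "\<delta> > 0" "\<And>r. 0 < r \<Longrightarrow> r < \<delta> \<Longrightarrow> f r < A"
      unfolding eventually_at_right_field by blast
    have "real n \<le> hr r / f r" if r: "0 < r" "r < min \<delta> \<epsilon>" for r
    proof -
      have fr: "0 < f r" "f r < A" using f0[of r] \<delta>(2)[of r] r by auto
      have "real n * f r = (\<Sum>k<n. f r)" by simp
      also have "\<dots> = (\<Sum>k<n. min (f r) (a k))" using A(2) fr by (intro sum.cong) (auto simp: min_def intro: order_trans[OF less_imp_le])
      also have "\<dots> \<le> hr r" unfolding hr_def using sm[of r] t0[of r] r by (intro sum_le_suminf) (auto intro: less_imp_le)
      finally show ?thesis using fr by (simp add: pos_le_divide_eq)
    qed
    then show ?thesis using \<delta>(1) eps by (intro exI[of _ "min \<delta> \<epsilon>"]) auto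
  qed
  \<comment> \<open>Beyond \<open>\<epsilon>\<close> the gauge is held constant; the value at
    infinity is imposed by \<open>gauge_fun\<close>.\<close>
  define h where "h x = (if x = \<infinity> then \<infinity> else if x = 0 then 0 else ennreal (hr (min (enn2real x) \<epsilon>)))" for x
  have hh: "h (ennreal r) = ennreal (hr r)" if "0 < r" "r \<le> \<epsilon>" for r using that by (simp add: h_def min_def)
  have mono: "mono_on {0..ennreal \<epsilon>} h"
  proof (rule mono_onI)
    fix x y assume xy: "x \<in> {0..ennreal \<epsilon>}" "y \<in> {0..ennreal \<epsilon>}" "x \<le> y"
    show "h x \<le> h y"
    proof (cases "x = 0")
      case True then show ?thesis by (simp add: h_def)
    next
      case False
      obtain s where s: "y = ennreal s" "0 < s" "s \<le> \<epsilon>"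
        using ennreal_le_realE[of y \<epsilon>] xy False by (metis atLeastAtMost_iff not_gr_zero le_zero_eq)
      obtain r where r: "x = ennreal r" "0 < r" "r \<le> s"
        using ennreal_le_realE[of x s] xy False s(1) by (metis not_gr_zero)
      show ?thesis using regularD(2)[OF reghr r(2,3) s(3)] hh[of r] hh[of s] r s by (simp add: ennreal_leI)
    qed
  qed
  have quot: "h s / s ^ d \<le> h r / r ^ d" if rs: "0 < r" "r \<le> s" "s \<le> ennreal \<epsilon>" for r s
  proof -
    obtain s' where s: "s = ennreal s'" "0 < s'" "s' \<le> \<epsilon>"
      proof -
        have "0 < s" "s \<le> ennreal \<epsilon>" using rs by auto
        then show ?thesis using ennreal_le_realE that by blast
      qed
    obtain r' where r: "r = ennreal r'" "0 < r'" "r' \<le> s'"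
      proof -
        have "0 < r" "r \<le> ennreal s'" using rs s(1) by auto
        then show ?thesis using ennreal_le_realE that by blast
      qed
    have "hr s' / s' ^ d \<le> hr r' / r' ^ d" using regularD(3)[OF reghr r(2,3) s(3)] .
    then show ?thesis using hh[of r'] hh[of s'] r s hr0[of r'] hr0[of s']
      by (simp add: ennreal_power divide_ennreal ennreal_leI)
  qed
  have gauge: "gauge_fun h"
    unfolding gauge_fun_def
  proof (intro conjI)
    show "\<exists>\<epsilon>>0. mono_on {0..\<epsilon>} h" using mono eps by (intro exI[of _ "ennreal \<epsilon>"]) auto
    show "h 0 = 0" "h \<infinity> = \<infinity>" by (auto simp: h_def)
    show "(h \<longlongrightarrow> 0) (at_right 0)"
    proof (rule order_tendstoI)
      fix y :: ennreal assume "0 < y"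
      then obtain z where z: "0 < z" "z < y" using dense by blast
      then have "z < top" using order_less_le_trans top_greatest by blast
      then have zr: "z = ennreal (enn2real z)" "0 < enn2real z" using z by (auto simp: enn2real_positive_iff)
      have "\<forall>\<^sub>F r in at_right 0. hr r < enn2real z" using zr(2) by (intro order_tendstoD(2)[OF hrlim]) auto
      then obtain \<delta> where \<delta>: "\<delta> > 0" "\<And>r. 0 < r \<Longrightarrow> r < \<delta> \<Longrightarrow> hr r < enn2real z"
        unfolding eventually_at_right_field by blast
      show "\<forall>\<^sub>F x in at_right 0. h x < y"
      proof (rule eventually_at_right_ennrealI[of "min \<delta> \<epsilon>"])
        fix s assume s: "0 < s" "s < min \<delta> \<epsilon>"
        have "h (ennreal s) \<le> z" using hh[of s] \<delta>(2)[of s] s zr(1) by (metis ennreal_leI less_imp_le min_less_iff_conj)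
        then show "h (ennreal s) < y" using z(2) by order
      qed (use \<delta>(1) eps in auto)
    qed simp
  qed
  have norm: "d_normalized d h"
    unfolding d_normalized_def
  proof (intro exI[of _ "ennreal \<epsilon>"] conjI allI impI)
    fix r assume r: "r < ennreal \<epsilon>"
    show "h r = dnorm d h r"
    proof (cases "r = 0")
      case True then show ?thesis by (simp add: h_def dnorm_def)
    next
      case False
      then have rp: "0 < r" by (simp add: zero_less_iff_neq_zero)
      have rt: "r \<noteq> \<infinity>" using r by auto
      have "(INF \<rho>\<in>{0<..r}. h \<rho> / \<rho> ^ d) = h r / r ^ d"
      proof (rule antisym)
        show "(INF \<rho>\<in>{0<..r}. h \<rho> / \<rho> ^ d) \<le> h r / r ^ d" using rp by (intro INF_lower) auto
        show "h r / r ^ d \<le> (INF \<rho>\<in>{0<..r}. h \<rho> / \<rho> ^ d)" using quot r by (intro INF_greatest) auto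
      qed
      moreover have "r ^ d \<noteq> 0" "r ^ d \<noteq> top" using False rt by (auto simp: power_eq_top_ennreal)
      moreover have "r ^ d * (h r / r ^ d) = h r"
        using calculation(2,3) mult_divide_eq_ennreal[of "r ^ d" "h r"] by (simp add: ennreal_times_divide mult.commute)
      ultimately show ?thesis using False rt by (simp add: dnorm_def)
    qed
  qed (use eps in auto)
  have prec: "gauge_prec h (dnorm d g)"
    unfolding gauge_prec_def
  proof (intro disjI2 conjI)
    show "\<exists>\<epsilon>>0. \<forall>r s. 0 < r \<and> r \<le> s \<and> s < \<epsilon> \<longrightarrow> h s / dnorm d g s \<le> h r / dnorm d g r"
    proof (intro exI[of _ "ennreal \<epsilon>"] conjI allI impI)
      fix r s assume rs: "0 < r \<and> r \<le> s \<and> s < ennreal \<epsilon>"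
      obtain s' where s: "s = ennreal s'" "0 < s'" "s' \<le> \<epsilon>"
      proof -
        have "0 < s" "s \<le> ennreal \<epsilon>" using rs by auto
        then show ?thesis using ennreal_le_realE that by blast
      qed
      obtain r' where r: "r = ennreal r'" "0 < r'" "r' \<le> s'"
      proof -
        have "0 < r" "r \<le> ennreal s'" using rs s(1) by auto
        then show ?thesis using ennreal_le_realE that by blast
      qed
      show "h s / dnorm d g s \<le> h r / dnorm d g r"
        using ratio[OF r(2,3) s(3)] hh[of r'] hh[of s'] dn[of r'] dn[of s'] r s hr0[of r'] hr0[of s'] f0[of r'] f0[of s']
        by (simp add: divide_ennreal ennreal_leI)
    qed (use eps in auto)
    show "((\<lambda>r. h r / dnorm d g r) \<longlongrightarrow> \<infinity>) (at_right 0)"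
      unfolding infinity_ennreal_def tendsto_top_iff_ennreal
    proof (intro allI impI)
      fix l :: real assume "0 \<le> l"
      obtain n :: nat where n: "l < real n" using reals_Archimedean2 by blast
      obtain \<delta> where \<delta>: "\<delta> > 0" "\<And>r. 0 < r \<Longrightarrow> r < \<delta> \<Longrightarrow> real n \<le> hr r / f r" using hrbig by blast
      show "\<forall>\<^sub>F r in at_right 0. ennreal l < h r / dnorm d g r"
      proof (rule eventually_at_right_ennrealI[of "min \<delta> \<epsilon>"])
        fix s assume s: "0 < s" "s < min \<delta> \<epsilon>"
        have "l < hr s / f s" using \<delta>(2)[of s] n s by simp
        then have "ennreal l < ennreal (hr s / f s)" using \<open>0 \<le> l\<close> by (simp add: ennreal_less_iff)
        then show "ennreal l < h (ennreal s) / dnorm d g (ennreal s)"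
          using hh[of s] dn[of s] hr0[of s] f0[of s] s by (simp add: divide_ennreal)
      qed (use \<delta>(1) eps in auto)
    qed
  qed
  \<comment> \<open>Exchanging the two summations leaves the bounds \<open>(1/2) ^ k\<close>, which
    add up to 2.\<close>
  have "summable (\<lambda>j. hr (min (b j) \<epsilon>) * D j)"
  proof (rule bounded_imp_summable[where B = 2])
    have mb: "0 < min (b j) \<epsilon>" "min (b j) \<epsilon> \<le> \<epsilon>" for j using b[of j] eps by auto
    show "0 \<le> hr (min (b j) \<epsilon>) * D j" for j using hr0[OF mb, of j] D[of j] by simp
    fix n
    have sk: "summable (\<lambda>k. min (v j) (a k) * D j)" for j unfolding v_def using sm[OF mb] by (rule summable_mult2)
    have "(\<Sum>j\<le>n. hr (min (b j) \<epsilon>) * D j) = (\<Sum>j\<le>n. \<Sum>k. min (v j) (a k) * D j)"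
      unfolding hr_def v_def using sm[OF mb] by (intro sum.cong refl suminf_mult2) auto
    also have "\<dots> = (\<Sum>k. \<Sum>j\<le>n. min (v j) (a k) * D j)" using sk by (intro suminf_sum[symmetric]) auto
    also have "\<dots> \<le> (\<Sum>k. (1/2) ^ k)"
    proof (rule suminf_le)
      fix k
      have t0: "0 \<le> min (v j) (a k) * D j" for j using v0[of j] a(1)[of k] D[of j] by simp
      have sj: "summable (\<lambda>j. min (v j) (a k) * D j)"
        using t0 D v0 by (intro summable_comparison_test'[OF sum[folded v_def], of 0]) (auto intro!: mult_right_mono less_imp_le)
      have "(\<Sum>j\<le>n. min (v j) (a k) * D j) \<le> (\<Sum>j. min (v j) (a k) * D j)" using t0 sj by (intro sum_le_suminf) auto
      then show "(\<Sum>j\<le>n. min (v j) (a k) * D j) \<le> (1/2) ^ k" using a(3)[of k] by linarith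
    qed (use geo sk in \<open>auto intro!: summable_sum\<close>)
    also have "\<dots> = 2" by (simp add: suminf_geometric)
    finally show "(\<Sum>j\<le>n. hr (min (b j) \<epsilon>) * D j) \<le> 2" .
  qed
  moreover have "ennreal \<epsilon> \<le> eps_h d h"
    unfolding eps_h_def using eps mono quot by (intro Sup_upper) auto
  ultimately show ?thesis using that gauge norm prec reghr hh by blast
qed

section \<open>The intensity of the radii\<close>

locale radius_measure =
  fixes \<nu> :: "real measure" and d :: nat
  assumes \<nu>: "\<nu> \<in> Rcls" and d: "0 < d"
begin

text \<open>The number of cubes of level \<open>j\<close> per unit of volume, that is
  \<open>(16 ^ d) ^ j\<close>.\<close>

definition q :: "nat \<Rightarrow> real" where "q j = 1 / cvol d (4 * int j)"

text \<open>A generalized inverse of the tail of \<open>\<nu>\<close> at the value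
  \<open>4 * q j\<close>. If \<open>\<nu>\<close> has an atom at \<open>b j\<close>, the closed tail
  may be much larger than \<open>4 * q j\<close> and the open tail much smaller. This is why
  occupied cubes are sought among radii at least \<open>b j\<close>, whereas upper counts concern
  radii strictly above \<open>b j\<close>.\<close>

definition b :: "nat \<Rightarrow> real" where
  "b j = Sup {a \<in> {0<..1}. ennreal (4 * q j) \<le> emeasure \<nu> {a..1}}"

lemma q_power: "q j = (16 ^ d) ^ j"
proof -
  have "q j = 2 powr (real (4 * d * j))" by (simp add: q_def powr_minus divide_inverse mult.commute mult.left_commute)
  also have "\<dots> = 2 ^ (4 * d * j)" by (rule powr_realpow) simp
  also have "\<dots> = (16 ^ d) ^ j" by (simp add: power_mult)
  finally show ?thesis .
qed

lemma q_pos: "0 < q j" by (simp add: q_power)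

lemma q_Suc: "16 * q j \<le> q (Suc j)"
proof -
  have "(16::real) ^ 1 \<le> 16 ^ d" using d by (intro power_increasing) auto
  then show ?thesis by (simp add: q_power mult_right_mono)
qed

lemma q_ge: "real j \<le> q j"
proof -
  have "(2::real) ^ 1 \<le> 16 ^ d" using d power_increasing[of 1 d "16::real"] by simp
  then have "2 ^ j \<le> q j" unfolding q_power by (intro power_mono) auto
  then show ?thesis using of_nat_less_two_power[of j, where 'a = real] by linarith
qed

lemma space_\<nu>: "space \<nu> = {0<..1}" and sets_\<nu>: "sets \<nu> = sets (restrict_space borel {0<..1})"
  and infinite_\<nu>: "emeasure \<nu> {0<..1} = \<infinity>" and finite_\<nu>: "0 < a \<Longrightarrow> emeasure \<nu> {a..1} < \<infinity>"
proof -
  show s: "sets \<nu> = sets (restrict_space borel {0<..1})" using \<nu> by (simp add: Rcls_def)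
  have "space \<nu> = space (restrict_space borel {0<..1::real})" using s by (rule sets_eq_imp_space_eq)
  then show sp: "space \<nu> = {0<..1}" by (simp add: space_restrict_space)
  show "emeasure \<nu> {0<..1} = \<infinity>" using \<nu> sp by (simp add: Rcls_def)
  show "emeasure \<nu> {a..1} < \<infinity>" if "0 < a"
    using \<nu> that by (cases "a \<le> 1") (auto simp: Rcls_def)
qed

lemma in_sets_\<nu>: "A \<in> sets borel \<Longrightarrow> A \<subseteq> {0<..1} \<Longrightarrow> A \<in> sets \<nu>"
  by (simp add: sets_\<nu> sets_restrict_space_iff)

lemma mono_measurable_\<nu>:
  assumes "mono_on {0<..1} w"
  shows "(w :: real \<Rightarrow> real) \<in> borel_measurable \<nu>"
  using borel_measurable_mono_on_fnc[OF assms] measurable_cong_sets[OF sets_\<nu> refl] by blast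

lemma level_set_nonempty: "\<exists>a\<in>{0<..1}. ennreal (4 * q j) \<le> emeasure \<nu> {a..1}"
proof -
  define A where "A n = {1 / (real n + 1)..1::real}" for n
  have Apos: "0 < 1 / (real n + 1)" for n by simp
  have inc: "incseq A" by (intro incseq_SucI) (auto simp: A_def field_simps intro: order_trans[rotated])
  have "(\<Union>n. A n) = {0<..1}"
  proof
    show "(\<Union>n. A n) \<subseteq> {0<..1}" unfolding A_def using less_le_trans[OF Apos] by auto
    show "{0<..1} \<subseteq> (\<Union>n. A n)"
    proof
      fix x :: real assume x: "x \<in> {0<..1}"
      obtain n where "1 / real (Suc n) < x" using nat_approx_posE[of x] x by auto
      then have "x \<in> A n" using x by (auto simp: A_def add.commute)
      then show "x \<in> (\<Union>n. A n)" by blast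
    qed
  qed
  moreover have "(SUP n. emeasure \<nu> (A n)) = emeasure \<nu> (\<Union>n. A n)"
  proof (intro SUP_emeasure_incseq inc)
    have "A n \<in> sets \<nu>" for n unfolding A_def using less_le_trans[OF Apos] by (intro in_sets_\<nu>) auto
    then show "range A \<subseteq> sets \<nu>" by blast
  qed
  ultimately have "(SUP n. emeasure \<nu> (A n)) = \<infinity>" using infinite_\<nu> by simp
  then have "ennreal (4 * q j) < (SUP n. emeasure \<nu> (A n))" by (metis ennreal_less_top infinity_ennreal_def)
  then obtain n where "ennreal (4 * q j) < emeasure \<nu> (A n)" unfolding less_SUP_iff by blast
  then show ?thesis by (intro bexI[of _ "1 / (real n + 1)"]) (auto simp: A_def)
qed

lemma b_bounds: "0 < b j" "b j \<le> 1"
proof -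
  let ?L = "{a \<in> {0<..1}. ennreal (4 * q j) \<le> emeasure \<nu> {a..1}}"
  obtain a where a: "a \<in> ?L" using level_set_nonempty by blast
  have "bdd_above ?L" by (rule bdd_aboveI[of _ 1]) auto
  then have "a \<le> b j" unfolding b_def using a by (intro cSup_upper)
  then show "0 < b j" using a by auto
  show "b j \<le> 1" unfolding b_def using a by (intro cSup_least) auto
qed

text \<open>The supremum is attained, by continuity from above along intervals that start slightly
  below \<open>b j\<close>.\<close>

lemma emeasure_ge_b: "ennreal (4 * q j) \<le> emeasure \<nu> {b j..1}"
proof -
  let ?L = "{a \<in> {0<..1}. ennreal (4 * q j) \<le> emeasure \<nu> {a..1}}"
  \<comment> \<open>The denominator \<open>n + 2\<close> keeps the left end positive already for
    \<open>n = 0\<close>, so that all these tails are finite.\<close>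
  define A where "A n = {b j - b j / (real n + 2)..1}" for n
  have pos: "0 < b j - b j / (real n + 2)" for n using b_bounds[of j] by (simp add: field_simps add_pos_nonneg)
  have "ennreal (4 * q j) \<le> emeasure \<nu> (A n)" for n
  proof -
    have "b j - b j / (real n + 2) < b j" using b_bounds[of j] by simp
    then obtain a where a: "a \<in> ?L" "b j - b j / (real n + 2) < a"
      using less_cSupD[of ?L] level_set_nonempty unfolding b_def by blast
    have "emeasure \<nu> {a..1} \<le> emeasure \<nu> (A n)"
      using a pos[of n] by (intro emeasure_mono in_sets_\<nu>) (auto simp: A_def)
    then show ?thesis using a by (auto intro: order_trans)
  qed
  then have "ennreal (4 * q j) \<le> (INF n. emeasure \<nu> (A n))" by (intro INF_greatest)
  also have "\<dots> = emeasure \<nu> (\<Inter>n. A n)"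
  proof (rule INF_emeasure_decseq)
    have "A n \<in> sets \<nu>" for n unfolding A_def using less_le_trans[OF pos] by (intro in_sets_\<nu>) auto
    then show "range A \<subseteq> sets \<nu>" by blast
    show "decseq A" unfolding decseq_Suc_iff A_def using b_bounds[of j] by (auto simp: field_simps intro: order_trans)
    show "emeasure \<nu> (A i) \<noteq> \<infinity>" for i using finite_\<nu>[OF pos[of i]] by (auto simp: A_def)
  qed
  also have "(\<Inter>n. A n) = {b j..1}"
  proof
    have "b j - b j / (real n + 2) \<le> b j" for n using b_bounds[of j] by simp
    from order_trans[OF this] show "{b j..1} \<subseteq> (\<Inter>n. A n)" unfolding A_def by auto
    show "(\<Inter>n. A n) \<subseteq> {b j..1}"
    proof
      fix x assume x: "x \<in> (\<Inter>n. A n)"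
      have "b j \<le> x + e" if e: "e > 0" for e
      proof -
        obtain n where "1 / real (Suc n) < e" using nat_approx_posE[OF e] by blast
        moreover have "b j / (real n + 2) \<le> 1 / real (Suc n)" using b_bounds[of j] by (intro frac_le) auto
        moreover have "b j - b j / (real n + 2) \<le> x" using x by (auto simp: A_def)
        ultimately show ?thesis by linarith
      qed
      then have "b j \<le> x" by (rule field_le_epsilon)
      moreover have "x \<le> 1" using x by (auto simp: A_def)
      ultimately show "x \<in> {b j..1}" by simp
    qed
  qed
  finally show ?thesis .
qed

text \<open>Every interval that starts strictly above \<open>b j\<close> stays below the threshold
  because \<open>b j\<close> is a supremum; continuity from below passes to the open tail.\<close>

lemma emeasure_gt_b: "emeasure \<nu> {b j<..1} \<le> ennreal (4 * q j)"
proof -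
  define A where "A n = {b j + 1 / real (Suc n)..1}" for n
  have pos: "0 < b j + 1 / real (Suc n)" for n using b_bounds[of j] by (intro add_pos_pos) auto
  have "(\<Union>n. A n) = {b j<..1}"
  proof
    have "b j < b j + 1 / real (Suc n)" for n by simp
    from less_le_trans[OF this] show "(\<Union>n. A n) \<subseteq> {b j<..1}" unfolding A_def by auto
    show "{b j<..1} \<subseteq> (\<Union>n. A n)"
    proof
      fix x assume x: "x \<in> {b j<..1}"
      obtain n where "1 / real (Suc n) < x - b j" using nat_approx_posE[of "x - b j"] x by auto
      then have "x \<in> A n" using x by (auto simp: A_def)
      then show "x \<in> (\<Union>n. A n)" by blast
    qed
  qed
  then have "emeasure \<nu> {b j<..1} = emeasure \<nu> (\<Union>n. A n)" by simp
  also have "\<dots> = (SUP n. emeasure \<nu> (A n))"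
  proof (rule SUP_emeasure_incseq[symmetric])
    have "A n \<in> sets \<nu>" for n unfolding A_def using less_le_trans[OF pos] by (intro in_sets_\<nu>) auto
    then show "range A \<subseteq> sets \<nu>" by blast
    show "incseq A"
    proof (rule incseq_SucI)
      fix n
      have "1 / real (Suc (Suc n)) \<le> 1 / real (Suc n)" by (intro frac_le) auto
      then show "A n \<le> A (Suc n)" unfolding A_def by auto
    qed
  qed
  also have "\<dots> \<le> ennreal (4 * q j)"
  proof (rule SUP_least)
    fix n
    let ?a = "b j + 1 / real (Suc n)"
    show "emeasure \<nu> (A n) \<le> ennreal (4 * q j)"
    proof (rule ccontr)
      assume neg: "\<not> ?thesis"
      then have "A n \<noteq> {}" by auto
      then have "?a \<le> 1" unfolding A_def by simp
      then have "?a \<in> {a \<in> {0<..1}. ennreal (4 * q j) \<le> emeasure \<nu> {a..1}}"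
        using neg pos[of n] by (auto simp: A_def)
      then have "?a \<le> b j" unfolding b_def by (intro cSup_upper) (auto intro: bdd_aboveI[of _ 1])
      then show False by simp
    qed
  qed
  finally show ?thesis .
qed

lemma decseq_b: "decseq b"
proof (rule decseq_SucI)
  fix j
  have le: "ennreal (4 * q j) \<le> ennreal (4 * q (Suc j))" using q_Suc[of j] q_pos[of j] by (intro ennreal_leI) simp
  show "b (Suc j) \<le> b j"
    unfolding b_def
  proof (rule cSup_subset_mono)
    show "{a \<in> {0<..1}. ennreal (4 * q (Suc j)) \<le> emeasure \<nu> {a..1}} \<noteq> {}" using level_set_nonempty by blast
    show "{a \<in> {0<..1}. ennreal (4 * q (Suc j)) \<le> emeasure \<nu> {a..1}} \<subseteq> {a \<in> {0<..1}. ennreal (4 * q j) \<le> emeasure \<nu> {a..1}}"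
      using le order_trans by blast
  qed (rule bdd_aboveI[of _ 1], auto)
qed

lemma b_tendsto_0: "b \<longlonglongrightarrow> 0"
proof (rule tendstoI)
  fix e :: real assume e: "e > 0"
  define m where "m = enn2real (emeasure \<nu> {min e 1..1})"
  have m: "emeasure \<nu> {min e 1..1} = ennreal m" using finite_\<nu>[of "min e 1"] e by (simp add: m_def)
  obtain j0 :: nat where j0: "m < real j0" using reals_Archimedean2 by blast
  have "b j < e" if "j \<ge> j0" for j
  proof (rule ccontr)
    assume "\<not> b j < e"
    then have "emeasure \<nu> {b j..1} \<le> emeasure \<nu> {min e 1..1}"
      using e b_bounds[of j] by (intro emeasure_mono in_sets_\<nu>) auto
    then have "ennreal (4 * q j) \<le> ennreal m" using emeasure_ge_b[of j] m by simp
    then have "4 * q j \<le> m" using q_pos[of j] by (subst (asm) ennreal_le_iff2) auto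
    then show False using q_ge[of j] that j0 q_pos[of j] by simp
  qed
  then show "\<forall>\<^sub>F j in sequentially. dist (b j) 0 < e"
    using b_bounds(1) unfolding eventually_sequentially by (intro exI[of _ j0]) (auto simp: dist_real_def abs_of_pos)
qed

text \<open>On the shell from \<open>b (Suc j)\<close> to \<open>b j\<close> the function is at most
  \<open>w (b j)\<close>, and the mass of the shell is at most \<open>4 * q (Suc j)\<close>, that is
  \<open>4 * 16 ^ d * q j\<close>.\<close>

lemma integral_finite_if_summable:
  assumes w: "mono_on {0<..1} w" "\<And>r. 0 < r \<Longrightarrow> r \<le> 1 \<Longrightarrow> 0 \<le> w r" and sum: "summable (\<lambda>j. w (b j) * q j)"
  shows "(\<integral>\<^sup>+ r. ennreal (w r) \<partial>\<nu>) < \<infinity>"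
proof -
  have wb: "0 \<le> w (b j)" for j using w(2) b_bounds by blast
  have sets: "{b j<..1} \<in> sets \<nu>" for j using b_bounds[of j] by (intro in_sets_\<nu>) auto
  have "(\<integral>\<^sup>+ r. ennreal (w r) \<partial>\<nu>) \<le> (\<integral>\<^sup>+ r. ennreal (w 1) * indicator {b 0<..1} r + (\<Sum>j. ennreal (w (b j)) * indicator {b (Suc j)<..1} r) \<partial>\<nu>)"
  proof (rule nn_integral_mono)
    fix r assume "r \<in> space \<nu>"
    then have r: "0 < r" "r \<le> 1" by (auto simp: space_\<nu>)
    show "ennreal (w r) \<le> ennreal (w 1) * indicator {b 0<..1} r + (\<Sum>j. ennreal (w (b j)) * indicator {b (Suc j)<..1} r)"
    proof (cases "b 0 < r")
      case True
      have "w r \<le> w 1" using r by (intro mono_onD[OF w(1)]) auto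
      then have "ennreal (w r) \<le> ennreal (w 1) * indicator {b 0<..1} r" using True r by (simp add: ennreal_leI)
      then show ?thesis by (rule order_trans) simp
    next
      case False
      have "\<forall>\<^sub>F j in sequentially. b j < r" using r by (intro order_tendstoD(2)[OF b_tendsto_0])
      then obtain j1 where ex: "b j1 < r" unfolding eventually_sequentially by blast
      define k where "k = (LEAST k. b k < r)"
      have k: "b k < r" unfolding k_def using ex by (rule LeastI)
      have "k \<noteq> 0" using k False by (intro notI) simp
      then obtain k' where k': "k = Suc k'" using not0_implies_Suc by blast
      have "\<not> b k' < r" using not_less_Least[of k' "\<lambda>k. b k < r"] k' by (simp add: k_def)
      then have "w r \<le> w (b k')" using r b_bounds[of k'] by (intro mono_onD[OF w(1)]) auto
      then have "ennreal (w r) \<le> ennreal (w (b k')) * indicator {b (Suc k')<..1} r" using k k' r by (simp add: ennreal_leI)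
      also have "\<dots> \<le> (\<Sum>j. ennreal (w (b j)) * indicator {b (Suc j)<..1} r)"
      proof -
        define F where "F j = ennreal (w (b j)) * indicator {b (Suc j)<..1} r" for j
        have "sum F {k'} \<le> suminf F" by (intro sum_le_suminf) auto
        moreover have "sum F {k'} = F k'" by simp
        ultimately show ?thesis unfolding F_def[symmetric] F_def[abs_def, symmetric] by argo
      qed
      finally show ?thesis by (rule order_trans) simp
    qed
  qed
  also have "\<dots> = ennreal (w 1) * emeasure \<nu> {b 0<..1} + (\<Sum>j. ennreal (w (b j)) * emeasure \<nu> {b (Suc j)<..1})"
    using sets by (simp add: nn_integral_add nn_integral_suminf nn_integral_cmult)
  also have "\<dots> \<le> ennreal (w 1) * ennreal (4 * q 0) + (\<Sum>j. ennreal (w (b j)) * ennreal (4 * q (Suc j)))"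
    using emeasure_gt_b by (intro add_mono suminf_le mult_left_mono) auto
  also have "(\<Sum>j. ennreal (w (b j)) * ennreal (4 * q (Suc j))) = (\<Sum>j. ennreal (4 * 16 ^ d * (w (b j) * q j)))"
  proof (intro suminf_cong)
    fix j
    have "4 * 16 ^ d * (w (b j) * q j) = w (b j) * (4 * q (Suc j))" by (simp add: q_power)
    moreover have "ennreal (w (b j)) * ennreal (4 * q (Suc j)) = ennreal (w (b j) * (4 * q (Suc j)))"
      using wb[of j] q_pos[of "Suc j"] by (intro ennreal_mult[symmetric]) auto
    ultimately show "ennreal (w (b j)) * ennreal (4 * q (Suc j)) = ennreal (4 * 16 ^ d * (w (b j) * q j))" by metis
  qed
  also have "\<dots> = ennreal (\<Sum>j. 4 * 16 ^ d * (w (b j) * q j))"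
  proof (rule suminf_ennreal2[OF _ summable_mult[OF sum]])
    show "0 \<le> 4 * 16 ^ d * (w (b j) * q j)" for j using wb[of j] q_pos[of j] by simp
  qed
  finally show ?thesis by (rule order_le_less_trans) (simp add: ennreal_mult_less_top)
qed

text \<open>Summation by parts against the tail \<open>T n\<close> of \<open>\<nu>\<close> at \<open>b n\<close>: since \<open>T n \<ge> 4 * q n \<ge> E n\<close>, the
  term \<open>w (b n) * (T n - E n)\<close> kept in the induction below is nonnegative.\<close>

lemma summable_if_integral_finite:
  assumes w: "mono_on {0<..1} w" "\<And>r. 0 < r \<Longrightarrow> r \<le> 1 \<Longrightarrow> 0 \<le> w r" and fin: "(\<integral>\<^sup>+ r. ennreal (w r) \<partial>\<nu>) < \<infinity>"
  shows "summable (\<lambda>j. w (b j) * q j)"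
proof -
  have wb: "0 \<le> w (b j)" for j using w(2) b_bounds by blast
  have [measurable]: "(w :: real \<Rightarrow> real) \<in> borel_measurable \<nu>" using w(1) by (rule mono_measurable_\<nu>)
  define T where "T j = enn2real (emeasure \<nu> {b j..1})" for j
  have T: "emeasure \<nu> {b j..1} = ennreal (T j)" for j using finite_\<nu>[OF b_bounds(1)] by (simp add: T_def)
  have T4: "4 * q j \<le> T j" for j using emeasure_ge_b[of j] q_pos[of j] unfolding T
    by (subst (asm) ennreal_le_iff2) auto
  \<comment> \<open>Twice the partial sums of \<open>q\<close>; since \<open>q\<close> grows by a
    factor of at least 16 per step, they stay below \<open>3 * q j\<close>, hence below
    \<open>T j\<close>.\<close>
  define E where "E j = 2 * (\<Sum>i\<le>j. q i)" for j
  have E3: "E j \<le> 3 * q j" for j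
  proof (induction j)
    case 0 show ?case using q_pos[of 0] by (simp add: E_def)
  next
    case (Suc j)
    then show ?case using q_Suc[of j] q_pos[of j] by (simp add: E_def)
  qed
  define G where "G n = (\<integral>\<^sup>+ r. ennreal (w r) * indicator {b n..1} r \<partial>\<nu>)" for n
  have sets: "{b j..1} \<in> sets \<nu>" "{b (Suc j)..<b j} \<in> sets \<nu>" for j
    using b_bounds[of j] b_bounds[of "Suc j"] by (auto intro!: in_sets_\<nu>)
  have bd: "b (Suc j) \<le> b j" for j using decseq_b by (simp add: decseq_Suc_iff)
  have main: "ennreal (2 * (\<Sum>j\<le>n. w (b j) * q j) + w (b n) * (T n - E n)) \<le> G n" for n
  proof (induction n)
    case 0
    have "ennreal (2 * (\<Sum>j\<le>0. w (b j) * q j) + w (b 0) * (T 0 - E 0)) = ennreal (w (b 0)) * emeasure \<nu> {b 0..1}"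
    proof -
      have "2 * (\<Sum>j\<le>0. w (b j) * q j) + w (b 0) * (T 0 - E 0) = w (b 0) * T 0" by (simp add: E_def algebra_simps)
      moreover have "ennreal (w (b 0) * T 0) = ennreal (w (b 0)) * ennreal (T 0)" using wb[of 0] by (intro ennreal_mult) (auto simp: T_def)
      ultimately show ?thesis unfolding T by presburger
    qed
    also have "\<dots> = (\<integral>\<^sup>+ r. ennreal (w (b 0)) * indicator {b 0..1} r \<partial>\<nu>)"
      by (rule nn_integral_cmult_indicator[OF sets(1), symmetric])
    also have "\<dots> \<le> G 0"
      unfolding G_def
    proof (rule nn_integral_mono)
      fix r
      have "w (b 0) \<le> w r" if "b 0 \<le> r" "r \<le> 1" using that b_bounds[of 0] by (intro mono_onD[OF w(1)]) auto
      then show "ennreal (w (b 0)) * indicator {b 0..1} r \<le> ennreal (w r) * indicator {b 0..1} r"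
        by (auto simp: indicator_def intro!: ennreal_leI)
    qed
    finally show ?case .
  next
    case (Suc n)
    have dT: "emeasure \<nu> {b (Suc n)..<b n} = ennreal (T (Suc n) - T n)"
    proof -
      have "{b (Suc n)..<b n} = {b (Suc n)..1} - {b n..1}" using b_bounds[of n] by auto
      moreover have "emeasure \<nu> ({b (Suc n)..1} - {b n..1}) = emeasure \<nu> {b (Suc n)..1} - emeasure \<nu> {b n..1}"
      proof (rule emeasure_Diff)
        show "emeasure \<nu> {b n..1} \<noteq> \<infinity>" using finite_\<nu>[OF b_bounds(1)[of n]] by simp
        show "{b n..1} \<subseteq> {b (Suc n)..1}" using bd[of n] by simp
      qed (rule sets)+
      moreover have "ennreal (T (Suc n)) - ennreal (T n) = ennreal (T (Suc n) - T n)"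
        by (intro ennreal_minus) (simp add: T_def)
      ultimately show ?thesis unfolding T by metis
    qed
    have TT: "T n \<le> T (Suc n)"
    proof -
      have "emeasure \<nu> {b n..1} \<le> emeasure \<nu> {b (Suc n)..1}" using bd[of n] by (intro emeasure_mono sets) simp
      then have "ennreal (T n) \<le> ennreal (T (Suc n))" unfolding T .
      then show ?thesis by (subst (asm) ennreal_le_iff) (auto simp: T_def)
    qed
    have wm: "w (b (Suc n)) \<le> w (b n)" using bd[of n] b_bounds by (intro mono_onD[OF w(1)]) auto
    have TE: "0 \<le> T n - E n" using T4[of n] E3[of n] q_pos[of n] by linarith
    have nn: "0 \<le> 2 * (\<Sum>j\<le>n. w (b j) * q j) + w (b n) * (T n - E n)"
      using wb q_pos TE by (intro add_nonneg_nonneg mult_nonneg_nonneg sum_nonneg) (auto intro: less_imp_le)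
    \<comment> \<open>The factor of \<open>T n - E n\<close> drops from \<open>w (b n)\<close> to
      \<open>w (b (Suc n))\<close>, which only lowers the left side as \<open>T n - E n\<close> is
      nonnegative; the newly gained mass \<open>T (Suc n) - T n\<close> enters at
      \<open>w (b (Suc n))\<close>.\<close>
    have "w (b (Suc n)) * (T n - E n) \<le> w (b n) * (T n - E n)" using wm TE by (rule mult_right_mono)
    then have "2 * (\<Sum>j\<le>Suc n. w (b j) * q j) + w (b (Suc n)) * (T (Suc n) - E (Suc n))
        \<le> w (b (Suc n)) * (T (Suc n) - T n) + (2 * (\<Sum>j\<le>n. w (b j) * q j) + w (b n) * (T n - E n))"
      by (simp add: E_def algebra_simps)
    then have "ennreal (2 * (\<Sum>j\<le>Suc n. w (b j) * q j) + w (b (Suc n)) * (T (Suc n) - E (Suc n)))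
        \<le> ennreal (w (b (Suc n)) * (T (Suc n) - T n) + (2 * (\<Sum>j\<le>n. w (b j) * q j) + w (b n) * (T n - E n)))"
      by (rule ennreal_leI)
    also have "\<dots> = ennreal (w (b (Suc n))) * emeasure \<nu> {b (Suc n)..<b n} + ennreal (2 * (\<Sum>j\<le>n. w (b j) * q j) + w (b n) * (T n - E n))"
      using wb[of "Suc n"] TT nn by (simp add: dT ennreal_plus ennreal_mult del: ennreal_plus) (simp add: ennreal_mult ennreal_plus)
    also have "\<dots> \<le> ennreal (w (b (Suc n))) * emeasure \<nu> {b (Suc n)..<b n} + G n" using Suc by (intro add_left_mono)
    also have "\<dots> = (\<integral>\<^sup>+ r. ennreal (w (b (Suc n))) * indicator {b (Suc n)..<b n} r + ennreal (w r) * indicator {b n..1} r \<partial>\<nu>)"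
      unfolding G_def using sets by (subst nn_integral_add) (auto simp: nn_integral_cmult)
    also have "\<dots> \<le> G (Suc n)"
      unfolding G_def
    proof (rule nn_integral_mono)
      fix r assume "r \<in> space \<nu>"
      then have r: "0 < r" "r \<le> 1" by (auto simp: space_\<nu>)
      have "w (b (Suc n)) \<le> w r" if "b (Suc n) \<le> r" using r that b_bounds by (intro mono_onD[OF w(1)]) auto
      then show "ennreal (w (b (Suc n))) * indicator {b (Suc n)..<b n} r + ennreal (w r) * indicator {b n..1} r \<le> ennreal (w r) * indicator {b (Suc n)..1} r"
        using r bd[of n] b_bounds[of n] by (auto simp: indicator_def intro!: ennreal_leI)
    qed
    finally show ?case .
  qed
  define F where "F = enn2real (\<integral>\<^sup>+ r. ennreal (w r) \<partial>\<nu>)"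
  have F: "(\<integral>\<^sup>+ r. ennreal (w r) \<partial>\<nu>) = ennreal F" using fin by (simp add: F_def)
  show ?thesis
  proof (rule bounded_imp_summable)
    show "0 \<le> w (b n) * q n" for n using wb[of n] q_pos[of n] by simp
    fix n
    have TE: "0 \<le> T n - E n" using T4[of n] E3[of n] q_pos[of n] by linarith
    have "ennreal (2 * (\<Sum>j\<le>n. w (b j) * q j) + w (b n) * (T n - E n)) \<le> ennreal F"
      using main[of n] unfolding F[symmetric] G_def
      by (rule order_trans) (intro nn_integral_mono, auto simp: indicator_def)
    then have "2 * (\<Sum>j\<le>n. w (b j) * q j) + w (b n) * (T n - E n) \<le> F"
      by (subst (asm) ennreal_le_iff) (auto simp: F_def)
    moreover have "0 \<le> w (b n) * (T n - E n)" using wb[of n] TE by simp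
    ultimately show "(\<Sum>j\<le>n. w (b j) * q j) \<le> F / 2" by linarith
  qed
qed

end

section \<open>Poisson points\<close>

text \<open>Chernoff bound with base 2: a Poisson variable of mean \<open>l\<close> gives
  \<open>2 ^ X\<close> the expectation \<open>exp l\<close>. The event is phrased by excluding the
  values below \<open>n\<close>, so that it also contains infinite or non-integer values.\<close>

lemma poisson_tail:
  fixes X :: "'w \<Rightarrow> ennreal"
  assumes M: "prob_space M" and X: "X \<in> borel_measurable M" and l: "0 \<le> l"
    and P: "\<And>k::nat. measure M {\<omega> \<in> space M. X \<omega> = of_nat k} = exp (- l) * l ^ k / fact k"
  shows "measure M {\<omega> \<in> space M. \<forall>k<n. X \<omega> \<noteq> of_nat k} \<le> exp l / 2 ^ n"
proof -
  interpret prob_space M by (rule M)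
  define A where "A k = {\<omega> \<in> space M. X \<omega> = of_nat k}" for k :: nat
  define p where "p k = exp (- l) * l ^ k / fact k" for k :: nat
  \<comment> \<open>This is \<open>2 ^ k * p k\<close>, with sum \<open>exp l\<close>.\<close>
  define r where "r k = exp (- l) * (2 * l) ^ k / fact k" for k :: nat
  have A: "A k \<in> sets M" for k unfolding A_def using X by measurable
  have sums: "(\<lambda>k. exp (- l) * (x ^ k / fact k)) sums (exp (- l) * exp x)" for x :: real
    using exp_converges[of x] by (intro sums_mult) (simp add: divide_inverse mult.commute)
  have "p = (\<lambda>k. exp (- l) * (l ^ k / fact k))" "r = (\<lambda>k. exp (- l) * ((2 * l) ^ k / fact k))"
    by (simp_all add: p_def r_def fun_eq_iff)
  moreover have "exp (- l) * exp l = 1" "exp (- l) * exp (2 * l) = exp l" by (simp_all add: exp_add[symmetric])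
  ultimately have ps: "p sums 1" and rs: "r sums exp l" using sums[of l] sums[of "2 * l"] by simp_all
  have r0: "0 \<le> r k" for k using l by (simp add: r_def)
  have "{\<omega> \<in> space M. \<forall>k<n. X \<omega> \<noteq> of_nat k} = space M - (\<Union>k<n. A k)" by (auto simp: A_def)
  then have "prob {\<omega> \<in> space M. \<forall>k<n. X \<omega> \<noteq> of_nat k} = 1 - prob (\<Union>k<n. A k)"
    using A by (simp add: prob_compl)
  also have "prob (\<Union>k<n. A k) = (\<Sum>k<n. prob (A k))"
    using A by (intro finite_measure_finite_Union) (auto simp: disjoint_family_on_def A_def)
  also have "\<dots> = (\<Sum>k<n. p k)" using P by (simp add: A_def p_def)
  also have "1 - (\<Sum>k<n. p k) = (\<Sum>k. p (k + n))"
    using suminf_split_initial_segment[of p n] ps by (simp add: sums_iff)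
  also have "\<dots> \<le> (\<Sum>k. r (k + n) / 2 ^ n)"
  proof (rule suminf_le)
    fix k
    have "p (k + n) * 2 ^ n \<le> p (k + n) * 2 ^ (k + n)"
      using l by (intro mult_left_mono power_increasing) (auto simp: p_def)
    also have "\<dots> = r (k + n)" by (simp add: p_def r_def power_mult_distrib)
    finally show "p (k + n) \<le> r (k + n) / 2 ^ n" by (simp add: field_simps)
    show "summable (\<lambda>k. p (k + n))" using ps by (intro summable_ignore_initial_segment) (simp add: sums_iff)
    show "summable (\<lambda>k. r (k + n) / 2 ^ n)" using rs by (intro summable_divide summable_ignore_initial_segment) (simp add: sums_iff)
  qed
  also have "\<dots> = (\<Sum>k. r (k + n)) / 2 ^ n" using rs by (intro suminf_divide summable_ignore_initial_segment) (simp add: sums_iff)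
  also have "(\<Sum>k. r (k + n)) \<le> exp l"
    using suminf_split_initial_segment[of r n] rs r0 by (simp add: sums_iff sum_nonneg)
  finally show ?thesis by (simp add: divide_right_mono)
qed

text \<open>The series of indicators becomes the counting measure of an index set, so that mass 0
  means that no atom is present and finite mass that finitely many are.\<close>

lemma point_measureE:
  assumes "point_measure \<mu>"
  obtains I P where "\<And>i. i \<in> I \<Longrightarrow> P i \<in> space \<mu>" "\<And>E. E \<in> sets \<mu> \<Longrightarrow> emeasure \<mu> E = emeasure (count_space UNIV) {i \<in> (I::nat set). P i \<in> E}"
proof -
  obtain I P where IP: "\<forall>i\<in>I. P i \<in> space \<mu>" "\<forall>E\<in>sets \<mu>. emeasure \<mu> E = (\<Sum>i. if i \<in> (I::nat set) then indicator E (P i) else (0::ennreal))"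
    using assms unfolding point_measure_def by blast
  have "(\<Sum>i. if i \<in> I then indicator E (P i) else (0::ennreal)) = emeasure (count_space UNIV) {i \<in> I. P i \<in> E}" for E
  proof -
    have "emeasure (count_space UNIV) {i \<in> I. P i \<in> E} = (\<integral>\<^sup>+i. indicator {i \<in> I. P i \<in> E} i \<partial>count_space UNIV)" by simp
    also have "\<dots> = (\<Sum>i. indicator {i \<in> I. P i \<in> E} i)" by (rule nn_integral_count_space_nat)
    also have "\<dots> = (\<Sum>i. if i \<in> I then indicator E (P i) else (0::ennreal))" by (intro suminf_cong) (auto simp: indicator_def)
    finally show ?thesis ..
  qed
  then show ?thesis using that IP by metis
qed

locale poisson_balls =
  fixes N :: "real^'n \<Rightarrow> real" and \<nu> :: "real measure" and U :: "(real^'n) set"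
    and M :: "'w measure" and Pm :: "'w \<Rightarrow> (real \<times> (real^'n)) measure"
  assumes norm: "is_norm N" and \<nu>: "\<nu> \<in> Rcls" and U: "open U"
    and pp: "poisson_point_measure M Pm (\<nu> \<Otimes>\<^sub>M restrict_space lborel U)"
begin

sublocale radius_measure \<nu> "CARD('n)"
  by unfold_locales (use \<nu> in auto)

sublocale prob_space M
  using pp by (simp add: poisson_point_measure_def)

abbreviation \<pi> :: "(real \<times> (real^'n)) measure" where
  "\<pi> \<equiv> \<nu> \<Otimes>\<^sub>M restrict_space lborel U"

lemma space_\<pi>: "space \<pi> = {0<..1} \<times> U"
  by (simp add: space_pair_measure space_\<nu> space_restrict_space)

lemma rectangle:
  assumes "A \<in> sets \<nu>" "B \<in> sets borel" "B \<subseteq> U"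
  shows "A \<times> B \<in> sets \<pi>" "emeasure \<pi> (A \<times> B) = emeasure \<nu> A * emeasure lborel B"
proof -
  have UB: "U \<in> sets borel" using U by simp
  have B: "B \<in> sets (restrict_space lborel U)" using assms UB by (simp add: sets_restrict_space_iff)
  show "A \<times> B \<in> sets \<pi>" using assms(1) B by (rule pair_measureI)
  interpret s: sigma_finite_measure "restrict_space lborel U"
    using UB by (intro sigma_finite_measure_restrict_space sigma_finite_lborel) simp
  show "emeasure \<pi> (A \<times> B) = emeasure \<nu> A * emeasure lborel B"
    using assms UB B by (simp add: s.emeasure_pair_measure_Times emeasure_restrict_space)
qed

lemma measurable_Pm: "E \<in> sets \<pi> \<Longrightarrow> (\<lambda>\<omega>. emeasure (Pm \<omega>) E) \<in> borel_measurable M"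
  using pp by (simp add: poisson_point_measure_def)

lemma poisson_prob:
  assumes "E \<in> sets \<pi>" "emeasure \<pi> E = ennreal l" "0 \<le> l"
  shows "prob {\<omega> \<in> space M. emeasure (Pm \<omega>) E = of_nat k} = exp (- l) * l ^ k / fact k"
proof -
  have "emeasure \<pi> E \<noteq> \<infinity>" "enn2real (emeasure \<pi> E) = l" using assms by auto
  then show ?thesis using pp assms(1) unfolding poisson_point_measure_def by (metis (no_types, lifting))
qed

text \<open>If fewer than half of the \<open>m j\<close> cubes contain an atom, some family
  \<open>S\<close> of at least half of them is void altogether. The closed tail at
  \<open>b j\<close> is at least \<open>4 * q j\<close> and each cube has volume
  \<open>1 / q j\<close>, so the union of \<open>S\<close> has intensity at least
  \<open>4 * card S\<close>, hence at least \<open>2 * m j\<close>. As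
  \<open>2 * exp (- 2) \<le> 1/2\<close>, the union bound over all \<open>S\<close> is summable in
  \<open>j\<close>, and the Borel-Cantelli lemma applies.\<close>

lemma many_nonempty_cubes:
  assumes Q: "dyadic_at c z \<subseteq> U"
  shows "AE \<omega> in M. \<forall>\<^sub>F j in sequentially. 2 powr (real CARD('n) * (real_of_int (4 * int j) - real_of_int c))
      \<le> 2 * real (card {x \<in> subcubes (4 * int j) (dyadic_at c z). emeasure (Pm \<omega>) ({b j..1} \<times> x) \<noteq> 0})"
proof -
  define d where "d = CARD('n)"
  define SQ where "SQ j = subcubes (4 * int j) (dyadic_at c z)" for j
  define m where "m j = card (SQ j)" for j
  define V where "V S j = {\<omega> \<in> space M. emeasure (Pm \<omega>) ({b j..1} \<times> \<Union>S) = 0}" for S j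
  define B where "B j = (if c \<le> 4 * int j then (\<Union>S\<in>{S. S \<subseteq> SQ j \<and> m j \<le> 2 * card S}. V S j) else {})" for j
  have bs: "{b j..1} \<in> sets \<nu>" for j using b_bounds[of j] by (intro in_sets_\<nu>) auto
  have fin: "finite (SQ j)" and cardq: "real (m j) = cvol d c * q j" if "c \<le> 4 * int j" for j
  proof -
    show "finite (SQ j)" using card_subcubes(1)[OF that] by (simp add: SQ_def)
    have "cvol d c * q j = cvol d c / cvol d (4 * int j)" by (simp add: q_def d_def)
    also have "\<dots> = 2 powr (- real d * real_of_int c - (- real d * real_of_int (4 * int j)))" by (rule powr_diff[symmetric])
    also have "- real d * real_of_int c - (- real d * real_of_int (4 * int j)) = real d * (real_of_int (4 * int j) - real_of_int c)"
      by (simp add: algebra_simps)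
    finally show "real (m j) = cvol d c * q j" using card_subcubes(2)[OF that, of z] by (simp add: m_def SQ_def d_def)
  qed
  have US: "\<Union>S \<in> sets borel" "\<Union>S \<subseteq> U" if "S \<subseteq> SQ j" "c \<le> 4 * int j" for S j
  proof -
    show "\<Union>S \<in> sets borel" using that fin[OF that(2)]
      by (intro sets.finite_Union) (auto simp: SQ_def subcubes_def dest: finite_subset)
    show "\<Union>S \<subseteq> U" using that subcubes_subset[OF that(2)] Q unfolding SQ_def by blast
  qed
  have ES: "{b j..1} \<times> \<Union>S \<in> sets \<pi>" if "S \<subseteq> SQ j" "c \<le> 4 * int j" for S j
    using rectangle(1)[OF bs US] that by blast
  have VM: "V S j \<in> sets M" if "S \<subseteq> SQ j" "c \<le> 4 * int j" for S j
    unfolding V_def using measurable_Pm[OF ES[OF that]] by measurable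
  have VP: "prob (V S j) \<le> exp (- 2 * real (m j))" if S: "S \<subseteq> SQ j" "m j \<le> 2 * card S" and c: "c \<le> 4 * int j" for S j
  proof -
    have finS: "finite S" using fin[OF c] S(1) finite_subset by blast
    define T where "T = enn2real (emeasure \<nu> {b j..1})"
    have T: "emeasure \<nu> {b j..1} = ennreal T" using finite_\<nu>[OF b_bounds(1)] by (simp add: T_def)
    have T0: "0 \<le> T" by (simp add: T_def)
    have T4: "4 * q j \<le> T" using emeasure_ge_b[of j] q_pos[of j] unfolding T by (subst (asm) ennreal_le_iff2) auto
    have S1: "\<exists>x. s = dyadic_at (4 * int j) x" if "s \<in> S" for s using S(1) that by (auto simp: SQ_def subcubes_def)
    have "emeasure lborel (\<Union>S) = (\<Sum>s\<in>S. emeasure lborel s)"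
    proof -
      have "(\<Sum>s\<in>S. emeasure lborel s) = emeasure lborel (\<Union>s\<in>S. s)"
      proof (rule sum_emeasure)
        show "(\<lambda>s. s) ` S \<subseteq> sets lborel" using S1 by fastforce
        show "disjoint_family_on (\<lambda>s. s) S" unfolding disjoint_family_on_def
          using S(1) subcubes_disjoint unfolding SQ_def by blast
      qed (rule finS)
      then show ?thesis by simp
    qed
    also have "\<dots> = (\<Sum>s\<in>S. ennreal (cvol d (4 * int j)))"
    proof (intro sum.cong refl)
      fix s assume "s \<in> S"
      then obtain x where "s = dyadic_at (4 * int j) x" using S1 by blast
      then show "emeasure lborel s = ennreal (cvol d (4 * int j))" by (simp only: emeasure_dyadic_at d_def)
    qed
    also have "\<dots> = ennreal (real (card S) / q j)"
      by (simp add: q_def d_def ennreal_mult ennreal_of_nat_eq_real_of_nat)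
    finally have emS: "emeasure lborel (\<Union>S) = ennreal (real (card S) / q j)" .
    have em\<pi>: "emeasure \<pi> ({b j..1} \<times> \<Union>S) = ennreal (T * (real (card S) / q j))"
    proof -
      have "0 \<le> real (card S) / q j" using q_pos[of j] by simp
      then have "ennreal (T * (real (card S) / q j)) = ennreal T * ennreal (real (card S) / q j)" using T0 by (intro ennreal_mult)
      then show ?thesis using rectangle(2)[OF bs US[OF S(1) c], of j] 
        unfolding T emS by metis
    qed
    have "prob {\<omega> \<in> space M. emeasure (Pm \<omega>) ({b j..1} \<times> \<Union>S) = of_nat 0} = exp (- (T * (real (card S) / q j)))"
      using poisson_prob[OF ES[OF S(1) c] em\<pi>, of 0] q_pos[of j] T0 by simp
    then have "prob (V S j) = exp (- (T * (real (card S) / q j)))" by (simp add: V_def)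
    also have "\<dots> \<le> exp (- 2 * real (m j))"
    proof -
      have "2 * real (m j) \<le> 4 * real (card S)" using S(2) by simp
      also have "\<dots> = 4 * q j * (real (card S) / q j)" using q_pos[of j] by simp
      also have "\<dots> \<le> T * (real (card S) / q j)" using T4 q_pos[of j] by (intro mult_right_mono) auto
      finally show ?thesis by simp
    qed
    finally show ?thesis .
  qed
  have BM: "B j \<in> sets M" for j
    unfolding B_def using VM fin[of j] by (auto intro!: sets.finite_UN)
  have BP: "prob (B j) \<le> (1/2) ^ m j" if c: "c \<le> 4 * int j" for j
  proof -
    let ?F = "{S. S \<subseteq> SQ j \<and> m j \<le> 2 * card S}"
    have sub: "?F \<subseteq> Pow (SQ j)" by auto
    have finF: "finite ?F" using sub fin[OF c] by (meson finite_Pow_iff finite_subset)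
    have "prob (B j) \<le> (\<Sum>S\<in>?F. prob (V S j))"
      unfolding B_def using c VM finF by (simp, intro finite_measure_subadditive_finite) auto
    also have "\<dots> \<le> (\<Sum>S\<in>?F. exp (- 2 * real (m j)))" using VP c by (intro sum_mono) auto
    also have "\<dots> = real (card ?F) * exp (- 2 * real (m j))" by simp
    also have "\<dots> \<le> 2 ^ m j * exp (- 2 * real (m j))"
    proof (rule mult_right_mono)
      have "card ?F \<le> card (Pow (SQ j))" using fin[OF c] sub by (intro card_mono) auto
      also have "\<dots> = 2 ^ m j" using fin[OF c] by (simp add: card_Pow m_def)
      finally have "real (card ?F) \<le> real (2 ^ m j)" by (simp only: of_nat_le_iff)
      then show "real (card ?F) \<le> 2 ^ m j" by simp
    qed simp
    also have "\<dots> = (2 * exp (- 2)) ^ m j" by (simp add: power_mult_distrib exp_of_nat_mult[symmetric] mult.commute)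
    also have "\<dots> \<le> (1/2) ^ m j"
    proof (rule power_mono)
      have "(2::real) \<le> exp 1" using exp_ge_add_one_self[of 1] by simp
      then have "2 * 2 \<le> exp (1::real) * exp 1" by (intro mult_mono) auto
      then have "4 \<le> exp (2::real)" by (simp add: exp_add[symmetric])
      then show "2 * exp (- 2) \<le> (1/2::real)" by (simp add: exp_minus field_simps)
    qed simp
    finally show ?thesis .
  qed
  \<comment> \<open>Linear growth of \<open>m j\<close> suffices for summability; the exponential
    growth of \<open>q\<close> absorbs the volume of the fixed cube.\<close>
  obtain j1 :: nat where j1: "\<And>j. j \<ge> j1 \<Longrightarrow> c \<le> 4 * int j \<and> j \<le> m j"
  proof -
    define v where "v = cvol d c"
    have v: "v > 0" by (simp add: v_def)
    obtain n :: nat where n: "1 / v < real n" using reals_Archimedean2 by blast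
    show ?thesis
    proof (rule that)
      fix j assume "j \<ge> nat \<lceil>c\<rceil> + 2 * n"
      then have c: "c \<le> 4 * int j" and jn: "2 * n \<le> j" by auto
      have "real n \<le> q (nat (int n))" using q_ge[of n] by simp
      define i where "i = j - n"
      have ji: "j = n + i" "n \<le> i" using jn by (auto simp: i_def)
      have "q j = q n * q i" by (simp add: q_power ji power_add)
      also have "\<dots> \<ge> real n * q i" using q_ge[of n] q_pos[of i] by (intro mult_right_mono) auto
      finally have "real n * q i \<le> q j" .
      moreover have "2 * real i \<le> q i"
      proof (cases i)
        case 0 then show ?thesis using q_pos[of 0] by simp
      next
        case (Suc k)
        have "16 * real k \<le> 16 * q k" "1 \<le> q k" using q_ge[of k] by (auto simp: q_power)
        then show ?thesis using q_Suc[of k] Suc q_ge[of k] by simp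
      qed
      ultimately have nq: "real n * (2 * real i) \<le> q j" by (meson mult_left_mono of_nat_0_le_iff order_trans)
      have vn: "1 \<le> v * real n" using n v by (simp add: field_simps)
      have "1 * (2 * real i) \<le> v * real n * (2 * real i)" using vn by (intro mult_right_mono) auto
      also have "\<dots> = v * (real n * (2 * real i))" by (simp only: mult.assoc)
      also have "\<dots> \<le> v * q j" using nq v by (intro mult_left_mono) auto
      finally have "2 * real i \<le> v * q j" by simp
      moreover have "real j \<le> 2 * real i" using ji by simp
      ultimately have "real j \<le> real (m j)" using cardq[OF c] by (simp add: v_def)
      then show "c \<le> 4 * int j \<and> j \<le> m j" using c by simp
    qed
  qed
  have "summable (\<lambda>j. prob (B j))"
  proof (rule summable_comparison_test'[of "\<lambda>j. (1/2::real) ^ j" j1])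
    show "summable (\<lambda>j. (1/2::real) ^ j)" by (simp add: summable_geometric)
    fix j assume "j \<ge> j1"
    then have "c \<le> 4 * int j" "j \<le> m j" using j1 by auto
    then have "prob (B j) \<le> (1/2) ^ m j" "(1/2::real) ^ m j \<le> (1/2) ^ j"
      using BP[of j] power_decreasing[of j "m j" "1/2::real"] by auto
    then have "prob (B j) \<le> (1/2) ^ j" by (rule order_trans)
    then show "norm (prob (B j)) \<le> (1/2) ^ j" by simp
  qed
  then have "AE \<omega> in M. \<forall>\<^sub>F j in sequentially. \<omega> \<in> space M - B j"
    using BM by (intro borel_cantelli_AE1) (auto simp: emeasure_eq_measure)
  then show ?thesis
  proof eventually_elim
    case (elim \<omega>)
    moreover have "\<forall>\<^sub>F j in sequentially. j \<ge> j1" by (rule eventually_ge_at_top)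
    ultimately show ?case
    proof eventually_elim
      case (elim j)
      then have c: "c \<le> 4 * int j" and \<omega>: "\<omega> \<in> space M" "\<omega> \<notin> B j" using j1 by auto
      define G where "G = {x \<in> SQ j. emeasure (Pm \<omega>) ({b j..1} \<times> x) \<noteq> 0}"
      define S where "S = SQ j - G"
      have S: "S \<subseteq> SQ j" by (auto simp: S_def)
      have finS: "finite S" using S fin[OF c] finite_subset by blast
      have sP: "sets (Pm \<omega>) = sets \<pi>" using pp \<omega>(1) by (simp add: poisson_point_measure_def)
      have "{b j..1} \<times> \<Union>S = (\<Union>s\<in>S. {b j..1} \<times> s)" by auto
      moreover have "(\<Union>s\<in>S. {b j..1} \<times> s) \<in> null_sets (Pm \<omega>)"
      proof (rule null_sets.finite_UN[OF finS])
        fix s assume s: "s \<in> S"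
        have "{b j..1} \<times> \<Union>{s} \<in> sets \<pi>" using s S c by (intro ES) auto
        then show "{b j..1} \<times> s \<in> null_sets (Pm \<omega>)" using s by (auto simp: null_sets_def sP S_def G_def)
      qed
      ultimately have "emeasure (Pm \<omega>) ({b j..1} \<times> \<Union>S) = 0" by (simp add: null_setsD1)
      then have "\<omega> \<in> V S j" using \<omega>(1) by (simp add: V_def)
      then have "\<not> m j \<le> 2 * card S" using \<omega>(2) S c by (auto simp: B_def)
      moreover have "card S + card G = m j"
      proof -
        have "G \<subseteq> SQ j" by (auto simp: G_def)
        then show ?thesis unfolding S_def m_def using fin[OF c] by (metis card_Diff_subset card_mono finite_subset le_add_diff_inverse2)
      qed
      ultimately have "real (m j) \<le> 2 * real (card G)" by linarith
      moreover have "real (m j) = 2 powr (real CARD('n) * (real_of_int (4 * int j) - real_of_int c))"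
        using card_subcubes(2)[OF c, of z] by (simp add: m_def SQ_def)
      ultimately show ?case by (simp add: G_def SQ_def)
    qed
  qed
qed

text \<open>The mean is at most \<open>4 * q j * c0\<close>. The threshold
  \<open>16 * (c0 + 1) * q j\<close> beats it in the Chernoff bound: with
  \<open>exp (1/2) \<le> 2\<close> there remains at most
  \<open>exp (- (4 * ((c0 + 1) * q j)))\<close>, which is summable. Writing the count as a natural
  number includes its finiteness.\<close>

lemma few_large_radii:
  obtains C where "AE \<omega> in M. \<forall>\<^sub>F j in sequentially. \<exists>k::nat. emeasure (Pm \<omega>) ({b j<..1} \<times> (U \<inter> cball 0 R)) = of_nat k \<and> real k \<le> C * q j"
proof -
  define E where "E j = {b j<..1} \<times> (U \<inter> cball 0 R)" for j
  define c0 where "c0 = enn2real (emeasure lborel (U \<inter> cball 0 R))"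
  have UB: "U \<inter> cball 0 R \<in> sets borel" using U by simp
  have "emeasure lborel (U \<inter> cball 0 R) \<le> emeasure lborel (cball (0::real^'n) R)"
    by (rule Measure_Space.emeasure_mono) auto
  also have "\<dots> < \<infinity>" by (rule emeasure_lborel_cball_finite)
  finally have c0: "emeasure lborel (U \<inter> cball 0 R) = ennreal c0" by (simp add: c0_def)
  have c00: "0 \<le> c0" by (simp add: c0_def)
  have bs: "{b j<..1} \<in> sets \<nu>" for j using b_bounds[of j] by (intro in_sets_\<nu>) auto
  have E: "E j \<in> sets \<pi>" "emeasure \<pi> (E j) = emeasure \<nu> {b j<..1} * ennreal c0" for j
    unfolding E_def using rectangle[OF bs UB] c0 by auto
  define l where "l j = enn2real (emeasure \<pi> (E j))" for j
  have le: "emeasure \<pi> (E j) \<le> ennreal (4 * q j * c0)" for j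
  proof -
    have "emeasure \<pi> (E j) \<le> ennreal (4 * q j) * ennreal c0" unfolding E(2) by (intro mult_right_mono emeasure_gt_b) auto
    then show ?thesis using q_pos[of j] c00 by (simp add: ennreal_mult)
  qed
  have l: "emeasure \<pi> (E j) = ennreal (l j)" "0 \<le> l j" "l j \<le> 4 * q j * c0" for j
  proof -
    have "emeasure \<pi> (E j) < top" using le[of j] ennreal_less_top order_le_less_trans by blast
    then show l1: "emeasure \<pi> (E j) = ennreal (l j)" by (simp add: l_def)
    show "0 \<le> l j" by (simp add: l_def)
    have "ennreal (l j) \<le> ennreal (4 * q j * c0)" using le[of j] unfolding l1 .
    then show "l j \<le> 4 * q j * c0" using q_pos[of j] c00 by (subst (asm) ennreal_le_iff) auto
  qed
  define n where "n j = nat \<lceil>16 * (c0 + 1) * q j\<rceil>" for j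
  have n: "16 * (c0 + 1) * q j \<le> real (n j)" "real (n j) \<le> (16 * (c0 + 1) + 1) * q j" for j
  proof -
    have q1: "1 \<le> q j" by (simp add: q_power)
    have pos: "0 \<le> 16 * (c0 + 1) * q j" using c00 q_pos[of j] by simp
    show "16 * (c0 + 1) * q j \<le> real (n j)" unfolding n_def by linarith
    have "real (n j) \<le> 16 * (c0 + 1) * q j + 1" unfolding n_def using pos by linarith
    then show "real (n j) \<le> (16 * (c0 + 1) + 1) * q j" using q1 by (simp add: distrib_right)
  qed
  define B where "B j = {\<omega> \<in> space M. \<forall>k<n j. emeasure (Pm \<omega>) (E j) \<noteq> of_nat k}" for j
  have BM: "B j \<in> sets M" for j unfolding B_def using measurable_Pm[OF E(1)[of j]] by measurable
  have "prob (B j) \<le> (1/2) ^ j" for j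
  proof -
    have "prob (B j) \<le> exp (l j) / 2 ^ n j"
      unfolding B_def
      by (rule poisson_tail[OF prob_space_axioms measurable_Pm[OF E(1)] l(2) poisson_prob[OF E(1) l(1,2)]])
    also have "\<dots> \<le> exp (4 * ((c0 + 1) * q j)) / exp (8 * ((c0 + 1) * q j))"
    proof (rule frac_le)
      have "4 * q j * c0 \<le> 4 * ((c0 + 1) * q j)" using q_pos[of j] by (simp add: algebra_simps)
      then show "exp (l j) \<le> exp (4 * ((c0 + 1) * q j))" using l(3)[of j] by simp
      have "exp (1/2) \<le> (2::real)"
      proof -
        have "exp (1/2::real) ^ 2 = exp 1" by (simp add: exp_double[symmetric] power2_eq_square exp_add[symmetric])
        also have "\<dots> \<le> 2 ^ 2" using exp_le by simp
        finally show ?thesis by (rule power2_le_imp_le) simp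
      qed
      then have "exp (1/2) ^ n j \<le> (2::real) ^ n j" by (intro power_mono) auto
      moreover have "exp (1/2) ^ n j = exp (real (n j) / 2)" by (simp add: exp_of_nat_mult[symmetric])
      moreover have "8 * ((c0 + 1) * q j) \<le> real (n j) / 2" using n(1)[of j] by (simp add: algebra_simps)
      ultimately show "exp (8 * ((c0 + 1) * q j)) \<le> 2 ^ n j" by (metis exp_le_cancel_iff order_trans)
    qed auto
    also have "\<dots> = exp (- (4 * ((c0 + 1) * q j)))" by (simp add: exp_diff[symmetric])
    also have "\<dots> \<le> exp (- real j)"
    proof -
      have "real j \<le> 1 * q j" using q_ge[of j] by simp
      also have "\<dots> \<le> (c0 + 1) * q j" using c00 q_pos[of j] by (intro mult_right_mono) auto
      also have "\<dots> \<le> 4 * ((c0 + 1) * q j)" using c00 q_pos[of j] by simp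
      finally show ?thesis by simp
    qed
    also have "\<dots> = exp (- 1) ^ j" by (simp add: exp_of_nat_mult[symmetric])
    also have "\<dots> \<le> (1/2) ^ j"
    proof (rule power_mono)
      have "(2::real) \<le> exp 1" using exp_ge_add_one_self[of 1] by simp
      then show "exp (- 1) \<le> (1/2::real)" by (simp add: exp_minus field_simps)
    qed simp
    finally show ?thesis .
  qed
  note BP = this
  have "summable (\<lambda>j. prob (B j))"
  proof (rule summable_comparison_test'[of "\<lambda>j. (1/2::real) ^ j" 0])
    show "summable (\<lambda>j. (1/2::real) ^ j)" by (simp add: summable_geometric)
    show "norm (prob (B j)) \<le> (1/2) ^ j" for j using BP[of j] by simp
  qed
  then have "AE \<omega> in M. \<forall>\<^sub>F j in sequentially. \<omega> \<in> space M - B j"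
    using BM by (intro borel_cantelli_AE1) (auto simp: emeasure_eq_measure)
  then have "AE \<omega> in M. \<forall>\<^sub>F j in sequentially. \<exists>k::nat. emeasure (Pm \<omega>) ({b j<..1} \<times> (U \<inter> cball 0 R)) = of_nat k \<and> real k \<le> (16 * (c0 + 1) + 1) * q j"
  proof eventually_elim
    case (elim \<omega>)
    then show ?case
    proof eventually_elim
      case (elim j)
      then obtain k where k: "k < n j" "emeasure (Pm \<omega>) (E j) = of_nat k" by (auto simp: B_def)
      have "real k \<le> (16 * (c0 + 1) + 1) * q j" using k(1) n(2)[of j] by linarith
      then show ?case using k(2) unfolding E_def by blast
    qed
  qed
  then show ?thesis using that by blast
qed

text \<open>Both almost sure facts concern countably many data, the dyadic cubes and the integer
  radii, so one null set serves them all. The atoms are then enumerated for each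
  \<open>\<omega>\<close> separately; no measurability of the enumeration is asserted.\<close>

theorem AE_ubiquity:
  "AE \<omega> in M. \<exists>I rr xx. ubiquity N I rr xx b U \<and> sparse N I rr xx b \<and> F_set N (Pm \<omega>) = limsup_balls N I rr xx"
proof -
  \<comment> \<open>Quantified over cubes as sets: these are countable, whereas the pairs
    \<open>(c, z)\<close> that describe them are not.\<close>
  have "AE \<omega> in M. \<forall>Q\<in>{Q \<in> dyadic_cubes. Q \<subseteq> U}. \<forall>c z. Q = dyadic_at c z \<longrightarrow>
      (\<forall>\<^sub>F j in sequentially. 2 powr (real CARD('n) * (real_of_int (4 * int j) - real_of_int c))
      \<le> 2 * real (card {x \<in> subcubes (4 * int j) Q. emeasure (Pm \<omega>) ({b j..1} \<times> x) \<noteq> 0}))"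
  proof (rule AE_ball_countable')
    show "countable {Q \<in> dyadic_cubes. Q \<subseteq> U}" using countable_dyadic_cubes by (rule countable_subset[rotated]) auto
    fix Q assume "Q \<in> {Q \<in> dyadic_cubes. Q \<subseteq> U}"
    then obtain c0 z0 where Q: "Q = dyadic_at c0 z0" "Q \<subseteq> U" using dyadic_cubesE by blast
    have "AE \<omega> in M. \<forall>\<^sub>F j in sequentially. 2 powr (real CARD('n) * (real_of_int (4 * int j) - real_of_int c0))
      \<le> 2 * real (card {x \<in> subcubes (4 * int j) Q. emeasure (Pm \<omega>) ({b j..1} \<times> x) \<noteq> 0})"
      using many_nonempty_cubes[of c0 z0] Q by simp
    then show "AE \<omega> in M. \<forall>c z. Q = dyadic_at c z \<longrightarrow>
      (\<forall>\<^sub>F j in sequentially. 2 powr (real CARD('n) * (real_of_int (4 * int j) - real_of_int c))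
      \<le> 2 * real (card {x \<in> subcubes (4 * int j) Q. emeasure (Pm \<omega>) ({b j..1} \<times> x) \<noteq> 0}))"
    proof eventually_elim
      case (elim \<omega>)
      show ?case
      proof (intro allI impI)
        fix c z assume "Q = dyadic_at c z"
        then have "c = c0" using Q(1) dyadic_at_eq_gen by metis
        then show "\<forall>\<^sub>F j in sequentially. 2 powr (real CARD('n) * (real_of_int (4 * int j) - real_of_int c))
          \<le> 2 * real (card {x \<in> subcubes (4 * int j) Q. emeasure (Pm \<omega>) ({b j..1} \<times> x) \<noteq> 0})"
          using elim by simp
      qed
    qed
  qed
  moreover have "AE \<omega> in M. \<forall>R::nat. \<exists>C. \<forall>\<^sub>F j in sequentially. \<exists>k::nat. emeasure (Pm \<omega>) ({b j<..1} \<times> (U \<inter> cball 0 (real R))) = of_nat k \<and> real k \<le> C * q j"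
    unfolding AE_all_countable
  proof
    fix R :: nat
    obtain C where "AE \<omega> in M. \<forall>\<^sub>F j in sequentially. \<exists>k::nat. emeasure (Pm \<omega>) ({b j<..1} \<times> (U \<inter> cball 0 (real R))) = of_nat k \<and> real k \<le> C * q j"
      by (rule few_large_radii)
    then show "AE \<omega> in M. \<exists>C. \<forall>\<^sub>F j in sequentially. \<exists>k::nat. emeasure (Pm \<omega>) ({b j<..1} \<times> (U \<inter> cball 0 (real R))) = of_nat k \<and> real k \<le> C * q j"
      by eventually_elim blast
  qed
  ultimately show ?thesis using AE_space
  proof eventually_elim
    case (elim \<omega>)
    note many = elim(1) and few = elim(2)
    have sP: "sets (Pm \<omega>) = sets \<pi>" and pm: "point_measure (Pm \<omega>)"
      using pp elim(3) by (auto simp: poisson_point_measure_def)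
    have spP: "space (Pm \<omega>) = {0<..1} \<times> U" using sets_eq_imp_space_eq[OF sP] space_\<pi> by simp
    obtain I P where P: "\<And>i. i \<in> I \<Longrightarrow> P i \<in> space (Pm \<omega>)"
      "\<And>E. E \<in> sets (Pm \<omega>) \<Longrightarrow> emeasure (Pm \<omega>) E = emeasure (count_space UNIV) {i \<in> (I::nat set). P i \<in> E}"
      using point_measureE[OF pm] by blast
    define rr where "rr i = fst (P i)" for i
    define xx where "xx i = snd (P i)" for i
    have Pi: "0 < rr i" "rr i \<le> 1" "xx i \<in> U" if "i \<in> I" for i
      using P(1)[OF that] by (auto simp: spP rr_def xx_def)
    have bs: "{b j..1} \<in> sets \<nu>" "{b j<..1} \<in> sets \<nu>" for j using b_bounds[of j] by (auto intro!: in_sets_\<nu>)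
    have ub: "ubiquity N I rr xx b U"
    proof
      show "is_norm N" by (rule norm)
      fix c :: int and z :: "real^'n" assume Q: "dyadic_at c z \<subseteq> U"
      have ev: "\<forall>\<^sub>F j in sequentially. 2 powr (real CARD('n) * (real_of_int (4 * int j) - real_of_int c))
        \<le> 2 * real (card {x \<in> subcubes (4 * int j) (dyadic_at c z). emeasure (Pm \<omega>) ({b j..1} \<times> x) \<noteq> 0})"
        using many Q dyadic_at_in by blast
      have "\<forall>\<^sub>F j in sequentially. j \<ge> nat c" by (rule eventually_ge_at_top)
      with ev show "\<forall>\<^sub>F j in sequentially. 2 powr (real CARD('n) * (real_of_int (4 * int j) - real_of_int c))
        \<le> 2 * real (card {q \<in> subcubes (4 * int j) (dyadic_at c z). \<exists>i\<in>I. b j \<le> rr i \<and> xx i \<in> q})"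
      proof eventually_elim
        case (elim j)
        have c: "c \<le> 4 * int j" using elim(2) by linarith
        have "{x \<in> subcubes (4 * int j) (dyadic_at c z). emeasure (Pm \<omega>) ({b j..1} \<times> x) \<noteq> 0}
          \<subseteq> {q \<in> subcubes (4 * int j) (dyadic_at c z). \<exists>i\<in>I. b j \<le> rr i \<and> xx i \<in> q}"
        proof safe
          fix x assume x: "x \<in> subcubes (4 * int j) (dyadic_at c z)" "emeasure (Pm \<omega>) ({b j..1} \<times> x) \<noteq> 0"
          have xU: "x \<subseteq> U" using subcubes_subset[OF c x(1)] Q by blast
          have xb: "x \<in> sets borel" using x(1) by (auto simp: subcubes_def)
          have "{b j..1} \<times> x \<in> sets (Pm \<omega>)" unfolding sP by (rule rectangle(1)[OF bs(1) xb xU])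
          then have "emeasure (count_space UNIV) {i \<in> I. P i \<in> {b j..1} \<times> x} \<noteq> 0" using x(2) P(2) by metis
          then have "{i \<in> I. P i \<in> {b j..1} \<times> x} \<noteq> {}" by (metis emeasure_empty)
          then show "\<exists>i\<in>I. b j \<le> rr i \<and> xx i \<in> x" by (auto simp: rr_def xx_def mem_Times_iff)
        qed
        then have "card {x \<in> subcubes (4 * int j) (dyadic_at c z). emeasure (Pm \<omega>) ({b j..1} \<times> x) \<noteq> 0}
          \<le> card {q \<in> subcubes (4 * int j) (dyadic_at c z). \<exists>i\<in>I. b j \<le> rr i \<and> xx i \<in> q}"
          using card_subcubes(1)[OF c, of z] by (intro card_mono) auto
        then show ?case using elim(1) by linarith
      qed
    qed
    have sp: "sparse N I rr xx b"
    proof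
      show "is_norm N" by (rule norm)
      show "\<And>i. i \<in> I \<Longrightarrow> 0 < rr i" "\<And>i. i \<in> I \<Longrightarrow> rr i \<le> 1" using Pi by auto
      show "\<And>j. 0 < b j" by (rule b_bounds)
      show "decseq b" by (rule decseq_b)
      show "b \<longlonglongrightarrow> 0" by (rule b_tendsto_0)
      fix R :: real
      obtain R' :: nat where R': "R \<le> real R'" using real_arch_simple by blast
      obtain C where C: "\<forall>\<^sub>F j in sequentially. \<exists>k::nat. emeasure (Pm \<omega>) ({b j<..1} \<times> (U \<inter> cball 0 (real R'))) = of_nat k \<and> real k \<le> C * q j"
        using few by blast
      show "\<exists>C. \<forall>\<^sub>F j in sequentially. finite {i \<in> I. b j < rr i \<and> norm (xx i) \<le> R} \<and>
        real (card {i \<in> I. b j < rr i \<and> norm (xx i) \<le> R}) \<le> C / cvol CARD('n) (4 * int j)"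
      proof (rule exI[of _ C], use C in eventually_elim)
        case (elim j)
        then obtain k :: nat where k: "emeasure (Pm \<omega>) ({b j<..1} \<times> (U \<inter> cball 0 (real R'))) = of_nat k" "real k \<le> C * q j" by blast
        have E': "{b j<..1} \<times> (U \<inter> cball 0 (real R')) \<in> sets (Pm \<omega>)" unfolding sP using U by (intro rectangle(1) bs) auto
        have e: "emeasure (count_space UNIV) {i \<in> I. P i \<in> {b j<..1} \<times> (U \<inter> cball 0 (real R'))} = of_nat k"
          using P(2)[OF E'] k(1) by simp
        have sub: "{i \<in> I. b j < rr i \<and> norm (xx i) \<le> R} \<subseteq> {i \<in> I. P i \<in> {b j<..1} \<times> (U \<inter> cball 0 (real R'))}"
          using Pi R' by (auto simp: mem_Times_iff rr_def xx_def)
        have fin: "finite {i \<in> I. P i \<in> {b j<..1} \<times> (U \<inter> cball 0 (real R'))}"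
        proof (rule ccontr)
          assume "infinite {i \<in> I. P i \<in> {b j<..1} \<times> (U \<inter> cball 0 (real R'))}"
          then have "emeasure (count_space UNIV) {i \<in> I. P i \<in> {b j<..1} \<times> (U \<inter> cball 0 (real R'))} = \<infinity>"
            by (intro emeasure_count_space_infinite) auto
          then show False unfolding e by (simp add: ennreal_of_nat_eq_real_of_nat)
        qed
        then have "card {i \<in> I. P i \<in> {b j<..1} \<times> (U \<inter> cball 0 (real R'))} = k"
          using e by (simp add: emeasure_count_space_finite)
        then have "card {i \<in> I. b j < rr i \<and> norm (xx i) \<le> R} \<le> k" using card_mono[OF fin sub] by simp
        then have "real (card {i \<in> I. b j < rr i \<and> norm (xx i) \<le> R}) \<le> C * q j" using k(2) by linarith
        then show ?case using finite_subset[OF sub fin] by (simp add: q_def)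
      qed
    qed
    have "F_set N (Pm \<omega>) = limsup_balls N I rr xx"
    proof -
      have "y \<in> F_set N (Pm \<omega>) \<longleftrightarrow> y \<in> limsup_balls N I rr xx" for y
      proof -
        define H where "H = {z \<in> space (Pm \<omega>). N (y - snd z) < fst z}"
        have m1: "fst \<in> borel_measurable \<pi>"
        proof -
          have "fst \<in> measurable \<pi> \<nu>" by (rule measurable_fst)
          moreover have "(\<lambda>r. r) \<in> borel_measurable \<nu>" by (intro mono_measurable_\<nu> mono_onI)
          ultimately show ?thesis using measurable_compose by blast
        qed
        have m2: "snd \<in> borel_measurable \<pi>"
        proof -
          have "snd \<in> measurable \<pi> (restrict_space lborel U)" by (rule measurable_snd)
          moreover have "(\<lambda>x. x) \<in> borel_measurable (restrict_space lborel U)" by (intro measurable_restrict_space1) auto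
          ultimately show ?thesis using measurable_compose by blast
        qed
        have "N \<in> borel_measurable borel" by (intro borel_measurable_continuous_onI is_norm_continuous norm)
        then have m3: "(\<lambda>z. N (y - snd z)) \<in> borel_measurable \<pi>" using m2 by measurable
        have "{z \<in> space \<pi>. N (y - snd z) < fst z} \<in> sets \<pi>" using m1 m3 by measurable
        then have H: "H \<in> sets (Pm \<omega>)" unfolding H_def sP sets_eq_imp_space_eq[OF sP] .
        have "(\<integral>\<^sup>+ z. indicator {(r, x). N (y - x) < r} z \<partial>Pm \<omega>) = (\<integral>\<^sup>+ z. indicator H z \<partial>Pm \<omega>)"
          by (intro nn_integral_cong) (auto simp: H_def indicator_def)
        also have "\<dots> = emeasure (Pm \<omega>) H" using H by simp
        also have "\<dots> = emeasure (count_space UNIV) {i \<in> I. P i \<in> H}" using H by (rule P(2))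
        also have "{i \<in> I. P i \<in> H} = {i \<in> I. N (y - xx i) < rr i}" using P(1) by (auto simp: H_def rr_def xx_def)
        finally show ?thesis
          by (simp add: F_set_def limsup_balls_def emeasure_count_space ennreal_of_nat_eq_real_of_nat)
      qed
      then show ?thesis by blast
    qed
    then show ?case using ub sp by blast
  qed
qed

end

section \<open>Describability\<close>

lemma nonempty_open_dyadic:
  fixes U :: "(real^'n) set"
  assumes "open U" "U \<noteq> {}"
  obtains c z where "e0 \<le> c" "dyadic_at c z \<subseteq> U"
proof -
  obtain z where z: "z \<in> U" using assms by blast
  obtain j0 where "\<And>j. j \<ge> j0 \<Longrightarrow> dyadic_at j z \<subseteq> U" using dyadic_at_in_open[OF assms(1) z] by blast
  then show ?thesis using that[of "max e0 j0" z] by simp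
qed

text \<open>One fixed realization: nothing random remains, \<open>b\<close> is the sequence
  determined by \<open>\<nu>\<close>, and all gauges are treated for this same realization.\<close>

locale describability =
  radius_measure \<nu> "CARD('n)" + ubiq: ubiquity N I rr xx b U + sparse N I rr xx b
  for \<nu> :: "real measure" and N :: "real^'n \<Rightarrow> real" and I rr xx U +
  assumes U: "open U" "U \<noteq> {}"
begin

abbreviation F :: "(real^'n) set" where "F \<equiv> limsup_balls N I rr xx"

lemma q_cvol: "x * q j = x / cvol CARD('n) (4 * int j)"
  by (simp add: q_def)

lemma F_eq_Inter_open:
  obtains G :: "nat \<Rightarrow> (real^'n) set" where "\<And>k. open (G k)" "F = \<Inter>(range G)"
proof
  show "open (\<Union>i\<in>I - {..<k}. {y. N (y - xx i) < rr i})" for k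
    using open_norm_ball[OF norm] by (intro open_UN) auto
  show "F = (\<Inter>k. \<Union>i\<in>I - {..<k}. {y. N (y - xx i) < rr i})"
  proof (rule set_eqI)
    show "y \<in> F \<longleftrightarrow> y \<in> (\<Inter>k. \<Union>i\<in>I - {..<k}. {y. N (y - xx i) < rr i})" for y
      unfolding limsup_balls_iff by simp
  qed
qed

lemma gdelta_F: "gdelta_in euclidean F"
proof -
  obtain G where G: "\<And>k::nat. open (G k)" "F = \<Inter>(range G)" using F_eq_Inter_open by blast
  show ?thesis unfolding G(2) using G(1) by (intro gdelta_in_Inter) (auto intro: open_imp_gdelta_in)
qed

lemma borel_F: "F \<in> sets borel"
proof -
  obtain G where G: "\<And>k::nat. open (G k)" "F = \<Inter>(range G)" using F_eq_Inter_open by blast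
  show ?thesis unfolding G(2) using G(1) by (intro sets.countable_INT) auto
qed

lemma regular_power: "regular d 1 (\<lambda>r. r ^ d)"
  by (auto simp: regular_def power_mono)

text \<open>A regular function is controlled only on \<open>(0, \<epsilon>]\<close>; holding it
  constant beyond \<open>\<epsilon>\<close> makes it monotone on all of \<open>(0, 1]\<close>, as
  the comparison of sum and integral requires.\<close>

lemma truncated_mono:
  assumes "regular d \<epsilon> f"
  shows "mono_on {0<..1} (\<lambda>r. f (min r \<epsilon>))" "\<And>r. 0 < r \<Longrightarrow> 0 < f (min r \<epsilon>)"
  using assms by (auto simp: regular_def mono_on_def min_def)

text \<open>The truncated \<open>f\<close> and the normalized \<open>g\<close> agree up to
  \<open>\<epsilon>\<close>, and on the rest, where \<open>\<nu>\<close> has finite mass, both are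
  bounded.\<close>

lemma summable_iff_integral:
  assumes reg: "regular CARD('n) \<epsilon> f" and dn: "\<And>r. 0 < r \<Longrightarrow> r \<le> \<epsilon> \<Longrightarrow> dnorm CARD('n) g (ennreal r) = ennreal (f r)"
  shows "summable (\<lambda>j. f (min (b j) \<epsilon>) * q j) \<longleftrightarrow> (\<integral>\<^sup>+ r. dnorm CARD('n) g (ennreal r) \<partial>\<nu>) < \<infinity>"
proof -
  let ?d = "CARD('n)"
  let ?w = "\<lambda>r. f (min r \<epsilon>)"
  note w = truncated_mono[OF reg]
  have w0: "\<And>r. 0 < r \<Longrightarrow> r \<le> 1 \<Longrightarrow> 0 \<le> ?w r" using w(2) less_imp_le by blast
  have eps: "\<epsilon> > 0" using reg by (simp add: regular_def)
  have iff: "summable (\<lambda>j. ?w (b j) * q j) \<longleftrightarrow> (\<integral>\<^sup>+ r. ennreal (?w r) \<partial>\<nu>) < \<infinity>"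
    using integral_finite_if_summable[OF w(1) w0] summable_if_integral_finite[OF w(1) w0] by blast
  have [measurable]: "?w \<in> borel_measurable \<nu>" using w(1) by (rule mono_measurable_\<nu>)
  define E where "E = {min \<epsilon> 1..1::real}"
  have E [measurable]: "E \<in> sets \<nu>" unfolding E_def using eps by (intro in_sets_\<nu>) auto
  have Efin: "emeasure \<nu> E < \<infinity>" unfolding E_def using eps by (intro finite_\<nu>) auto
  \<comment> \<open>\<open>f \<epsilon>\<close> bounds the truncation.
    \<open>f \<epsilon> / \<epsilon> ^ ?d\<close> bounds the normalization, whose infimum can only
    decrease beyond \<open>\<epsilon>\<close> while \<open>r ^ ?d \<le> 1\<close>.\<close>
  define K where "K = f \<epsilon> / \<epsilon> ^ ?d + f \<epsilon>"
  have f\<epsilon>: "0 < f \<epsilon>" using regularD(1)[OF reg eps order_refl order_refl] .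
  have K: "f \<epsilon> \<le> K" "f \<epsilon> / \<epsilon> ^ ?d \<le> K" using f\<epsilon> eps by (auto simp: K_def)
  have KE: "(\<integral>\<^sup>+ r. ennreal K * indicator E r \<partial>\<nu>) < \<infinity>"
    using Efin by (simp add: nn_integral_cmult_indicator ennreal_mult_less_top)
  have up: "dnorm ?d g (ennreal r) \<le> ennreal (?w r) + ennreal K * indicator E r" if r: "0 < r" "r \<le> 1" for r
  proof (cases "r \<le> \<epsilon>")
    case True
    then show ?thesis using dn[OF r(1)] by (simp add: min_def)
  next
    case False
    have "(INF \<rho>\<in>{0<..ennreal r}. g \<rho> / \<rho> ^ ?d) \<le> (INF \<rho>\<in>{0<..ennreal \<epsilon>}. g \<rho> / \<rho> ^ ?d)"
    proof (rule INF_superset_mono)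
      have "ennreal \<epsilon> \<le> ennreal r" using False by (intro ennreal_leI) simp
      then show "{0<..ennreal \<epsilon>} \<subseteq> {0<..ennreal r}" by (auto intro: order_trans)
    qed simp
    also have "\<dots> = ennreal (f \<epsilon> / \<epsilon> ^ ?d)"
    proof -
      let ?J = "INF \<rho>\<in>{0<..ennreal \<epsilon>}. g \<rho> / \<rho> ^ ?d"
      have "?J * ennreal (\<epsilon> ^ ?d) = ennreal (f \<epsilon>)"
        using dn[OF eps order_refl] dnorm_ennreal[OF eps, of ?d g] by (simp add: mult.commute)
      moreover have "?J * ennreal (\<epsilon> ^ ?d) / ennreal (\<epsilon> ^ ?d) = ?J" using eps by (intro mult_divide_eq_ennreal) auto
      ultimately have "?J = ennreal (f \<epsilon>) / ennreal (\<epsilon> ^ ?d)" by simp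
      then show ?thesis using eps f\<epsilon> by (simp add: divide_ennreal)
    qed
    finally have "dnorm ?d g (ennreal r) \<le> ennreal (r ^ ?d) * ennreal (f \<epsilon> / \<epsilon> ^ ?d)"
      unfolding dnorm_ennreal[OF r(1)] by (intro mult_left_mono) auto
    also have "\<dots> = ennreal (r ^ ?d * (f \<epsilon> / \<epsilon> ^ ?d))" using r f\<epsilon> eps by (intro ennreal_mult[symmetric]) auto
    also have "\<dots> \<le> ennreal (1 * K)"
      using r f\<epsilon> eps K by (intro ennreal_leI mult_mono power_le_one) auto
    also have "\<dots> = ennreal K * indicator E r" using False r by (simp add: E_def)
    finally show ?thesis by (rule order_trans) simp
  qed
  have lo: "ennreal (?w r) \<le> dnorm ?d g (ennreal r) * indicator (space \<nu> - E) r + ennreal K * indicator E r" if r: "0 < r" "r \<le> 1" for r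
  proof (cases "r \<in> E")
    case False
    then have "r \<le> \<epsilon>" using r by (auto simp: E_def min_def split: if_splits)
    then show ?thesis using dn[OF r(1)] False r by (simp add: min_def space_\<nu>)
  next
    case True
    have "?w r \<le> f \<epsilon>" using r eps by (intro regularD(2)[OF reg]) auto
    then show ?thesis using True K by (simp add: ennreal_leI)
  qed
  have "(\<integral>\<^sup>+ r. ennreal (?w r) \<partial>\<nu>) < \<infinity> \<longleftrightarrow> (\<integral>\<^sup>+ r. dnorm ?d g (ennreal r) \<partial>\<nu>) < \<infinity>"
  proof
    assume fin: "(\<integral>\<^sup>+ r. ennreal (?w r) \<partial>\<nu>) < \<infinity>"
    have "(\<integral>\<^sup>+ r. dnorm ?d g (ennreal r) \<partial>\<nu>) \<le> (\<integral>\<^sup>+ r. ennreal (?w r) + ennreal K * indicator E r \<partial>\<nu>)"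
      using up by (intro nn_integral_mono) (auto simp: space_\<nu>)
    also have "\<dots> = (\<integral>\<^sup>+ r. ennreal (?w r) \<partial>\<nu>) + (\<integral>\<^sup>+ r. ennreal K * indicator E r \<partial>\<nu>)"
      by (intro nn_integral_add) auto
    also have "\<dots> < \<infinity>" using fin KE by simp
    finally show "(\<integral>\<^sup>+ r. dnorm ?d g (ennreal r) \<partial>\<nu>) < \<infinity>" .
  next
    assume fin: "(\<integral>\<^sup>+ r. dnorm ?d g (ennreal r) \<partial>\<nu>) < \<infinity>"
    have "(\<integral>\<^sup>+ r. ennreal (?w r) \<partial>\<nu>) = (\<integral>\<^sup>+ r. ennreal (?w r) * indicator (space \<nu> - E) r + ennreal (?w r) * indicator E r \<partial>\<nu>)"
      by (intro nn_integral_cong) (auto simp: indicator_def)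
    also have "\<dots> = (\<integral>\<^sup>+ r. ennreal (?w r) * indicator (space \<nu> - E) r \<partial>\<nu>) + (\<integral>\<^sup>+ r. ennreal (?w r) * indicator E r \<partial>\<nu>)"
      by (intro nn_integral_add) auto
    also have "\<dots> \<le> (\<integral>\<^sup>+ r. dnorm ?d g (ennreal r) \<partial>\<nu>) + (\<integral>\<^sup>+ r. ennreal K * indicator E r \<partial>\<nu>)"
    proof (intro add_mono nn_integral_mono)
      fix r assume "r \<in> space \<nu>"
      then have r: "0 < r" "r \<le> 1" by (auto simp: space_\<nu>)
      show "ennreal (?w r) * indicator (space \<nu> - E) r \<le> dnorm ?d g (ennreal r)"
        using lo[OF r] by (auto simp: indicator_def split: if_splits)
      show "ennreal (?w r) * indicator E r \<le> ennreal K * indicator E r"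
        using lo[OF r] by (auto simp: indicator_def split: if_splits)
    qed
    also have "\<dots> < \<infinity>" using fin KE by simp
    finally show "(\<integral>\<^sup>+ r. ennreal (?w r) \<partial>\<nu>) < \<infinity>" .
  qed
  then show ?thesis using iff by blast
qed

lemma Rcls_d_iff: "\<nu> \<in> Rcls_d CARD('n) \<longleftrightarrow> summable (\<lambda>j. b j ^ CARD('n) * q j)"
proof -
  have m: "mono_on {0<..1} (\<lambda>r::real. r ^ CARD('n))" by (intro mono_onI power_mono) auto
  have nn: "0 \<le> r ^ CARD('n)" if "0 < r" "r \<le> 1" for r :: real using that by simp
  have "\<nu> \<in> Rcls_d CARD('n) \<longleftrightarrow> (\<integral>\<^sup>+ r. ennreal (r ^ CARD('n)) \<partial>\<nu>) < \<infinity>"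
    using \<nu> by (simp add: Rcls_d_def)
  then show ?thesis
    using integral_finite_if_summable[OF m nn] summable_if_integral_finite[OF m nn] by blast
qed

lemma full_measure_F:
  assumes "\<nu> \<notin> Rcls_d CARD('n)"
  shows "U - F \<in> null_sets lborel"
proof (rule ubiq.full_measure_of_divergence[OF U(1) b_bounds(1)])
  show "\<not> summable (\<lambda>j. b j ^ CARD('n) / cvol CARD('n) (4 * int j))"
    using assms unfolding Rcls_d_iff q_cvol by simp
qed

text \<open>For the power gauge the cost of a cube is a fixed multiple of its volume, so cheap
  coverings have small measure.\<close>

lemma null_F:
  assumes "\<nu> \<in> Rcls_d CARD('n)"
  shows "emeasure lborel F = 0"
proof -
  let ?d = "CARD('n)"
  have \<Delta>: "0 < unit_diam N" using ndiam_unit(2)[OF norm] .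
  have reg: "regular ?d 1 (\<lambda>r. r ^ ?d)" by (rule regular_power)
  have sum: "summable (\<lambda>j. (min (b j) 1) ^ ?d / cvol ?d (4 * int j))"
    using assms b_bounds(2) unfolding Rcls_d_iff q_cvol by (simp add: min_absorb1)
  define g :: "ennreal \<Rightarrow> ennreal" where "g r = r ^ ?d" for r
  have "\<exists>l::nat. ennreal (2 ^ (?d * l)) * g (ennreal (r / 2 ^ l)) \<le> ennreal (1 * r ^ ?d)" if "0 < r" "r \<le> 1" for r
    using that by (intro exI[of _ 0]) (simp add: g_def ennreal_power)
  then obtain \<rho> B where cov: "0 < \<rho>" "\<rho> \<le> 1" "0 \<le> B" "coverable N g (\<lambda>r. r ^ ?d) \<rho> B"
    using exists_coverable[OF norm reg, of 1 g] by auto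
  have "emeasure lborel F \<le> 0 + ennreal e" if e: "e > 0" for e
  proof -
    have e': "0 < e * unit_diam N ^ ?d" using e \<Delta> by simp
    obtain C where C: "C \<subseteq> dyadic_cubes" "F \<subseteq> \<Union>C" "\<And>K. K \<in> C \<Longrightarrow> ndiam N K \<le> ennreal 1"
      "dcost N g C \<le> ennreal (e * unit_diam N ^ ?d)"
      using cover_limsup[OF reg sum cov(4,1,2,3) e' zero_less_one] by blast
    have cC: "countable C" using C(1) countable_dyadic_cubes countable_subset by blast
    have vol: "ennreal (unit_diam N ^ ?d) * emeasure lborel K = g (ndiam N K)" if K: "K \<in> C" for K
    proof -
      obtain j x where K: "K = dyadic_at j x" using K C(1) dyadic_cubesE by blast
      have "unit_diam N ^ ?d * cvol ?d j = (unit_diam N * 2 powr (- real_of_int j)) ^ ?d"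
        by (simp only: cvol_power power_mult_distrib)
      then show ?thesis using \<Delta> unfolding K g_def ndiam_dyadic_at[OF norm] emeasure_dyadic_at
        by (subst ennreal_power) (auto simp: ennreal_mult[symmetric])
    qed
    have "ennreal (unit_diam N ^ ?d) * emeasure lborel F \<le> ennreal (unit_diam N ^ ?d) * emeasure lborel (\<Union>C)"
      using C(1,2) cC dyadic_cubes_borel by (intro mult_left_mono emeasure_mono sets.countable_Union) auto
    also have "\<dots> \<le> ennreal (unit_diam N ^ ?d) * (\<integral>\<^sup>+K. emeasure lborel K \<partial>count_space C)"
      using cC C(1) dyadic_cubes_borel by (intro mult_left_mono emeasure_Union_le_nn_integral) auto
    also have "\<dots> = (\<integral>\<^sup>+K. ennreal (unit_diam N ^ ?d) * emeasure lborel K \<partial>count_space C)"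
      by (simp add: nn_integral_cmult)
    also have "\<dots> = dcost N g C"
      unfolding cost_eq using vol by (intro nn_integral_cong) simp
    also have "\<dots> \<le> ennreal (unit_diam N ^ ?d) * ennreal e" using C(4) e \<Delta> by (simp add: ennreal_mult mult.commute)
    finally show ?thesis using \<Delta> by (subst (asm) ennreal_mult_le_mult_iff) auto
  qed
  then have "emeasure lborel F \<le> 0" by (rule ennreal_le_epsilon)
  then show ?thesis by simp
qed

text \<open>Coverings are priced by \<open>g\<close>, while the convergent sum concerns its
  normalization; \<open>gauge_refine\<close> bridges the two by using smaller cubes.\<close>

lemma hausdorff_zero:
  assumes g: "g \<in> gauges_inf CARD('n)" and fin: "(\<integral>\<^sup>+ r. dnorm CARD('n) g (ennreal r) \<partial>\<nu>) < \<infinity>"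
  shows "hausdorff_g N g (F \<inter> U) = 0"
proof -
  let ?d = "CARD('n)"
  obtain \<epsilon> f where f: "regular ?d \<epsilon> f" "\<And>r. 0 < r \<Longrightarrow> r \<le> \<epsilon> \<Longrightarrow> dnorm ?d g (ennreal r) = ennreal (f r)"
    "\<And>r s. 0 \<le> r \<Longrightarrow> r \<le> s \<Longrightarrow> s \<le> \<epsilon> \<Longrightarrow> g (ennreal r) \<le> g (ennreal s)"
    by (rule gauges_inf_regular[OF g]) (rule that; assumption)
  have sum: "summable (\<lambda>j. f (min (b j) \<epsilon>) / cvol ?d (4 * int j))"
    using summable_iff_integral[OF f(1,2)] fin by (simp add: q_cvol)
  have g0: "g 0 = 0" using g by (simp add: gauges_inf_def gauge_fun_def)
  have "\<exists>l::nat. ennreal (2 ^ (?d * l)) * g (ennreal (r / 2 ^ l)) \<le> ennreal (2 * 2 ^ ?d * f r)" if "0 < r" "r \<le> \<epsilon>" for r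
    by (rule gauge_refine[OF f that]; (assumption | (rule exI, assumption)))
  then obtain \<rho> B where cov: "0 < \<rho>" "\<rho> \<le> \<epsilon>" "0 \<le> B" "coverable N g f \<rho> B"
    using exists_coverable[OF norm f(1), of "2 * 2 ^ ?d" g] by auto
  have "hausdorff_pre N g \<delta> (F \<inter> U) \<le> 0 + ennreal e" if de: "\<delta> > 0" "e > 0" for \<delta> e
  proof -
    obtain C where C: "C \<subseteq> dyadic_cubes" "F \<subseteq> \<Union>C" "\<And>K. K \<in> C \<Longrightarrow> ndiam N K \<le> ennreal \<delta>"
      "dcost N g C \<le> ennreal e"
      using cover_limsup[OF f(1) sum cov(4,1,2,3) de(2,1)] by blast
    have "countable C" using C(1) countable_dyadic_cubes countable_subset by blast
    then obtain c where c: "\<And>n::nat. c n \<in> C \<or> c n = {}" "\<Union>C \<subseteq> (\<Union>n. c n)" "(\<Sum>n. g (ndiam N (c n))) \<le> dcost N g C"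
      using cost_sequence[of C "\<lambda>K. g (ndiam N K)"] g0 by auto
    have "ndiam N (c n) \<le> ennreal \<delta>" for n using c(1)[of n] C(3) by auto
    moreover have "F \<inter> U \<subseteq> (\<Union>n. c n)" using C(2) c(2) by blast
    ultimately have "hausdorff_pre N g \<delta> (F \<inter> U) \<le> (\<Sum>n. g (ndiam N (c n)))"
      unfolding hausdorff_pre_def by (intro INF_lower) simp
    then show ?thesis using c(3) C(4) by simp
  qed
  then have "hausdorff_pre N g \<delta> (F \<inter> U) \<le> 0" if "\<delta> > 0" for \<delta> using that ennreal_le_epsilon by blast
  then have "hausdorff_g N g (F \<inter> U) \<le> 0" unfolding hausdorff_g_def by (intro SUP_least) auto
  then show ?thesis by simp
qed

lemma exists_cost_ubiquity:
  assumes "regular CARD('n) \<epsilon> hr" "\<And>r. 0 < r \<Longrightarrow> r \<le> \<epsilon> \<Longrightarrow> h (ennreal r) = ennreal (hr r)"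
    "filterlim (\<lambda>r. hr r / r ^ CARD('n)) at_top (at_right 0)" "\<And>j. 0 < w j"
    "\<not> summable (\<lambda>j. w j * q j)" "filterlim (\<lambda>j. hr (b j) / w j) at_top sequentially" "0 < \<epsilon>'"
  obtains \<eta> e0 m e where "ubiquity_cost N I rr xx b U (\<lambda>K. h (ndiam N K)) \<eta> e0 m e"
    "\<And>j. e0 \<le> j \<Longrightarrow> unit_diam N * 2 powr (- real_of_int j) < \<epsilon>'" "\<And>j. e0 \<le> j \<Longrightarrow> 0 < \<eta> j"
proof -
  have "\<not> summable (\<lambda>j. w j / cvol CARD('n) (4 * int j))" using assms(5) by (simp add: q_cvol)
  from ubiq.exists_ubiquity_cost[OF assms(1-3) b_bounds(1) b_tendsto_0 assms(4) this assms(6,7)] that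
  show ?thesis by blast
qed

lemma ratio_tail:
  assumes "filterlim (\<lambda>r. hr r / f r) at_top (at_right (0::real))" "0 < \<epsilon>"
  shows "filterlim (\<lambda>j. hr (b j) / f (min (b j) \<epsilon>)) at_top sequentially"
proof -
  have lim: "filterlim b (at_right 0) sequentially"
    unfolding filterlim_at using b_tendsto_0 b_bounds(1) by (auto simp: less_imp_neq[symmetric])
  have ev: "\<forall>\<^sub>F j in sequentially. b j < \<epsilon>" using assms(2) by (intro order_tendstoD(2)[OF b_tendsto_0])
  have "filterlim (\<lambda>j. hr (b j) / f (b j)) at_top sequentially" by (rule filterlim_compose[OF assms(1) lim])
  then show ?thesis
    by (rule filterlim_cong[THEN iffD1, rotated -1]) (use ev in \<open>auto elim!: eventually_mono simp: min_def\<close>)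
qed

text \<open>The weights are the values of the normalized \<open>g\<close> at \<open>b j\<close>,
  whose sum diverges by \<open>summable_iff_integral\<close>; the room required by the covering
  estimate is the divergence of \<open>hr r / f r\<close>.\<close>

lemma large_intersection:
  assumes g: "g \<in> gauges_inf CARD('n)" and inf: "(\<integral>\<^sup>+ r. dnorm CARD('n) g (ennreal r) \<partial>\<nu>) = \<infinity>"
  shows "F \<in> large_int_class N g U"
  unfolding large_int_class_def
proof (intro CollectI conjI allI impI gdelta_F)
  fix h V assume hV: "gauge_fun h \<and> d_normalized CARD('n) h \<and> gauge_prec h (dnorm CARD('n) g) \<and> open V \<and> V \<subseteq> U"
  let ?d = "CARD('n)"
  obtain \<epsilon> f where f: "regular ?d \<epsilon> f" "\<And>r. 0 < r \<Longrightarrow> r \<le> \<epsilon> \<Longrightarrow> dnorm ?d g (ennreal r) = ennreal (f r)"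
    "filterlim (\<lambda>r. f r / r ^ ?d) at_top (at_right 0)"
    by (rule gauges_inf_regular[OF g]) (rule that; assumption)
  have eps: "\<epsilon> > 0" using f(1) by (simp add: regular_def)
  obtain \<epsilon>' hr where h: "regular ?d \<epsilon>' hr" "\<epsilon>' \<le> \<epsilon>" "\<And>r. 0 < r \<Longrightarrow> r \<le> \<epsilon>' \<Longrightarrow> h (ennreal r) = ennreal (hr r)"
    "filterlim (\<lambda>r. hr r / f r) at_top (at_right 0)" "ennreal \<epsilon>' \<le> eps_h ?d h"
  proof -
    have hh: "gauge_fun h" "d_normalized ?d h" "gauge_prec h (dnorm ?d g)" using hV by auto
    show ?thesis by (rule gauge_prec_regular[OF hh f(1,2)]; (assumption | (rule that; assumption)))
  qed
  have e': "\<epsilon>' > 0" using h(1) by (simp add: regular_def)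
  have "filterlim (\<lambda>r. hr r / f r * (f r / r ^ ?d)) at_top (at_right 0)"
    by (rule filterlim_at_top_mult_at_top[OF h(4) f(3)])
  moreover have "\<forall>\<^sub>F r in at_right 0. hr r / f r * (f r / r ^ ?d) = hr r / r ^ ?d"
    unfolding eventually_at_right_field
  proof (intro exI[of _ \<epsilon>] conjI allI impI eps)
    fix r assume "0 < r" "r < \<epsilon>"
    then have "f r \<noteq> 0" using regularD(1)[OF f(1), of r r] by simp
    then show "hr r / f r * (f r / r ^ ?d) = hr r / r ^ ?d" by simp
  qed
  ultimately have big: "filterlim (\<lambda>r. hr r / r ^ ?d) at_top (at_right 0)"
    using filterlim_cong[OF refl refl] by fast
  have w0: "0 < f (min (b j) \<epsilon>)" for j using truncated_mono(2)[OF f(1)] b_bounds(1) by blast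
  have div: "\<not> summable (\<lambda>j. f (min (b j) \<epsilon>) * q j)"
    using summable_iff_integral[OF f(1,2)] inf by simp
  obtain \<eta> e0 m e where uc: "ubiquity_cost N I rr xx b U (\<lambda>K. h (ndiam N K)) \<eta> e0 m e"
    and e0: "\<And>j. e0 \<le> j \<Longrightarrow> unit_diam N * 2 powr (- real_of_int j) < \<epsilon>'"
    by (rule exists_cost_ubiquity[OF h(1,3) big w0 div ratio_tail[OF h(4) eps] e']; (assumption | (rule that; assumption)))
  show "M_inf N h (F \<inter> V) = M_inf N h V"
  proof (rule ubiquity_cost.M_inf_limsup_set[OF uc refl])
    show "h 0 = 0" using hV by (simp add: gauge_fun_def)
    show "open V" "V \<subseteq> U" using hV by auto
    show "ennreal (unit_diam N * 2 powr (- real_of_int j)) < eps_h ?d h" if "e0 \<le> j" for j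
    proof -
      have "ennreal (unit_diam N * 2 powr (- real_of_int j)) < ennreal \<epsilon>'"
        using e0[OF that] ndiam_unit(2)[OF norm] by (simp add: ennreal_less_iff)
      then show ?thesis using h(5) by order
    qed
  qed
qed

text \<open>Take \<open>h\<close> from \<open>exists_smaller_gauge\<close>. A set \<open>F'\<close>
  of the class would have the same \<open>h\<close>-content in \<open>U\<close> as \<open>U\<close>
  itself, which is at least the price of a cube inside \<open>U\<close>; but \<open>F\<close> has
  coverings of arbitrarily small \<open>h\<close>-cost.\<close>

lemma no_large_intersection:
  assumes g: "g \<in> gauges_inf CARD('n)" and fin: "(\<integral>\<^sup>+ r. dnorm CARD('n) g (ennreal r) \<partial>\<nu>) < \<infinity>"
    and F': "F' \<in> large_int_class N g U" "F' \<subseteq> F"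
  shows False
proof -
  let ?d = "CARD('n)"
  obtain \<epsilon> f where f: "regular ?d \<epsilon> f" "\<And>r. 0 < r \<Longrightarrow> r \<le> \<epsilon> \<Longrightarrow> dnorm ?d g (ennreal r) = ennreal (f r)"
    "(f \<longlongrightarrow> 0) (at_right 0)"
    by (rule gauges_inf_regular[OF g]) (rule that; assumption)
  have eps: "\<epsilon> > 0" using f(1) by (simp add: regular_def)
  have sum: "summable (\<lambda>j. f (min (b j) \<epsilon>) * q j)"
    using summable_iff_integral[OF f(1,2)] fin by simp
  obtain h hr where h: "gauge_fun h" "d_normalized ?d h" "gauge_prec h (dnorm ?d g)" "regular ?d \<epsilon> hr"
    "\<And>r. 0 < r \<Longrightarrow> r \<le> \<epsilon> \<Longrightarrow> h (ennreal r) = ennreal (hr r)" "summable (\<lambda>j. hr (min (b j) \<epsilon>) * q j)"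
    "ennreal \<epsilon> \<le> eps_h ?d h"
    by (rule exists_smaller_gauge[OF f(1,2,3) b_bounds(1) q_pos sum]; (assumption | (rule that; assumption)))
  have h0: "h 0 = 0" using h(1) by (simp add: gauge_fun_def)
  have eh: "0 < eps_h ?d h" using h(7) eps by (metis ennreal_less_zero_iff order_less_le_trans)
  have meq: "M_inf N h (F' \<inter> U) = M_inf N h U"
    using F'(1) h(1-3) U(1) unfolding large_int_class_def by blast
  obtain e0 :: int where e0: "\<And>j. j \<ge> e0 \<Longrightarrow> unit_diam N * 2 powr (- real_of_int j) < \<epsilon>"
    using two_powr_small[OF eps] by blast
  obtain c z where Q: "e0 \<le> c" "dyadic_at c z \<subseteq> U" using nonempty_open_dyadic[OF U] by blast
  define t where "t = unit_diam N * 2 powr (- real_of_int c)"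
  have t: "0 < t" "t < \<epsilon>" using e0[OF Q(1)] ndiam_unit(2)[OF norm] by (auto simp: t_def)
  have diamQ: "ndiam N (dyadic_at c z) = ennreal t" by (simp add: ndiam_dyadic_at[OF norm] t_def)
  have ht: "h (ennreal t) = ennreal (hr t)" "0 < hr t" using h(5)[of t] regularD(1)[OF h(4), of t t] t by auto
  have vol_ratio: "ennreal (hr t) * emeasure lborel K \<le> ennreal (cvol ?d c) * h (ndiam N K)"
    if K: "K = dyadic_at j x" and cj: "c \<le> j" for K j x
  proof -
    define s where "s = unit_diam N * 2 powr (- real_of_int j)"
    have s: "0 < s" "s \<le> t" using cj ndiam_unit(2)[OF norm] unfolding s_def t_def by (auto intro!: mult_left_mono)
    have hs: "h (ndiam N K) = ennreal (hr s)" "0 < hr s"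
      using h(5)[of s] s t regularD(1)[OF h(4) s(1) order_refl] by (auto simp: K ndiam_dyadic_at[OF norm] s_def)
    have "hr t / t ^ ?d \<le> hr s / s ^ ?d" using regularD(3)[OF h(4) s] t by simp
    then have "hr t * s ^ ?d \<le> hr s * t ^ ?d" using s t by (simp add: field_simps)
    moreover have "s ^ ?d = unit_diam N ^ ?d * cvol ?d j" "t ^ ?d = unit_diam N ^ ?d * cvol ?d c"
      by (simp_all only: cvol_power power_mult_distrib s_def t_def)
    ultimately have "unit_diam N ^ ?d * (hr t * cvol ?d j) \<le> unit_diam N ^ ?d * (cvol ?d c * hr s)" by (simp only: mult_ac)
    then have "hr t * cvol ?d j \<le> cvol ?d c * hr s"
      using ndiam_unit(2)[OF norm] by (simp add: mult_le_cancel_left_pos)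
    then have "ennreal (hr t * cvol ?d j) \<le> ennreal (cvol ?d c * hr s)" by (rule ennreal_leI)
    then show ?thesis unfolding hs(1) unfolding K emeasure_dyadic_at using ht(2) hs(2) by (simp add: ennreal_mult)
  qed
  \<comment> \<open>A cover of the cube has a member containing it or covers it by cubes inside it,
    whose price per volume is no less.\<close>
  have lower: "ennreal (hr t) \<le> M_inf N h U"
  proof (rule M_inf_greatest)
    fix C assume C: "C \<subseteq> dyadic_cubes" "\<And>K. K \<in> C \<Longrightarrow> ndiam N K < eps_h ?d h" "U \<subseteq> \<Union>C"
    show "ennreal (hr t) \<le> dcost N h C"
    proof (cases "\<exists>K\<in>C. dyadic_at c z \<subseteq> K")
      case True
      then obtain K where K: "K \<in> C" "dyadic_at c z \<subseteq> K" by blast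
      \<comment> \<open>The diameter of \<open>K\<close> may exceed \<open>\<epsilon>\<close>, so
        monotonicity of \<open>h\<close> up to it is taken from the definition of
        \<open>eps_h\<close> as a supremum.\<close>
      obtain \<epsilon>2 where \<epsilon>2: "ndiam N K < \<epsilon>2" "mono_on {0..\<epsilon>2} h"
        using C(2)[OF K(1)] unfolding eps_h_def less_Sup_iff by blast
      have le: "ennreal t \<le> ndiam N K"
        unfolding diamQ[symmetric] ndiam_def using K(2) by (intro SUP_subset_mono) auto
      have "h (ennreal t) \<le> h (ndiam N K)"
        using le \<epsilon>2(1) by (intro mono_onD[OF \<epsilon>2(2)]) auto
      also have "\<dots> \<le> dcost N h C" using K(1) by (rule cost_ge[of K C "\<lambda>K. h (ndiam N K)"])
      finally show ?thesis using ht(1) by simp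
    next
      case False
      define C' where "C' = {K \<in> C. K \<subseteq> dyadic_at c z}"
      have cC: "countable C'" using C(1) countable_dyadic_cubes unfolding C'_def by (metis (no_types, lifting) countable_subset mem_Collect_eq subsetI subsetD)
      have cov: "dyadic_at c z \<subseteq> \<Union>C'"
      proof
        fix y assume y: "y \<in> dyadic_at c z"
        then obtain K where K: "K \<in> C" "y \<in> K" using Q(2) C(3) by blast
        then obtain j x where jx: "K = dyadic_at j x" using C(1) dyadic_cubesE by blast
        then have "K \<subseteq> dyadic_at c z" using dyadic_at_cases[of j x c z] False K y by blast
        then show "y \<in> \<Union>C'" using K by (auto simp: C'_def)
      qed
      have "ennreal (hr t) * ennreal (cvol ?d c) = ennreal (hr t) * emeasure lborel (dyadic_at c z)"
        by (simp add: emeasure_dyadic_at)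
      also have "\<dots> \<le> ennreal (hr t) * emeasure lborel (\<Union>C')"
        using cov cC C(1) dyadic_cubes_borel by (intro mult_left_mono emeasure_mono sets.countable_Union) (auto simp: C'_def)
      also have "\<dots> \<le> ennreal (hr t) * (\<integral>\<^sup>+K. emeasure lborel K \<partial>count_space C')"
        using cC C(1) dyadic_cubes_borel by (intro mult_left_mono emeasure_Union_le_nn_integral) (auto simp: C'_def)
      also have "\<dots> = (\<integral>\<^sup>+K. ennreal (hr t) * emeasure lborel K \<partial>count_space C')"
        by (simp add: nn_integral_cmult)
      also have "\<dots> \<le> (\<integral>\<^sup>+K. ennreal (cvol ?d c) * h (ndiam N K) \<partial>count_space C')"
      proof (rule nn_integral_mono)
        fix K assume "K \<in> space (count_space C')"
        then have K: "K \<in> C" "K \<subseteq> dyadic_at c z" by (auto simp: C'_def)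
        then obtain j x where jx: "K = dyadic_at j x" using C(1) dyadic_cubesE by blast
        then have "c \<le> j" using K dyadic_at_subset_gen by blast
        then show "ennreal (hr t) * emeasure lborel K \<le> ennreal (cvol ?d c) * h (ndiam N K)" using vol_ratio jx by blast
      qed
      also have "\<dots> = ennreal (cvol ?d c) * dcost N h C'" by (simp add: nn_integral_cmult cost_eq)
      finally have "ennreal (cvol ?d c) * ennreal (hr t) \<le> ennreal (cvol ?d c) * dcost N h C'"
        by (simp only: mult.commute)
      then have "ennreal (hr t) \<le> dcost N h C'" by (subst (asm) ennreal_mult_le_mult_iff) auto
      also have "\<dots> \<le> dcost N h C" by (intro cost_mono) (auto simp: C'_def)
      finally show ?thesis .
    qed
  qed
  have "\<exists>l::nat. ennreal (2 ^ (?d * l)) * h (ennreal (r / 2 ^ l)) \<le> ennreal (1 * hr r)" if "0 < r" "r \<le> \<epsilon>" for r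
    using h(5)[OF that] by (intro exI[of _ 0]) simp
  then obtain \<rho> B where cov: "0 < \<rho>" "\<rho> \<le> \<epsilon>" "0 \<le> B" "coverable N h hr \<rho> B"
    using exists_coverable[OF norm h(4), of 1 h] by auto
  have sum': "summable (\<lambda>j. hr (min (b j) \<epsilon>) / cvol ?d (4 * int j))" using h(6) by (simp add: q_cvol)
  \<comment> \<open>Half of \<open>\<epsilon>\<close> keeps the diameters strictly below
    \<open>eps_h\<close>, and a cost of half of \<open>hr t\<close> contradicts the lower
    bound.\<close>
  have ht2: "0 < hr t / 2" and e2: "0 < \<epsilon> / 2" using ht(2) eps by auto
  obtain C where C: "C \<subseteq> dyadic_cubes" "F \<subseteq> \<Union>C" "\<And>K. K \<in> C \<Longrightarrow> ndiam N K \<le> ennreal (\<epsilon> / 2)"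
    "dcost N h C \<le> ennreal (hr t / 2)"
    using cover_limsup[OF h(4) sum' cov(4,1,2,3) ht2 e2] by blast
  have "ennreal (\<epsilon> / 2) < ennreal \<epsilon>" using eps by (simp add: ennreal_less_iff)
  then have lt: "ennreal (\<epsilon> / 2) < eps_h ?d h" using h(7) by order
  have "M_inf N h (F' \<inter> U) \<le> dcost N h C"
    using C(1,2,3) lt F'(2) by (intro M_inf_le_cost h0 eh) (auto intro: order_le_less_trans)
  then have "ennreal (hr t) \<le> ennreal (hr t / 2)" using lower meq C(4) by order
  then show False using ht(2) by (simp add: ennreal_le_iff)
qed

text \<open>The Abel-Dini theorem. Over a stretch on which the partial sums more than double, the
  quotients add up to at least 1/2, so the tails of their series do not become small. The added 1
  keeps the denominators away from 0.\<close>

lemma abel_dini: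
  fixes a :: "nat \<Rightarrow> real"
  assumes a: "\<And>j. 0 < a j" and div: "\<not> summable a"
  shows "\<not> summable (\<lambda>j. a j / (1 + (\<Sum>i\<le>j. a i)))" "filterlim (\<lambda>j. 1 + (\<Sum>i\<le>j. a i)) at_top sequentially"
proof -
  define S where "S j = 1 + (\<Sum>i\<le>j. a i)" for j
  have S1: "1 \<le> S j" for j unfolding S_def using a by (simp add: sum_nonneg less_imp_le)
  have Smono: "mono S" unfolding S_def by (intro monoI add_left_mono sum_mono2) (auto intro: a less_imp_le)
  have unb: "\<exists>j. K < S j" for K
  proof (rule ccontr)
    assume "\<not> (\<exists>j. K < S j)"
    then have "(\<Sum>i\<le>j. a i) \<le> K" for j by (simp add: S_def not_less) (smt (verit, best))
    then have "summable a" using a by (intro bounded_imp_summable[where B = K]) (auto intro: less_imp_le)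
    then show False using div by blast
  qed
  show lim: "filterlim (\<lambda>j. 1 + (\<Sum>i\<le>j. a i)) at_top sequentially"
    unfolding S_def[symmetric] filterlim_at_top eventually_sequentially
  proof
    fix K
    obtain j where "K < S j" using unb by blast
    then have "\<forall>n\<ge>j. K \<le> S n" using monoD[OF Smono, of j] by (meson less_imp_le less_le_trans)
    then show "\<exists>j. \<forall>n\<ge>j. K \<le> S n" by blast
  qed
  show "\<not> summable (\<lambda>j. a j / (1 + (\<Sum>i\<le>j. a i)))"
    unfolding S_def[symmetric]
  proof
    assume sum: "summable (\<lambda>j. a j / S j)"
    have pos: "0 \<le> a j / S j" for j using a[of j] S1[of j] by simp
    obtain n where n: "\<And>m. m \<ge> n \<Longrightarrow> norm (\<Sum>i. a (i + m) / S (i + m)) < 1/2"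
      using suminf_exist_split[of "1/2" "\<lambda>j. a j / S j"] sum by auto
    obtain k where k: "2 * S n < S k" using unb by blast
    have nk: "n < k"
    proof (rule ccontr)
      assume "\<not> n < k"
      then have "S k \<le> S n" using monoD[OF Smono, of k n] by simp
      then show False using k S1[of n] by linarith
    qed
    have sum': "summable (\<lambda>i. a (i + Suc n) / S (i + Suc n))" by (rule summable_ignore_initial_segment[OF sum])
    have "1/2 \<le> (S k - S n) / S k" using k S1[of k] by (simp add: field_simps)
    also have "\<dots> = (\<Sum>i\<in>{Suc n..k}. a i) / S k"
    proof -
      have "{..k} = {..n} \<union> {Suc n..k}" using nk by auto
      then have "(\<Sum>i\<le>k. a i) = (\<Sum>i\<le>n. a i) + (\<Sum>i\<in>{Suc n..k}. a i)" by (simp add: sum.union_disjoint)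
      then show ?thesis by (simp add: S_def)
    qed
    also have "\<dots> = (\<Sum>i\<in>{Suc n..k}. a i / S k)" by (rule sum_divide_distrib)
    also have "\<dots> \<le> (\<Sum>i\<in>{Suc n..k}. a i / S i)"
      using a S1 monoD[OF Smono] by (intro sum_mono divide_left_mono mult_pos_pos) (auto intro: less_imp_le less_le_trans[OF zero_less_one])
    also have "\<dots> = (\<Sum>i<k - n. a (i + Suc n) / S (i + Suc n))"
      by (rule sum.reindex_bij_witness[of _ "\<lambda>i. i + Suc n" "\<lambda>i. i - Suc n"]) auto
    also have "\<dots> \<le> (\<Sum>i. a (i + Suc n) / S (i + Suc n))" using pos sum' by (intro sum_le_suminf) auto
    also have "\<dots> < 1/2" using n[of "Suc n"] by simp
    finally show False by simp
  qed
qed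

text \<open>The estimate for covers needs weights that are negligible against the gauge. Dividing by the
  partial sums of the divergent series provides them for the gauge itself.\<close>

lemma hausdorff_positive:
  assumes g: "g \<in> gauges_inf CARD('n)" and inf: "(\<integral>\<^sup>+ r. dnorm CARD('n) g (ennreal r) \<partial>\<nu>) = \<infinity>"
  shows "hausdorff_g N g (F \<inter> U) \<noteq> 0"
proof
  assume zero: "hausdorff_g N g (F \<inter> U) = 0"
  let ?d = "CARD('n)"
  obtain \<epsilon> f where f: "regular ?d \<epsilon> f" "\<And>r. 0 < r \<Longrightarrow> r \<le> \<epsilon> \<Longrightarrow> dnorm ?d g (ennreal r) = ennreal (f r)"
    "(f \<longlongrightarrow> 0) (at_right 0)" "filterlim (\<lambda>r. f r / r ^ ?d) at_top (at_right 0)"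
    by (rule gauges_inf_regular[OF g]) (rule that; assumption)
  have eps: "\<epsilon> > 0" using f(1) by (simp add: regular_def)
  define h where "h = dnorm ?d g"
  have hf: "h (ennreal r) = ennreal (f r)" if "0 < r" "r \<le> \<epsilon>" for r using f(2)[OF that] by (simp add: h_def)
  have h0: "h 0 = 0" by (simp add: h_def dnorm_def)
  have hg: "h (ennreal r) \<le> g (ennreal r)" if "0 < r" for r
  proof -
    have "h (ennreal r) \<le> ennreal (r ^ ?d) * (g (ennreal r) / ennreal r ^ ?d)"
      unfolding h_def dnorm_ennreal[OF that] using that by (intro mult_left_mono INF_lower) auto
    also have "\<dots> = g (ennreal r)" using that by (simp add: ennreal_power ennreal_times_divide ennreal_mult_divide_eq mult.commute)
    finally show ?thesis .
  qed
  have div: "\<not> summable (\<lambda>j. f (min (b j) \<epsilon>) * q j)" using summable_iff_integral[OF f(1,2)] inf by simp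
  have a0: "0 < f (min (b j) \<epsilon>) * q j" for j using truncated_mono(2)[OF f(1) b_bounds(1)] q_pos[of j] by simp
  define S where "S j = 1 + (\<Sum>i\<le>j. f (min (b i) \<epsilon>) * q i)" for j
  have S0: "0 < S j" for j unfolding S_def using a0 by (intro add_pos_nonneg sum_nonneg) (auto intro: less_imp_le)
  \<comment> \<open>Once \<open>b j < \<epsilon>\<close>, the quotient of \<open>f (b j)\<close> by
    \<open>w j\<close> is the partial sum \<open>S j\<close>, which tends to infinity.\<close>
  define w where "w j = f (min (b j) \<epsilon>) / S j" for j
  have w0: "0 < w j" for j using truncated_mono(2)[OF f(1) b_bounds(1), of j] S0[of j] by (simp add: w_def)
  have wdiv: "\<not> summable (\<lambda>j. w j * q j)" using abel_dini(1)[OF a0 div] by (simp add: w_def S_def)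
  have wlim: "filterlim (\<lambda>j. f (b j) / w j) at_top sequentially"
  proof -
    have "\<forall>\<^sub>F j in sequentially. b j < \<epsilon>" using eps by (intro order_tendstoD(2)[OF b_tendsto_0])
    then have "\<forall>\<^sub>F j in sequentially. S j = f (b j) / w j"
    proof eventually_elim
      case (elim j)
      then have "min (b j) \<epsilon> = b j" by simp
      moreover have "f (b j) \<noteq> 0" using regularD(1)[OF f(1) b_bounds(1) order_refl, of j] elim by simp
      ultimately show ?case by (simp add: w_def)
    qed
    moreover have "filterlim S at_top sequentially" using abel_dini(2)[OF a0 div] by (simp add: S_def[abs_def])
    ultimately show ?thesis using filterlim_cong[OF refl refl] by fast
  qed
  obtain \<eta> e0 m e where uc: "ubiquity_cost N I rr xx b U (\<lambda>K. h (ndiam N K)) \<eta> e0 m e"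
    and \<eta>: "\<And>j. e0 \<le> j \<Longrightarrow> 0 < \<eta> j"
    by (rule exists_cost_ubiquity[OF f(1) hf f(4) w0 wdiv wlim zero_less_one]; (assumption | (rule that; assumption)))
  obtain c z where Q: "e0 \<le> c" "dyadic_at c z \<subseteq> U" using nonempty_open_dyadic[OF U] by blast
  have hQ: "h (ndiam N (dyadic_at c z)) = \<eta> c" using ubiquity_cost.f[OF uc Q(1)] .
  define t where "t = unit_diam N * 2 powr (- real_of_int c)"
  have t: "0 < t" using ndiam_unit(2)[OF norm] by (simp add: t_def)
  have diamQ: "ndiam N (dyadic_at c z) = ennreal t" by (simp add: ndiam_dyadic_at[OF norm] t_def)
  have "\<exists>l::nat. ennreal (2 ^ (?d * l)) * h (ennreal (r / 2 ^ l)) \<le> ennreal (1 * f r)" if "0 < r" "r \<le> \<epsilon>" for r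
    using hf[OF that] by (intro exI[of _ 0]) simp
  then obtain \<rho> B where cov: "0 < \<rho>" "\<rho> \<le> \<epsilon>" "0 \<le> B" "coverable N h f \<rho> B"
    using exists_coverable[OF norm f(1), of 1 h] by auto
  define \<Delta> where "\<Delta> = unit_diam N"
  have \<Delta>: "0 < \<Delta>" using ndiam_unit(2)[OF norm] by (simp add: \<Delta>_def)
  \<comment> \<open>The second bound makes all cubes of the cover smaller in diameter than
    \<open>dyadic_at c z\<close>, so none can contain it.\<close>
  define \<delta> where "\<delta> = min \<rho> (t / (4 * \<Delta>))"
  have \<delta>: "0 < \<delta>" "\<delta> \<le> \<rho>" "2 * \<Delta> * \<delta> < t" using cov(1) t \<Delta> by (auto simp: \<delta>_def min_def field_simps)
  have \<eta>fin: "\<eta> c < \<infinity>" using ubiquity_cost.eta_fin[OF uc Q(1)] .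
  define \<kappa> where "\<kappa> = enn2real (\<eta> c)"
  have \<kappa>: "\<eta> c = ennreal \<kappa>" "0 < \<kappa>" using \<eta>fin \<eta>[OF Q(1)] by (auto simp: \<kappa>_def enn2real_positive_iff)
  \<comment> \<open>The cover will cost at most \<open>B * \<sigma>\<close>, and 32 times this is at
    most half the price \<open>\<kappa>\<close> of the cube.\<close>
  define \<sigma> where "\<sigma> = \<kappa> / (64 * (B + 1))"
  have \<sigma>: "0 < \<sigma>" using \<kappa>(2) cov(3) by (simp add: \<sigma>_def)
  have "hausdorff_pre N g \<delta> (F \<inter> U) \<le> hausdorff_g N g (F \<inter> U)"
    unfolding hausdorff_g_def using \<delta>(1) by (intro SUP_upper) auto
  then have "hausdorff_pre N g \<delta> (F \<inter> U) < ennreal (\<sigma> / 2)" using zero \<sigma> by simp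
  then obtain A :: "nat \<Rightarrow> (real^'n) set" where A: "F \<inter> U \<subseteq> (\<Union>n. A n)" "\<And>n. ndiam N (A n) \<le> ennreal \<delta>" "(\<Sum>n. g (ndiam N (A n))) < ennreal (\<sigma> / 2)"
    unfolding hausdorff_pre_def INF_less_iff by blast
  have "\<forall>n. \<exists>K. finite K \<and> K \<subseteq> dyadic_cubes \<and> A n \<subseteq> \<Union>K \<and> (\<forall>k\<in>K. ndiam N k < ennreal t) \<and>
    dcost N h K \<le> ennreal B * (g (ndiam N (A n)) + ennreal (\<sigma> / 2 * (1/2) ^ Suc n))"
  proof
    fix n
    define x where "x = \<sigma> / 2 * (1/2) ^ Suc n"
    have x: "0 < x" using \<sigma> by (simp add: x_def)
    \<comment> \<open>A set of diameter 0 costs nothing, but \<open>coverable\<close> needs a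
      positive \<open>r\<close>; the surplus \<open>x\<close>, summable in \<open>n\<close>, pays
      for it.\<close>
    have "\<exists>r. 0 < r \<and> r \<le> \<delta> \<and> ndiam N (A n) \<le> ennreal r \<and> ennreal (f r) \<le> g (ndiam N (A n)) + ennreal x"
    proof (cases "ndiam N (A n) = 0")
      case True
      have "\<forall>\<^sub>F r in at_right 0. f r < x" using x by (intro order_tendstoD(2)[OF f(3)])
      then obtain s where s: "s > 0" "\<And>r. 0 < r \<Longrightarrow> r < s \<Longrightarrow> f r < x" unfolding eventually_at_right_field by blast
      define r where "r = min (s / 2) \<delta>"
      have r: "0 < r" "r \<le> \<delta>" "f r < x" using s \<delta>(1) by (auto simp: r_def)
      have "ennreal (f r) \<le> ennreal x" using r(3) by (intro ennreal_leI) simp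
      also have "\<dots> \<le> g (ndiam N (A n)) + ennreal x" by simp
      finally show ?thesis using r True by (intro exI[of _ r]) auto
    next
      case False
      then obtain r where r: "ndiam N (A n) = ennreal r" "0 < r" "r \<le> \<delta>"
        using ennreal_le_realE[OF _ A(2)[of n]] by (metis not_gr_zero)
      have "ennreal (f r) = h (ennreal r)" using hf[of r] r \<delta>(2) cov(2) by simp
      also have "\<dots> \<le> g (ndiam N (A n))" using hg[OF r(2)] r(1) by simp
      also have "\<dots> \<le> g (ndiam N (A n)) + ennreal x" by simp
      finally show ?thesis using r by (intro exI[of _ r]) auto
    qed
    then obtain r where r: "0 < r" "r \<le> \<delta>" "ndiam N (A n) \<le> ennreal r" "ennreal (f r) \<le> g (ndiam N (A n)) + ennreal x" by blast
    obtain K where K: "finite K" "K \<subseteq> dyadic_cubes" "A n \<subseteq> \<Union>K" "\<forall>k\<in>K. ndiam N k \<le> ennreal (2 * unit_diam N * r)"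
      "(\<Sum>k\<in>K. h (ndiam N k)) \<le> ennreal (B * f r)"
      using cov(4)[unfolded coverable_def, rule_format, of r "A n"] r \<delta>(2) by auto
    have fr: "0 \<le> f r" using regularD(1)[OF f(1) r(1) order_refl] r(2) \<delta>(2) cov(2) by simp
    have "dcost N h K \<le> ennreal (B * f r)" using K(1,5) by (simp add: cost_finite_sum)
    also have "\<dots> = ennreal B * ennreal (f r)" using cov(3) fr by (rule ennreal_mult)
    also have "\<dots> \<le> ennreal B * (g (ndiam N (A n)) + ennreal x)" by (intro mult_left_mono r(4)) simp
    finally have cK: "dcost N h K \<le> ennreal B * (g (ndiam N (A n)) + ennreal x)" .
    have "ndiam N k < ennreal t" if "k \<in> K" for k
    proof -
      have "2 * \<Delta> * r \<le> 2 * \<Delta> * \<delta>" using r(2) \<Delta> by (intro mult_left_mono) auto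
      then have "2 * unit_diam N * r < t" using \<delta>(3) by (simp add: \<Delta>_def)
      then have "ennreal (2 * unit_diam N * r) < ennreal t" using t by (intro ennreal_lessI)
      then show ?thesis using K(4) that by (meson order_le_less_trans)
    qed
    then show "\<exists>K. finite K \<and> K \<subseteq> dyadic_cubes \<and> A n \<subseteq> \<Union>K \<and> (\<forall>k\<in>K. ndiam N k < ennreal t) \<and>
      dcost N h K \<le> ennreal B * (g (ndiam N (A n)) + ennreal (\<sigma> / 2 * (1/2) ^ Suc n))"
      using K(1-3) cK unfolding x_def by blast
  qed
  from choice[OF this] obtain KK where KK0: "\<forall>n. finite (KK n) \<and> KK n \<subseteq> dyadic_cubes \<and> A n \<subseteq> \<Union>(KK n) \<and> (\<forall>k\<in>KK n. ndiam N k < ennreal t) \<and>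
    dcost N h (KK n) \<le> ennreal B * (g (ndiam N (A n)) + ennreal (\<sigma> / 2 * (1/2) ^ Suc n))" ..
  have KK: "KK n \<subseteq> dyadic_cubes" "A n \<subseteq> \<Union>(KK n)" "k \<in> KK n \<Longrightarrow> ndiam N k < ennreal t"
    "dcost N h (KK n) \<le> ennreal B * (g (ndiam N (A n)) + ennreal (\<sigma> / 2 * (1/2) ^ Suc n))" for n k
    using KK0[rule_format, of n] by auto
  define C where "C = (\<Union>n. KK n)"
  have C: "C \<subseteq> dyadic_cubes" "F \<inter> U \<subseteq> \<Union>C"
  proof -
    show "C \<subseteq> dyadic_cubes" unfolding C_def by (intro UN_least KK(1))
    show "F \<inter> U \<subseteq> \<Union>C"
    proof
      fix y assume "y \<in> F \<inter> U"
      then obtain n where "y \<in> A n" using A(1) by auto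
      then have "y \<in> \<Union>(KK n)" using KK(2) by (rule subsetD[rotated])
      then show "y \<in> \<Union>C" by (auto simp: C_def)
    qed
  qed
  have "dcost N h C \<le> (\<Sum>n. dcost N h (KK n))" unfolding C_def by (rule cost_UN_le)
  also have "\<dots> \<le> (\<Sum>n. ennreal B * (g (ndiam N (A n)) + ennreal (\<sigma> / 2 * (1/2) ^ Suc n)))" by (intro suminf_le KK(4)) auto
  also have "\<dots> = ennreal B * ((\<Sum>n. g (ndiam N (A n))) + (\<Sum>n. ennreal (\<sigma> / 2 * (1/2) ^ Suc n)))"
    by (simp only: ennreal_suminf_cmult suminf_add[OF summableI summableI, symmetric])
  also have "(\<Sum>n. ennreal (\<sigma> / 2 * (1/2) ^ Suc n)) = ennreal (\<sigma> / 2 * 1)"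
    using \<sigma> by (intro suminf_ennreal_eq sums_mult power_half_series) auto
  also have "ennreal B * ((\<Sum>n. g (ndiam N (A n))) + ennreal (\<sigma> / 2 * 1)) \<le> ennreal B * (ennreal (\<sigma> / 2) + ennreal (\<sigma> / 2 * 1))"
    using A(3) by (intro mult_left_mono add_right_mono) auto
  also have "\<dots> = ennreal (B * \<sigma>)" using \<sigma> cov(3) by (simp add: ennreal_mult flip: ennreal_plus)
  finally have cost: "dcost N h C \<le> ennreal (B * \<sigma>)" .
  have sub: "F \<inter> dyadic_at c z \<subseteq> \<Union>C" using C(2) Q(2) by blast
  show False
  proof (rule ubiquity_cost.cover_cost[OF uc C(1) Q sub])
    fix K assume K: "K \<in> C" "dyadic_at c z \<subseteq> K"
    have "ennreal t \<le> ndiam N K" unfolding diamQ[symmetric] ndiam_def using K(2) by (intro SUP_subset_mono) auto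
    moreover have "ndiam N K < ennreal t" using K(1) KK(3) by (auto simp: C_def)
    ultimately show False by order
  next
    assume "h (ndiam N (dyadic_at c z)) \<le> 32 * dcost N h {K \<in> C. K \<subseteq> dyadic_at c z}"
    also have "\<dots> \<le> 32 * dcost N h C" by (intro mult_left_mono cost_mono) auto
    also have "\<dots> \<le> 32 * ennreal (B * \<sigma>)" using cost by (intro mult_left_mono) auto
    also have "\<dots> = ennreal (32 * (B * \<sigma>))" using cov(3) \<sigma> by (simp add: ennreal_mult)
    finally have "\<kappa> \<le> 32 * (B * \<sigma>)" using \<kappa> cov(3) \<sigma> unfolding hQ by (simp add: ennreal_le_iff)
    also have "\<dots> = \<kappa> / 2 * (B / (B + 1))" using cov(3) by (simp add: \<sigma>_def divide_simps)
    also have "\<dots> \<le> \<kappa> / 2 * 1" using \<kappa>(2) cov(3) by (intro mult_left_mono) auto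
    finally show False using \<kappa>(2) by simp
  qed
qed

theorem nu_describable_F:
  assumes "\<nu> \<in> Rcls_d CARD('n)"
  shows "nu_describable N \<nu> F U"
proof -
  have "emeasure lborel (F \<inter> U) \<le> emeasure lborel F" using borel_F by (intro emeasure_mono) auto
  then have Z: "F \<in> Zcls U" using null_F[OF assms] borel_F by (simp add: Zcls_def)
  have fin: "(\<integral>\<^sup>+ r. dnorm CARD('n) g (ennreal r) \<partial>\<nu>) < \<infinity>" if "g \<in> gauges_inf CARD('n) - gauges_nu CARD('n) \<nu>" for g
    using that by (auto simp: gauges_nu_def top.not_eq_extremum)
  have "majorizing N F U = gauges_inf CARD('n) - gauges_nu CARD('n) \<nu>"
  proof
    show "majorizing N F U \<subseteq> gauges_inf CARD('n) - gauges_nu CARD('n) \<nu>"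
      using hausdorff_positive by (auto simp: majorizing_def gauges_nu_def)
    show "gauges_inf CARD('n) - gauges_nu CARD('n) \<nu> \<subseteq> majorizing N F U"
      using hausdorff_zero fin by (auto simp: majorizing_def)
  qed
  moreover have "minorizing N F U \<inter> gauges_inf CARD('n) = gauges_nu CARD('n) \<nu>"
  proof
    show "minorizing N F U \<inter> gauges_inf CARD('n) \<subseteq> gauges_nu CARD('n) \<nu>"
    proof
      fix g assume g: "g \<in> minorizing N F U \<inter> gauges_inf CARD('n)"
      then obtain F' where "F' \<in> large_int_class N g U" "F' \<subseteq> F" by (auto simp: minorizing_def)
      then show "g \<in> gauges_nu CARD('n) \<nu>" using no_large_intersection[of g F'] fin[of g] g by blast
    qed
    show "gauges_nu CARD('n) \<nu> \<subseteq> minorizing N F U \<inter> gauges_inf CARD('n)"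
    proof
      fix g assume g: "g \<in> gauges_nu CARD('n) \<nu>"
      then have "g \<in> gauges_inf CARD('n)" "F \<in> large_int_class N g U"
        using large_intersection by (auto simp: gauges_nu_def)
      then show "g \<in> minorizing N F U \<inter> gauges_inf CARD('n)"
        by (auto simp: minorizing_def gauges_inf_def gauges_star_def)
    qed
  qed
  ultimately show ?thesis using Z by (simp add: nu_describable_def)
qed

end

theorem theorem14p1:
  fixes N :: "real^'n \<Rightarrow> real" and \<nu> :: "real measure" and U :: "(real^'n) set"
    and M :: "'w measure" and Pm :: "'w \<Rightarrow> (real \<times> (real^'n)) measure"
  assumes "is_norm N"
    and "\<nu> \<in> Rcls"
    and "open U" and "U \<noteq> {}"
    and "poisson_point_measure M Pm (\<nu> \<Otimes>\<^sub>M restrict_space lborel U)"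
  shows "(\<nu> \<notin> Rcls_d CARD('n) \<longrightarrow>
            (AE \<omega> in M. U - F_set N (Pm \<omega>) \<in> null_sets lebesgue))
       \<and> (\<nu> \<in> Rcls_d CARD('n) \<longrightarrow>
            (AE \<omega> in M. nu_describable N \<nu> (F_set N (Pm \<omega>)) U))"
proof -
  interpret poisson_balls N \<nu> U M Pm using assms by unfold_locales
  have "AE \<omega> in M. (\<nu> \<notin> Rcls_d CARD('n) \<longrightarrow> U - F_set N (Pm \<omega>) \<in> null_sets lebesgue) \<and>
      (\<nu> \<in> Rcls_d CARD('n) \<longrightarrow> nu_describable N \<nu> (F_set N (Pm \<omega>)) U)"
    using AE_ubiquity
  proof eventually_elim
    case (elim \<omega>)
    then obtain I rr xx where *: "ubiquity N I rr xx b U" "sparse N I rr xx b" "F_set N (Pm \<omega>) = limsup_balls N I rr xx"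
      by blast
    interpret D: describability \<nu> N I rr xx U
      by (intro describability.intro describability_axioms.intro radius_measure_axioms * assms)
    show ?case using D.full_measure_F D.nu_describable_F *(3) by (auto intro: null_sets_completionI)
  qed
  then show ?thesis by (auto elim: eventually_mono)
qed

end
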